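(* Let $\kappa>0$ and $0<\theta\le1$. Let $B$ be the convolution operator with Lorentz kernel $b(x,y)=\frac{1}{\kappa\pi}\frac{1}{1+(x-y)^2/\kappa^2}$, let $\psi(\lambda)=\exp\left(\theta\left(\frac{\log\lambda}{2\kappa}\right)^2+\sqrt8\,(1-\theta)\frac{\log\lambda}{2\kappa}\right)$ for $\lambda\ge1$, let $g$ be a Voigt spectrum with parameter $\theta$, let $f\in L_2(\mathbb{R})$ be the solution of $Bf=g$, and let $M\ge0$. Then there exists $\epsilon_0>0$ such that for every $0<\epsilon<\epsilon_0$ and every $f_\alpha\in L_2(\mathbb{R})$ with $\|Bf_\alpha\|_\psi\le M$ and $\|Bf_\alpha-g\|=\epsilon$ one has $$\|f_\alpha-f\|\le \epsilon^{\,1-2\kappa/\sqrt{\theta|\log\epsilon|+(1-\theta)^2}} .$$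
   Context: $\|\cdot\|$ and $(\cdot,\cdot)$ denote the norm and inner product of $L_2(\mathbb{R})$. The operator is $Bf(x)=\int_{\mathbb{R}}b(x,y)f(y)\,dy$ on $L_2(\mathbb{R})$, i.e. multiplication by $\exp(-\kappa|\omega|)$ in the Fourier domain. Let $\hat a_G(\omega)=\exp(-\omega^2/2)$ and $\hat a_L(\omega)=\exp(-\sqrt2|\omega|)$ (the Fourier transforms of the Gaussian kernel $\frac1{\sqrt{2\pi}}e^{-(x-y)^2/2}$ and of the Lorentz kernel $\frac{1}{\sqrt2\pi}\frac{1}{1+(x-y)^2/2}$). For $0<\theta\le1$ set $\hat a_V(\omega)=\hat a_G(\omega)^\theta\,\hat a_L(\omega)^{1-\theta}$ and $a_V(x,y)=\frac1{2\pi}\int_{\mathbb{R}}e^{i\omega(x-y)}\hat a_V(\omega)\,d\omega$. A Voigt spectrum with (mixing) parameter $\theta$ is a function $g(x)=\int_{\mathbb{R}}a_V(x,y)u(y)\,dy$ for some $u\in L_2(\mathbb{R})$. $H_\psi$ is the space of $g\in L_2(\mathbb{R})$ for which $\|g\|_\psi^2=(g,\psi((BB^* )^{-1})g)$ is finite, with $\psi((BB^* )^{-1})$ defined by the spectral theorem; $\|Bf_\alpha\|_\psi\le M$ includes the requirement $Bf_\alpha\in H_\psi$. A spectrum $f_\alpha$ satisfying $\|Bf_\alpha\|_\psi\le M$ and $\|Bf_\alpha-g\|=\epsilon$ is called stably computed (stably enhanced with $B$). *)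

theory Defs
  imports "HOL-Analysis.Analysis"
begin

section \<open>The space of square-integrable functions\<close>

text \<open>
  Elements of \<open>L\<^sub>2(M)\<close> are represented by measurable functions; equality in \<open>L\<^sub>2(M)\<close> is
  equality almost everywhere.
\<close>

definition L2 :: "'a measure \<Rightarrow> ('a \<Rightarrow> complex) set" where
  "L2 M = {f \<in> borel_measurable M. integrable M (\<lambda>x. (norm (f x))\<^sup>2)}"

definition L2_inner :: "'a measure \<Rightarrow> ('a \<Rightarrow> complex) \<Rightarrow> ('a \<Rightarrow> complex) \<Rightarrow> complex" where
  "L2_inner M f g = (LINT x|M. f x * cnj (g x))"

definition L2_norm :: "'a measure \<Rightarrow> ('a \<Rightarrow> complex) \<Rightarrow> real" where
  "L2_norm M f = sqrt (LINT x|M. (norm (f x))\<^sup>2)"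

section \<open>Operators on \<open>L\<^sub>2(\<real>)\<close>\<close>

definition int_op :: "(real \<Rightarrow> real \<Rightarrow> complex) \<Rightarrow> (real \<Rightarrow> complex) \<Rightarrow> real \<Rightarrow> complex" where
  "int_op k f = (\<lambda>x. LINT y|lborel. k x y * f y)"

text \<open>
  A possibly unbounded operator is given by its graph, a relation that is closed under
  almost-everywhere equality in both components. Composition of operators is then relational
  composition (in the reverse order) and the inverse is the converse relation.
\<close>

type_synonym l2_operator = "((real \<Rightarrow> complex) \<times> (real \<Rightarrow> complex)) set"

definition op_graph :: "((real \<Rightarrow> complex) \<Rightarrow> real \<Rightarrow> complex) \<Rightarrow> l2_operator" where
  "op_graph T = {(f, h). f \<in> L2 lborel \<and> h \<in> L2 lborel \<and> (AE x in lborel. h x = T f x)}"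

definition op_adjoint :: "l2_operator \<Rightarrow> l2_operator" where
  "op_adjoint T = {(f, h). f \<in> L2 lborel \<and> h \<in> L2 lborel \<and>
     (\<forall>(u, v) \<in> T. L2_inner lborel v f = L2_inner lborel u h)}"

section \<open>Functional calculus of a self-adjoint operator\<close>

text \<open>
  The multiplication-operator form of the spectral theorem: a self-adjoint \<open>A\<close> is unitarily
  equivalent, via \<open>U\<close>, to multiplication by a real function \<open>m\<close> on some \<open>L\<^sub>2(N)\<close>.
  Preservation of inner products and surjectivity make \<open>U\<close> unitary; linearity and
  compatibility with almost-everywhere equality follow. The domain of \<open>A\<close> comes out as
  \<open>{f. m \<cdot> U f \<in> L\<^sub>2(N)}\<close>, because \<open>U\<close> is onto.
\<close>

definition diagonalizes ::
  "real measure \<Rightarrow> ((real \<Rightarrow> complex) \<Rightarrow> real \<Rightarrow> complex) \<Rightarrow> (real \<Rightarrow> real) \<Rightarrow> l2_operator \<Rightarrow> bool"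
where
  "diagonalizes N U m A \<longleftrightarrow>
     sigma_finite_measure N \<and> m \<in> borel_measurable N \<and>
     (\<forall>f \<in> L2 lborel. U f \<in> L2 N) \<and>
     (\<forall>f \<in> L2 lborel. \<forall>g \<in> L2 lborel. L2_inner N (U f) (U g) = L2_inner lborel f g) \<and>
     (\<forall>v \<in> L2 N. \<exists>f \<in> L2 lborel. AE x in N. U f x = v x) \<and>
     A = {(f, h). f \<in> L2 lborel \<and> h \<in> L2 lborel \<and>
            (AE x in N. U h x = complex_of_real (m x) * U f x)}"

definition diagonalization ::
  "l2_operator \<Rightarrow> real measure \<times> ((real \<Rightarrow> complex) \<Rightarrow> real \<Rightarrow> complex) \<times> (real \<Rightarrow> real)" where
  "diagonalization A = (SOME (N, U, m). diagonalizes N U m A)"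

text \<open>
  The functional calculus is \<open>\<psi>(A) = U\<^sup>* M\<^sub>\<psi>\<^sub>\<circ>\<^sub>m U\<close>, so for \<open>\<psi> \<ge> 0\<close> the quadratic form
  \<open>(g, \<psi>(A) g)\<close> is the following extended nonnegative number. Its value does not depend on
  the diagonalization chosen.
\<close>

definition spectral_form :: "l2_operator \<Rightarrow> (real \<Rightarrow> real) \<Rightarrow> (real \<Rightarrow> complex) \<Rightarrow> ennreal" where
  "spectral_form A \<psi> g = (case diagonalization A of (N, U, m) \<Rightarrow>
     \<integral>\<^sup>+x. ennreal (\<psi> (m x) * (norm (U g x))\<^sup>2) \<partial>N)"

definition H_space :: "l2_operator \<Rightarrow> (real \<Rightarrow> real) \<Rightarrow> (real \<Rightarrow> complex) set" where
  "H_space A \<psi> = {g \<in> L2 lborel. spectral_form A \<psi> g < \<infinity>}"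

definition H_norm :: "l2_operator \<Rightarrow> (real \<Rightarrow> real) \<Rightarrow> (real \<Rightarrow> complex) \<Rightarrow> real" where
  "H_norm A \<psi> g = sqrt (enn2real (spectral_form A \<psi> g))"

section \<open>The Lorentz operator and Voigt spectra\<close>

definition lorentz_kernel :: "real \<Rightarrow> real \<Rightarrow> real \<Rightarrow> complex" where
  "lorentz_kernel \<kappa> x y = complex_of_real (1 / (\<kappa> * pi) * (1 / (1 + (x - y)\<^sup>2 / \<kappa>\<^sup>2)))"

definition lorentz_op :: "real \<Rightarrow> (real \<Rightarrow> complex) \<Rightarrow> real \<Rightarrow> complex" where
  "lorentz_op \<kappa> = int_op (lorentz_kernel \<kappa>)"

text \<open>\<open>(B B\<^sup>*)\<^sup>-\<^sup>1\<close> for the Lorentz operator \<open>B\<close>; its spectrum is \<open>[1,\<infinity>)\<close>.\<close>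

definition BB_adj_inv :: "real \<Rightarrow> l2_operator" where
  "BB_adj_inv \<kappa> = (op_adjoint (op_graph (lorentz_op \<kappa>)) O op_graph (lorentz_op \<kappa>))\<inverse>"

text \<open>Only the values for \<open>t \<ge> 1\<close>, i.e. on the spectrum of \<open>(B B\<^sup>*)\<^sup>-\<^sup>1\<close>, matter.\<close>

definition psi :: "real \<Rightarrow> real \<Rightarrow> real \<Rightarrow> real" where
  "psi \<kappa> \<theta> t = exp (\<theta> * (ln t / (2 * \<kappa>))\<^sup>2 + sqrt 8 * (1 - \<theta>) * (ln t / (2 * \<kappa>)))"

definition gauss_hat :: "real \<Rightarrow> real" where
  "gauss_hat \<omega> = exp (- \<omega>\<^sup>2 / 2)"

definition lorentz_hat :: "real \<Rightarrow> real" where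
  "lorentz_hat \<omega> = exp (- sqrt 2 * \<bar>\<omega>\<bar>)"

definition voigt_hat :: "real \<Rightarrow> real \<Rightarrow> real" where
  "voigt_hat \<theta> \<omega> = gauss_hat \<omega> powr \<theta> * lorentz_hat \<omega> powr (1 - \<theta>)"

definition voigt_kernel :: "real \<Rightarrow> real \<Rightarrow> real \<Rightarrow> complex" where
  "voigt_kernel \<theta> x y = complex_of_real (1 / (2 * pi)) *
     (LINT \<omega>|lborel. exp (\<i> * complex_of_real (\<omega> * (x - y))) * complex_of_real (voigt_hat \<theta> \<omega>))"

definition voigt_spectrum :: "real \<Rightarrow> (real \<Rightarrow> complex) \<Rightarrow> bool" where
  "voigt_spectrum \<theta> g \<longleftrightarrow> g \<in> L2 lborel \<and>
     (\<exists>u \<in> L2 lborel. AE x in lborel. g x = int_op (voigt_kernel \<theta>) u x)"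

end

theory Submission
  imports Defs "HOL-Probability.Sinc_Integral"
begin

text \<open>
  In the Fourier domain \<open>B\<close> is multiplication by \<open>exp (- \<kappa> |\<omega>|)\<close>, so the form
  of \<open>\<psi> ((BB\<^sup>*)\<^sup>-\<^sup>1)\<close> is integration against the weight
  \<open>exp (\<theta> \<omega>\<^sup>2 + sqrt 8 (1 - \<theta>) |\<omega>|)\<close>. This weight is the inverse square of the
  Voigt multiplier, hence a Voigt spectrum \<open>g\<close> has finite \<open>\<psi>\<close>-norm, and the
  \<open>\<psi>\<close>-norm of the residual \<open>B f\<^sub>\<alpha> - g\<close> is bounded by a constant that depends
  on \<open>M\<close> and \<open>g\<close> only. To recover \<open>f\<^sub>\<alpha> - f\<close>, the residual is
  amplified by \<open>exp (\<kappa> |\<omega>|)\<close>. Up to a cutoff frequency \<open>\<Omega>\<close> this costs at most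
  \<open>exp (\<kappa> \<Omega>)\<close>, and beyond \<open>\<Omega>\<close> the weight wins (\<open>cutoff_estimate\<close>).
  With \<open>\<Omega>\<close> equal to \<open>3/2 * sqrt (|ln \<epsilon>| / \<theta>)\<close> the high frequencies contribute
  less than the low ones, and the amplification is smaller than the stated rate permits
  (\<open>rate_asymptotics\<close>). Every factor
  between \<open>sqrt 2\<close> and \<open>2\<close> would serve in place of \<open>3/2\<close>; this slack absorbs
  all constants for small \<open>\<epsilon>\<close>.

  The argument rests on two facts. The first is Plancherel's theorem. The transform is the
  closed linear relation \<open>FT\<close> generated by the indicator functions of intervals. It is
  isometric because of the Fejer integral \<open>\<integral> (1 - cos (t \<omega>)) / \<omega>\<^sup>2 d\<omega> = \<pi> |t|\<close>
  (\<open>fourier_interval_isometry\<close>), defined everywhere because of completeness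
  (\<open>FT_total\<close>), and invertible (\<open>FT_inversion\<close>). It carries the integral operators to
  multiplication operators (\<open>FT_convolution\<close>), which yields a diagonalization of
  \<open>(BB\<^sup>*)\<^sup>-\<^sup>1\<close> (\<open>fourier_diagonalizes_BB_adj_inv\<close>).

  The second is that the spectral form, defined through an arbitrarily chosen diagonalization, can
  be computed in this one (\<open>spectral_form_eq\<close>). The inner products of \<open>(BB\<^sup>*)\<^sup>n g\<close>
  with \<open>g\<close> are the moments of the spectral measure of \<open>BB\<^sup>*\<close> on \<open>[0, 1]\<close>, and a
  measure on \<open>[0, 1]\<close> is determined by its moments.
\<close>

section \<open>Square-integrable functions\<close>

lemma L2_measurable [measurable_dest]: "f \<in> L2 M \<Longrightarrow> f \<in> borel_measurable M"
  by (simp add: L2_def)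

lemma L2_norm_sq_integrable: "f \<in> L2 M \<Longrightarrow> integrable M (\<lambda>x. (norm (f x))\<^sup>2)"
  by (simp add: L2_def)

lemma L2_bound:
  assumes "f \<in> borel_measurable M" "integrable M h" "AE x in M. (norm (f x))\<^sup>2 \<le> h x"
  shows "f \<in> L2 M"
  unfolding L2_def mem_Collect_eq
  using assms by (auto intro!: Bochner_Integration.integrable_bound[OF assms(2)])

lemma norm_add_sq_le: "(norm (a + b))\<^sup>2 \<le> 2 * (norm a)\<^sup>2 + 2 * (norm (b :: 'a::real_normed_vector))\<^sup>2"
proof -
  have "(norm (a + b))\<^sup>2 \<le> (norm a + norm b)\<^sup>2"
    by (intro power_mono norm_triangle_ineq) auto
  also have "\<dots> \<le> 2 * (norm a)\<^sup>2 + 2 * (norm b)\<^sup>2"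
    using sum_squares_bound[of "norm a" "norm b"] by (simp add: power2_sum)
  finally show ?thesis .
qed

lemma L2_lincomb:
  assumes f: "f \<in> L2 M" and g: "g \<in> L2 M"
  shows "(\<lambda>x. c * f x + g x) \<in> L2 M"
proof (rule L2_bound)
  show "(\<lambda>x. c * f x + g x) \<in> borel_measurable M" using f g by measurable
  show "integrable M (\<lambda>x. 2 * ((norm c)\<^sup>2 * (norm (f x))\<^sup>2) + 2 * (norm (g x))\<^sup>2)"
    using f g by (intro Bochner_Integration.integrable_add integrable_mult_right L2_norm_sq_integrable)
  show "AE x in M. (norm (c * f x + g x))\<^sup>2 \<le> 2 * ((norm c)\<^sup>2 * (norm (f x))\<^sup>2) + 2 * (norm (g x))\<^sup>2"
    using norm_add_sq_le[of "c * f _"] by (auto simp: norm_mult power_mult_distrib)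
qed

lemma L2_zero: "(\<lambda>x. 0) \<in> L2 M"
  by (simp add: L2_def)

lemma L2_diff: "f \<in> L2 M \<Longrightarrow> g \<in> L2 M \<Longrightarrow> (\<lambda>x. f x - g x) \<in> L2 M"
  using L2_lincomb[of g M f "-1"] by simp

lemma borel_measurable_cnj [measurable]: "cnj \<in> borel_measurable borel"
  by (intro borel_measurable_continuous_onI continuous_intros)

lemma L2_cnj: "f \<in> L2 M \<Longrightarrow> (\<lambda>x. cnj (f x)) \<in> L2 M"
  unfolding L2_def mem_Collect_eq by (auto intro: measurable_compose[OF _ borel_measurable_cnj])

lemma L2_mult_bounded:
  assumes f: "f \<in> L2 M" and [measurable]: "k \<in> borel_measurable M" and "\<And>x. norm (k x) \<le> c"
  shows "(\<lambda>x. k x * f x) \<in> L2 M"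
proof (rule L2_bound)
  show "(\<lambda>x. k x * f x) \<in> borel_measurable M" using f by measurable
  show "integrable M (\<lambda>x. c\<^sup>2 * (norm (f x))\<^sup>2)"
    using f by (intro integrable_mult_right L2_norm_sq_integrable)
  show "AE x in M. (norm (k x * f x))\<^sup>2 \<le> c\<^sup>2 * (norm (f x))\<^sup>2"
    using assms(3) by (auto simp: norm_mult power_mult_distrib intro!: mult_right_mono power_mono)
qed

lemma L2_AE_cong:
  assumes "f \<in> L2 M" "g \<in> borel_measurable M" "AE x in M. g x = f x"
  shows "g \<in> L2 M"
  using assms(3) by (intro L2_bound[OF assms(2) L2_norm_sq_integrable[OF assms(1)]]) auto

lemma L2_bounded_integrable:
  assumes f: "integrable M f" and "\<And>x. norm (f x) \<le> c"
  shows "f \<in> L2 M"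
proof (rule L2_bound)
  show "integrable M (\<lambda>x. c * norm (f x))"
    using f by simp
  show "AE x in M. (norm (f x))\<^sup>2 \<le> c * norm (f x)"
    using assms(2) by (auto simp: power2_eq_square intro!: mult_right_mono)
qed (use f in auto)

lemma L2_mult_integrable:
  assumes f: "f \<in> L2 M" and g: "g \<in> L2 M"
  shows "integrable M (\<lambda>x. f x * g x)"
proof (rule Bochner_Integration.integrable_bound)
  show "integrable M (\<lambda>x. (norm (f x))\<^sup>2 + (norm (g x))\<^sup>2)"
    using f g by (intro Bochner_Integration.integrable_add L2_norm_sq_integrable)
  show "AE x in M. norm (f x * g x) \<le> norm ((norm (f x))\<^sup>2 + (norm (g x))\<^sup>2)"
  proof (rule AE_I2)
    fix x
    have "norm (f x) * norm (g x) \<le> 2 * norm (f x) * norm (g x)" by simp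
    also have "\<dots> \<le> (norm (f x))\<^sup>2 + (norm (g x))\<^sup>2" by (rule sum_squares_bound)
    finally show "norm (f x * g x) \<le> norm ((norm (f x))\<^sup>2 + (norm (g x))\<^sup>2)"
      by (simp add: norm_mult)
  qed
qed (use f g in measurable)

text \<open>
  The pairing is bilinear, without conjugation, so that it serves the multiplication formula
  of the Fourier transform and, applied to a conjugate, the inner product.
\<close>

lemma L2_Cauchy_Schwarz:
  assumes f: "f \<in> L2 M" and g: "g \<in> L2 M"
  shows "(norm (LINT x|M. f x * g x))\<^sup>2 \<le> (LINT x|M. (norm (f x))\<^sup>2) * (LINT x|M. (norm (g x))\<^sup>2)"
proof -
  define F where "F = (LINT x|M. (norm (f x))\<^sup>2)"
  define G where "G = (LINT x|M. (norm (g x))\<^sup>2)"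
  define I where "I = (LINT x|M. norm (f x * g x))"
  have I0: "I \<ge> 0" unfolding I_def by (rule integral_nonneg_AE) auto
  have F0: "F \<ge> 0" unfolding F_def by (rule integral_nonneg_AE) auto
  note int = L2_norm_sq_integrable[OF f] L2_norm_sq_integrable[OF g] L2_mult_integrable[OF f g]
  \<comment> \<open>The quadratic in \<open>t\<close> is the squared distance of \<open>t |f|\<close> and \<open>|g|\<close>;
    its discriminant is the claim.\<close>
  have quad: "0 \<le> t\<^sup>2 * F - 2 * t * I + G" for t :: real
  proof -
    have "0 \<le> (LINT x|M. (t * norm (f x) - norm (g x))\<^sup>2)"
      by (rule integral_nonneg_AE) auto
    also have "(\<lambda>x. (t * norm (f x) - norm (g x))\<^sup>2) =
        (\<lambda>x. t\<^sup>2 * (norm (f x))\<^sup>2 - 2 * t * norm (f x * g x) + (norm (g x))\<^sup>2)"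
      by (auto simp: power2_eq_square norm_mult algebra_simps)
    also have "(LINT x|M. t\<^sup>2 * (norm (f x))\<^sup>2 - 2 * t * norm (f x * g x) + (norm (g x))\<^sup>2)
        = t\<^sup>2 * F - 2 * t * I + G"
      unfolding F_def G_def I_def using int
      by (subst Bochner_Integration.integral_add Bochner_Integration.integral_diff; simp)+
    finally show ?thesis .
  qed
  have "I\<^sup>2 \<le> F * G"
  proof (cases "F = 0")
    case True
    have "I = 0"
    proof (rule ccontr)
      assume "I \<noteq> 0"
      then have "I > 0" using I0 by simp
      have "2 * ((G + 1) / (2 * I)) * I = G + 1" using \<open>I > 0\<close> by simp
      then show False using quad[of "(G + 1) / (2 * I)"] True by simp
    qed
    then show ?thesis using True by simp
  next
    case False
    then have "F > 0" using F0 by simp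
    have "0 \<le> F * ((I / F)\<^sup>2 * F - 2 * (I / F) * I + G)"
      using quad[of "I / F"] F0 by simp
    also have "\<dots> = F * G - I\<^sup>2"
      using \<open>F > 0\<close> by (simp add: field_simps power2_eq_square)
    finally show ?thesis by simp
  qed
  moreover have "norm (LINT x|M. f x * g x) \<le> I"
    unfolding I_def by (rule integral_norm_bound)
  then have "(norm (LINT x|M. f x * g x))\<^sup>2 \<le> I\<^sup>2"
    by (intro power_mono) auto
  ultimately show ?thesis unfolding F_def G_def by simp
qed

definition L2_lim :: "'a measure \<Rightarrow> (nat \<Rightarrow> 'a \<Rightarrow> complex) \<Rightarrow> ('a \<Rightarrow> complex) \<Rightarrow> bool" where
  "L2_lim M F f \<longleftrightarrow> (\<lambda>n. LINT x|M. (norm (F n x - f x))\<^sup>2) \<longlonglongrightarrow> 0"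

lemma L2_lim_pairing:
  assumes F: "\<And>n. F n \<in> L2 M" and f: "f \<in> L2 M" and g: "g \<in> L2 M" and lim: "L2_lim M F f"
  shows "(\<lambda>n. LINT x|M. F n x * g x) \<longlonglongrightarrow> (LINT x|M. f x * g x)"
proof -
  have "(\<lambda>n. (norm ((LINT x|M. F n x * g x) - (LINT x|M. f x * g x)))\<^sup>2) \<longlonglongrightarrow> 0"
  proof (rule tendsto_sandwich[where f = "\<lambda>_. 0"])
    show "(\<lambda>n. (LINT x|M. (norm (F n x - f x))\<^sup>2) * (LINT x|M. (norm (g x))\<^sup>2)) \<longlonglongrightarrow> 0"
      using tendsto_mult_left_zero[OF lim[unfolded L2_lim_def]] .
    have eq: "(LINT x|M. F n x * g x) - (LINT x|M. f x * g x) = (LINT x|M. (F n x - f x) * g x)" for n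
      using L2_mult_integrable[OF F[of n] g] L2_mult_integrable[OF f g]
      by (simp add: left_diff_distrib)
    show "\<forall>\<^sub>F n in sequentially. (norm ((LINT x|M. F n x * g x) - (LINT x|M. f x * g x)))\<^sup>2
        \<le> (LINT x|M. (norm (F n x - f x))\<^sup>2) * (LINT x|M. (norm (g x))\<^sup>2)"
      unfolding eq using L2_Cauchy_Schwarz[OF L2_diff[OF F f] g] by auto
  qed auto
  then have "(\<lambda>n. norm ((LINT x|M. F n x * g x) - (LINT x|M. f x * g x))) \<longlonglongrightarrow> 0"
    using tendsto_real_sqrt[of _ 0] by fastforce
  then show ?thesis
    by (rule LIM_zero_cancel[OF tendsto_norm_zero_cancel])
qed

lemma L2_lim_cnj: "L2_lim M F f \<Longrightarrow> L2_lim M (\<lambda>n x. cnj (F n x)) (\<lambda>x. cnj (f x))"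
  by (simp add: L2_lim_def flip: complex_cnj_diff)

text \<open>
  The theorem of Riesz and Fischer, for sequences whose Cauchy property comes with a
  geometric rate; every Cauchy sequence has such a subsequence.
\<close>

lemma L2_geometric_Cauchy_lim:
  assumes F: "\<And>n. F n \<in> L2 M"
    and cau: "\<And>n m. n \<le> m \<Longrightarrow> (LINT x|M. (norm (F m x - F n x))\<^sup>2) \<le> (1/4) ^ n"
  obtains f where "f \<in> L2 M" "L2_lim M F f"
proof -
  have [measurable]: "F n \<in> borel_measurable M" for n using F by measurable
  define D where "D n x = norm (F (Suc n) x - F n x)" for n x
  have Dm[measurable]: "D n \<in> borel_measurable M" for n unfolding D_def by measurable
  \<comment> \<open>The weights \<open>2 ^ n\<close> leave a convergent series of integrals, and pointwise they make
    \<open>D n x\<close> at most \<open>2 ^ (- n) + 2 ^ n * (D n x)\<^sup>2\<close>, hence summable in \<open>n\<close>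
    almost everywhere.\<close>
  have "(\<integral>\<^sup>+x. (\<Sum>n. ennreal (2 ^ n * (D n x)\<^sup>2)) \<partial>M) = (\<Sum>n. \<integral>\<^sup>+x. ennreal (2 ^ n * (D n x)\<^sup>2) \<partial>M)"
    by (rule nn_integral_suminf) measurable
  also have "\<dots> \<le> (\<Sum>n. ennreal ((1/2) ^ n))"
  proof (rule suminf_le)
    fix n
    have i: "integrable M (\<lambda>x. (D n x)\<^sup>2)"
      unfolding D_def using F by (intro L2_norm_sq_integrable L2_diff)
    have "(\<integral>\<^sup>+x. ennreal (2 ^ n * (D n x)\<^sup>2) \<partial>M) = ennreal (LINT x|M. 2 ^ n * (D n x)\<^sup>2)"
      using i by (intro nn_integral_eq_integral) auto
    also have "(LINT x|M. 2 ^ n * (D n x)\<^sup>2) = 2 ^ n * (LINT x|M. (D n x)\<^sup>2)" by simp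
    also have "\<dots> \<le> 2 ^ n * (1/4) ^ n"
      unfolding D_def using cau[of n "Suc n"] by (intro mult_left_mono) auto
    also have "\<dots> = (1/2) ^ n" by (simp flip: power_mult_distrib)
    finally show "(\<integral>\<^sup>+x. ennreal (2 ^ n * (D n x)\<^sup>2) \<partial>M) \<le> ennreal ((1/2) ^ n)"
      by (simp add: ennreal_leI)
  qed auto
  also have "\<dots> = ennreal (\<Sum>n. (1/2) ^ n)"
    by (intro suminf_ennreal2) (auto intro!: summable_geometric)
  also have "\<dots> < \<infinity>" by simp
  finally have "(\<integral>\<^sup>+x. (\<Sum>n. ennreal (2 ^ n * (D n x)\<^sup>2)) \<partial>M) \<noteq> \<infinity>" by simp
  then have "AE x in M. (\<Sum>n. ennreal (2 ^ n * (D n x)\<^sup>2)) \<noteq> \<infinity>"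
    by (intro nn_integral_PInf_AE) auto
  then have conv: "AE x in M. convergent (\<lambda>n. F n x)"
  proof eventually_elim
    fix x assume "(\<Sum>n. ennreal (2 ^ n * (D n x)\<^sup>2)) \<noteq> \<infinity>"
    then have s: "summable (\<lambda>n. 2 ^ n * (D n x)\<^sup>2)"
      by (intro summable_suminf_not_top) auto
    have "summable (\<lambda>n. D n x)"
    proof (rule summable_comparison_test)
      show "summable (\<lambda>n. (1/2) ^ n + 2 ^ n * (D n x)\<^sup>2)"
        using s by (intro summable_add summable_geometric) auto
      have "D n x \<le> (1/2) ^ n + 2 ^ n * (D n x)\<^sup>2" for n
      proof -
        have "0 \<le> D n x" by (simp add: D_def)
        define p :: real where "p = 2 ^ n"
        have p: "p > 0" by (simp add: p_def)
        have "0 \<le> D n x * p" using \<open>0 \<le> D n x\<close> p by simp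
        then have "D n x * p \<le> 1 + (D n x * p)\<^sup>2"
          using sum_squares_bound[of 1 "D n x * p"] unfolding power_one by linarith
        then have "D n x * p / p \<le> (1 + (D n x * p)\<^sup>2) / p"
          using p by (intro divide_right_mono) auto
        also have "(1 + (D n x * p)\<^sup>2) / p = 1 / p + p * (D n x)\<^sup>2"
          using p by (simp add: add_divide_distrib power2_eq_square)
        finally have "D n x \<le> 1 / p + p * (D n x)\<^sup>2"
          using p by simp
        then show ?thesis by (simp add: p_def power_one_over)
      qed
      then show "\<exists>N. \<forall>n\<ge>N. norm (D n x) \<le> (1/2) ^ n + 2 ^ n * (D n x)\<^sup>2"
        by (auto simp: D_def)
    qed
    then have "summable (\<lambda>n. F (Suc n) x - F n x)"
      unfolding D_def by (rule summable_norm_cancel)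
    then have "convergent (\<lambda>n. \<Sum>k<n. F (Suc k) x - F k x)"
      by (simp add: summable_iff_convergent)
    then obtain l where "(\<lambda>n. F n x - F 0 x) \<longlonglongrightarrow> l"
      unfolding sum_lessThan_telescope[of "\<lambda>n. F n x"] convergent_def by blast
    then have "(\<lambda>n. F n x - F 0 x + F 0 x) \<longlonglongrightarrow> l + F 0 x"
      by (intro tendsto_add tendsto_const)
    then show "convergent (\<lambda>n. F n x)"
      by (auto simp: convergent_def)
  qed
  define f where "f x = lim (\<lambda>n. F n x)" for x
  have [measurable]: "f \<in> borel_measurable M" unfolding f_def by (rule borel_measurable_lim_metric) measurable
  have lim: "AE x in M. (\<lambda>n. F n x) \<longlonglongrightarrow> f x"
    using conv unfolding f_def by eventually_elim (simp add: convergent_LIMSEQ_iff)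
  have bound: "(\<integral>\<^sup>+x. ennreal ((norm (f x - F n x))\<^sup>2) \<partial>M) \<le> ennreal ((1/4) ^ n)" for n
  proof -
    \<comment> \<open>Fatou's lemma turns the Cauchy estimates into the distance to the limit.\<close>
    have "(\<integral>\<^sup>+x. ennreal ((norm (f x - F n x))\<^sup>2) \<partial>M)
        = (\<integral>\<^sup>+x. liminf (\<lambda>m. ennreal ((norm (F m x - F n x))\<^sup>2)) \<partial>M)"
      using lim
    proof (intro nn_integral_cong_AE, eventually_elim)
      fix x assume "(\<lambda>n. F n x) \<longlonglongrightarrow> f x"
      then have "(\<lambda>m. ennreal ((norm (F m x - F n x))\<^sup>2)) \<longlonglongrightarrow> ennreal ((norm (f x - F n x))\<^sup>2)"
        by (intro tendsto_intros)
      then show "ennreal ((norm (f x - F n x))\<^sup>2) = liminf (\<lambda>m. ennreal ((norm (F m x - F n x))\<^sup>2))"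
        by (rule lim_imp_Liminf[OF sequentially_bot, symmetric])
    qed
    also have "\<dots> \<le> liminf (\<lambda>m. \<integral>\<^sup>+x. ennreal ((norm (F m x - F n x))\<^sup>2) \<partial>M)"
      by (rule nn_integral_liminf) measurable
    also have "\<dots> \<le> liminf (\<lambda>m. ennreal ((1/4) ^ n))"
    proof (rule Liminf_mono, rule eventually_sequentiallyI[of n])
      fix m assume "n \<le> m"
      have "integrable M (\<lambda>x. (norm (F m x - F n x))\<^sup>2)"
        using F by (intro L2_norm_sq_integrable L2_diff)
      then have "(\<integral>\<^sup>+x. ennreal ((norm (F m x - F n x))\<^sup>2) \<partial>M)
          = ennreal (LINT x|M. (norm (F m x - F n x))\<^sup>2)"
        by (intro nn_integral_eq_integral) auto
      then show "(\<integral>\<^sup>+x. ennreal ((norm (F m x - F n x))\<^sup>2) \<partial>M) \<le> ennreal ((1/4) ^ n)"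
        using cau[OF \<open>n \<le> m\<close>] by (simp add: ennreal_leI)
    qed
    also have "\<dots> = ennreal ((1/4) ^ n)"
      by (simp add: Liminf_const)
    finally show ?thesis .
  qed
  have diff: "(\<lambda>x. f x - F n x) \<in> L2 M" for n
  proof -
    have "integrable M (\<lambda>x. (norm (f x - F n x))\<^sup>2)"
    proof (rule integrableI_nonneg)
      show "(\<integral>\<^sup>+x. ennreal ((norm (f x - F n x))\<^sup>2) \<partial>M) < \<infinity>"
        using le_less_trans[OF bound[of n] ennreal_less_top] by simp
    qed auto
    then show ?thesis by (simp add: L2_def)
  qed
  have "f \<in> L2 M"
    using L2_lincomb[OF diff[of 0] F[of 0], of 1] by simp
  moreover have "L2_lim M F f"
    unfolding L2_lim_def
  proof (rule tendsto_sandwich[where f = "\<lambda>_. 0"])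
    show "(\<lambda>n. (1/4::real) ^ n) \<longlonglongrightarrow> 0" by (intro LIMSEQ_power_zero) auto
    have "(LINT x|M. (norm (F n x - f x))\<^sup>2) \<le> (1/4) ^ n" for n
    proof -
      have "ennreal (LINT x|M. (norm (f x - F n x))\<^sup>2) = (\<integral>\<^sup>+x. ennreal ((norm (f x - F n x))\<^sup>2) \<partial>M)"
        using L2_norm_sq_integrable[OF diff[of n]] by (intro nn_integral_eq_integral[symmetric]) auto
      then have "ennreal (LINT x|M. (norm (f x - F n x))\<^sup>2) \<le> ennreal ((1/4) ^ n)"
        using bound[of n] by simp
      then have "(LINT x|M. (norm (f x - F n x))\<^sup>2) \<le> (1/4) ^ n"
        by (subst (asm) ennreal_le_iff) auto
      then show ?thesis by (simp add: norm_minus_commute)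
    qed
    then show "\<forall>\<^sub>F n in sequentially. (LINT x|M. (norm (F n x - f x))\<^sup>2) \<le> (1/4) ^ n" by simp
  qed auto
  ultimately show ?thesis by (rule that)
qed

section \<open>Fourier transforms of intervals\<close>

lemma sinc_sq_eq: "x \<noteq> 0 \<Longrightarrow> x / 2 * (sinc (x / 2))\<^sup>2 = (1 - cos x) / x"
  using cos_double_sin[of "x / 2"] by (simp add: field_simps power2_eq_square)

text \<open>
  Integration by parts: \<open>(1 - cos x) / x\<^sup>2\<close> has the primitive
  \<open>Si x - (1 - cos x) / x\<close>. The second term is written through \<open>sinc\<close>,
  because that form is continuous at \<open>0\<close>.
\<close>

lemma DERIV_Fejer_primitive:
  assumes "x > 0"
  shows "((\<lambda>x. Si x - x / 2 * (sinc (x / 2))\<^sup>2) has_real_derivative (1 - cos x) / x\<^sup>2) (at x)"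
proof (rule has_field_derivative_transform_within_open)
  show "((\<lambda>x. Si x - (1 - cos x) / x) has_real_derivative (1 - cos x) / x\<^sup>2) (at x)"
    using assms by (auto intro!: derivative_eq_intros DERIV_Si simp: field_simps power2_eq_square)
  show "Si y - (1 - cos y) / y = Si y - y / 2 * (sinc (y / 2))\<^sup>2" if "y \<in> {0<..}" for y
    using that by (subst sinc_sq_eq) auto
qed (use assms in auto)

lemma Fejer_integral_half:
  "set_integrable lborel {0<..} (\<lambda>x::real. (1 - cos x) / x\<^sup>2)"
  "(LBINT x::real:{0<..}. (1 - cos x) / x\<^sup>2) = pi / 2"
proof -
  let ?F = "\<lambda>x. Si x - x / 2 * (sinc (x / 2))\<^sup>2"
  have "isCont ?F 0"
    by (intro continuous_intros isCont_Si isCont_o2[OF _ isCont_sinc]) auto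
  then have "(?F \<longlongrightarrow> ?F 0) (at 0)"
    by (simp only: isCont_def)
  moreover have "?F 0 = 0"
    by (simp add: Si_def zero_ereal_def[symmetric])
  ultimately have "(?F \<longlongrightarrow> 0) (at 0)"
    by (simp only:)
  then have A: "((?F \<circ> real_of_ereal) \<longlongrightarrow> 0) (at_right 0)"
    unfolding zero_ereal_def ereal_tendsto_simps by (rule filterlim_at_split[THEN iffD1, THEN conjunct2])
  have "((\<lambda>x::real. (1 - cos x) / x) \<longlongrightarrow> 0) at_top"
  proof (rule Lim_null_comparison)
    show "((\<lambda>x::real. 2 / x) \<longlongrightarrow> 0) at_top"
      by (intro tendsto_divide_0[OF tendsto_const] filterlim_at_top_imp_at_infinity filterlim_ident)
    have "norm ((1 - cos x) / x) \<le> 2 / x" if "x > 0" for x :: real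
      using that cos_ge_minus_one[of x] by (simp add: divide_right_mono)
    then show "\<forall>\<^sub>F x in at_top. norm ((1 - cos x) / x) \<le> 2 / (x::real)"
      by (intro eventually_mono[OF eventually_gt_at_top[of 0]])
  qed
  then have "((\<lambda>x. Si x - (1 - cos x) / x) \<longlongrightarrow> pi / 2 - 0) at_top"
    by (intro tendsto_diff Si_at_top)
  then have "(?F \<longlongrightarrow> pi / 2) at_top"
    unfolding diff_zero
  proof (rule Lim_transform_eventually)
    show "\<forall>\<^sub>F x in at_top. Si x - (1 - cos x) / x = ?F x"
      by (rule eventually_mono[OF eventually_gt_at_top[of 0]]) (subst sinc_sq_eq, auto)
  qed
  then have B: "((?F \<circ> real_of_ereal) \<longlongrightarrow> pi / 2) (at_left \<infinity>)"
    unfolding ereal_tendsto_simps .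
  have d: "(?F has_real_derivative (1 - cos x) / x\<^sup>2) (at x)" if "0 < ereal x" "ereal x < \<infinity>" for x
    by (rule DERIV_Fejer_primitive) (use that in simp)
  have c: "isCont (\<lambda>x. (1 - cos x) / x\<^sup>2) x" if "0 < ereal x" "ereal x < \<infinity>" for x :: real
    using that by (intro continuous_intros) auto
  have n: "AE x in lborel. 0 < ereal x \<longrightarrow> ereal x < \<infinity> \<longrightarrow> 0 \<le> (1 - cos x) / x\<^sup>2"
    by simp
  note * = interval_integral_FTC_nonneg[OF _ d c n A B]
  have einterval: "einterval 0 \<infinity> = {0<..}"
    by (auto simp: einterval_iff)
  show "set_integrable lborel {0<..} (\<lambda>x::real. (1 - cos x) / x\<^sup>2)"
    using *(1) by (simp add: einterval)
  have "(LBINT x::real=0..\<infinity>. (1 - cos x) / x\<^sup>2) = pi / 2"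
    using *(2) by simp
  then show "(LBINT x::real:{0<..}. (1 - cos x) / x\<^sup>2) = pi / 2"
    by (simp add: interval_lebesgue_integral_0_infty)
qed

lemma lborel_has_bochner_integral_even:
  fixes f :: "real \<Rightarrow> real"
  assumes int: "set_integrable lborel {0<..} f" and even: "\<And>x. f (- x) = f x"
  shows "has_bochner_integral lborel f (2 * (LBINT x:{0<..}. f x))"
proof -
  let ?g = "\<lambda>x. indicator {0<..} x *\<^sub>R f x"
  have g: "has_bochner_integral lborel ?g (LBINT x:{0<..}. f x)"
    using int unfolding set_integrable_def set_lebesgue_integral_def by (rule has_bochner_integral_integrable)
  have "has_bochner_integral lborel (\<lambda>x. ?g (0 + (-1) * x)) ((LBINT x:{0<..}. f x) /\<^sub>R \<bar>-1\<bar>)"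
    by (rule lborel_has_bochner_integral_real_affine_iff[THEN iffD1, OF _ g]) simp
  from has_bochner_integral_add[OF g this]
  have *: "has_bochner_integral lborel (\<lambda>x. ?g x + ?g (0 + (-1) * x)) (2 * (LBINT x:{0<..}. f x))"
    by simp
  have "(\<lambda>x. if x = 0 then 0 else f x) = (\<lambda>x. ?g x + ?g (0 + (-1) * x))"
    by (auto simp: even fun_eq_iff indicator_def)
  with * have **: "has_bochner_integral lborel (\<lambda>x. if x = 0 then 0 else f x) (2 * (LBINT x:{0<..}. f x))"
    by simp
  then have [measurable]: "(\<lambda>x. if x = 0 then 0 else f x) \<in> borel_measurable borel"
    by (auto dest: borel_measurable_has_bochner_integral)
  have "f = (\<lambda>x. if x = 0 then f 0 else (if x = 0 then 0 else f x))"
    by auto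
  moreover have "\<dots> \<in> borel_measurable borel"
    by measurable
  ultimately have "f \<in> borel_measurable lborel" by simp
  have "AE x in lborel. (if x = 0 then 0 else f x) = f x"
    using AE_lborel_singleton[of 0] by eventually_elim simp
  then show ?thesis
    by (rule has_bochner_integralI_AE[OF ** \<open>f \<in> borel_measurable lborel\<close>])
qed

lemma Fejer_integral:
  "has_bochner_integral lborel (\<lambda>\<omega>. (1 - cos (t * \<omega>)) / \<omega>\<^sup>2) (pi * \<bar>t\<bar>)"
proof (cases "t = 0")
  case True
  then show ?thesis by (simp add: has_bochner_integral_zero)
next
  case False
  have "has_bochner_integral lborel (\<lambda>x::real. (1 - cos x) / x\<^sup>2) pi"
    using lborel_has_bochner_integral_even[OF Fejer_integral_half(1)] Fejer_integral_half(2) by simp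
  then have "has_bochner_integral lborel (\<lambda>x. (1 - cos (0 + t * x)) / (0 + t * x)\<^sup>2) (pi /\<^sub>R \<bar>t\<bar>)"
    by (rule lborel_has_bochner_integral_real_affine_iff[where t = 0, THEN iffD1, OF False])
  from has_bochner_integral_mult_right[OF this, of "t\<^sup>2"]
  have "has_bochner_integral lborel (\<lambda>x. t\<^sup>2 * ((1 - cos (0 + t * x)) / (0 + t * x)\<^sup>2)) (t\<^sup>2 * (pi /\<^sub>R \<bar>t\<bar>))"
    by simp
  moreover have "t\<^sup>2 * (pi /\<^sub>R \<bar>t\<bar>) = pi * \<bar>t\<bar>"
    using False by (simp add: field_simps power2_eq_square)
  moreover have "(\<lambda>x. t\<^sup>2 * ((1 - cos (0 + t * x)) / (0 + t * x)\<^sup>2)) = (\<lambda>\<omega>. (1 - cos (t * \<omega>)) / \<omega>\<^sup>2)"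
    using False by (auto simp: power_mult_distrib)
  ultimately show ?thesis by (simp only:)
qed

text \<open>
  The unitary normalisation with kernel \<open>exp (- i \<omega> x)\<close>.
\<close>

definition fourier_int :: "(real \<Rightarrow> complex) \<Rightarrow> real \<Rightarrow> complex" where
  "fourier_int f \<omega> = complex_of_real (1 / sqrt (2 * pi)) * (LINT x|lborel. cis (- (\<omega> * x)) * f x)"

lemma borel_measurable_cis [measurable]: "cis \<in> borel_measurable borel"
  by (intro borel_measurable_continuous_onI continuous_on_cis continuous_intros)

lemma borel_measurable_fourier_int [measurable]:
  assumes [measurable]: "f \<in> borel_measurable borel"
  shows "fourier_int f \<in> borel_measurable borel"
  unfolding fourier_int_def by measurable

lemma fourier_int_bound:
  "norm (fourier_int f \<omega>) \<le> 1 / sqrt (2 * pi) * (LINT x|lborel. norm (f x))"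
proof -
  have "norm (LINT x|lborel. cis (- (\<omega> * x)) * f x) \<le> (LINT x|lborel. norm (cis (- (\<omega> * x)) * f x))"
    by (rule integral_norm_bound)
  then show ?thesis
    unfolding fourier_int_def by (simp add: norm_mult norm_divide divide_right_mono)
qed

lemma fourier_int_uminus: "fourier_int f (- \<omega>) = cnj (fourier_int (\<lambda>x. cnj (f x)) \<omega>)"
  unfolding fourier_int_def by (simp add: cis_cnj flip: Bochner_Integration.integral_cnj)

abbreviation fourier_interval :: "real \<Rightarrow> real \<Rightarrow> real \<Rightarrow> complex" where
  "fourier_interval a b \<equiv> fourier_int (indicator {a..b})"

lemma fourier_interval_eq:
  assumes "a \<le> b" "\<omega> \<noteq> 0"
  shows "fourier_interval a b \<omega> =
    complex_of_real (1 / sqrt (2 * pi)) * ((cis (- (\<omega> * a)) - cis (- (\<omega> * b))) / (\<i> * of_real \<omega>))"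
proof -
  let ?P = "\<lambda>x. \<i> / of_real \<omega> * cis (- (\<omega> * x))"
  have "(LINT x|lborel. indicator {a..b} x *\<^sub>R cis (- (\<omega> * x))) = ?P b - ?P a"
  proof (rule integral_FTC_atLeastAtMost[OF assms(1)])
    show "continuous_on {a..b} (\<lambda>x. cis (- (\<omega> * x)))"
      by (intro continuous_intros)
    fix x
    have "((\<lambda>x. cis (- (\<omega> * x))) has_vector_derivative (- \<omega>) *\<^sub>R (\<i> * cis (- (\<omega> * x)))) (at x within {a..b})"
      unfolding has_vector_derivative_def
      by (auto intro!: derivative_eq_intros simp: fun_eq_iff)
    then show "(?P has_vector_derivative cis (- (\<omega> * x))) (at x within {a..b})"
      by (rule has_vector_derivative_mult_right[THEN has_vector_derivative_eq_rhs])
         (use assms(2) in \<open>simp add: scaleR_conv_of_real\<close>)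
  qed
  also have "(LINT x|lborel. indicator {a..b} x *\<^sub>R cis (- (\<omega> * x))) = (LINT x|lborel. cis (- (\<omega> * x)) * indicator {a..b} x)"
    by (intro Bochner_Integration.integral_cong) (auto simp: indicator_def)
  finally have "(LINT x|lborel. cis (- (\<omega> * x)) * indicator {a..b} x) = ?P b - ?P a" .
  moreover have "?P b - ?P a = (cis (- (\<omega> * a)) - cis (- (\<omega> * b))) / (\<i> * of_real \<omega>)"
    by (simp add: divide_inverse algebra_simps)
  ultimately show ?thesis
    unfolding fourier_int_def by simp
qed

lemma complex_indicator_eq: "(indicator A :: _ \<Rightarrow> complex) = (\<lambda>x. of_real (indicator A x))"
  by (auto simp: indicator_def)

lemma L2_indicator:
  assumes "A \<in> sets M" "emeasure M A < \<infinity>"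
  shows "(indicator A :: _ \<Rightarrow> complex) \<in> L2 M"
  unfolding complex_indicator_eq using assms
  by (intro L2_bounded_integrable[where c = 1] integrable_of_real integrable_real_indicator)
     (auto simp: indicator_def)

lemma norm_cis_diff_sq: "(norm (cis a - cis b))\<^sup>2 = 2 * (1 - cos (b - a))"
proof -
  have "(cos a - cos b)\<^sup>2 + (sin a - sin b)\<^sup>2 = 2 * (1 - cos (b - a))"
    using sin_cos_squared_add[of a] sin_cos_squared_add[of b]
    by (simp add: cos_diff power2_eq_square algebra_simps)
  then show ?thesis by (simp add: cmod_def)
qed

lemma fourier_interval_L2:
  assumes "a \<le> b"
  shows "fourier_interval a b \<in> L2 lborel"
proof (rule L2_bound)
  have "integrable lborel (\<lambda>\<omega>. (1 - cos ((b - a) * \<omega>)) / \<omega>\<^sup>2)"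
    using Fejer_integral[of "b - a"] by (rule integrable.intros)
  then show "integrable lborel (\<lambda>\<omega>. 1 / pi * ((1 - cos ((b - a) * \<omega>)) / \<omega>\<^sup>2))"
    by (rule integrable_mult_right)
  show "AE \<omega> in lborel. (norm (fourier_interval a b \<omega>))\<^sup>2 \<le> 1 / pi * ((1 - cos ((b - a) * \<omega>)) / \<omega>\<^sup>2)"
    using AE_lborel_singleton[of 0]
  proof eventually_elim
    fix \<omega> :: real assume "\<omega> \<noteq> 0"
    have "cos (- (\<omega> * b) - - (\<omega> * a)) = cos ((b - a) * \<omega>)"
      by (subst cos_minus[symmetric]) (simp add: algebra_simps)
    then have "(norm (fourier_interval a b \<omega>))\<^sup>2 = 1 / (2 * pi) * (2 * (1 - cos ((b - a) * \<omega>)) / \<omega>\<^sup>2)"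
      unfolding fourier_interval_eq[OF assms \<open>\<omega> \<noteq> 0\<close>]
      by (simp add: norm_mult norm_divide power_mult_distrib power_divide norm_cis_diff_sq del: cos_minus)
    then show "(norm (fourier_interval a b \<omega>))\<^sup>2 \<le> 1 / pi * ((1 - cos ((b - a) * \<omega>)) / \<omega>\<^sup>2)"
      by (simp only: times_divide_times_eq)
  qed
qed simp

text \<open>
  The length of the intersection of two intervals, expressed by the distances of the four
  end points: this is the form in which it comes out of the Fejer integral.
\<close>

lemma integral_indicator_interval_product:
  assumes "a \<le> b" "c \<le> d"
  shows "(LINT x|lborel. indicator {a..b} x * (indicator {c..d} x :: complex))
    = of_real ((\<bar>d - a\<bar> + \<bar>c - b\<bar> - \<bar>c - a\<bar> - \<bar>d - b\<bar>) / 2)"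
proof -
  have "(LINT x|lborel. indicator {a..b} x * (indicator {c..d} x :: complex))
      = (LINT x|lborel. indicator {max a c..min b d} x)"
    by (intro Bochner_Integration.integral_cong) (auto simp: indicator_def)
  also have "\<dots> = of_real (measure lborel {max a c..min b d})"
    unfolding complex_indicator_eq integral_of_real by simp
  also have "measure lborel {max a c..min b d} = max 0 (min b d - max a c)"
    by (cases "max a c \<le> min b d") auto
  also have "\<dots> = (\<bar>d - a\<bar> + \<bar>c - b\<bar> - \<bar>c - a\<bar> - \<bar>d - b\<bar>) / 2"
    using assms by (auto simp: max_def min_def abs_if)
  finally show ?thesis .
qed

lemma lborel_integral_reflect:
  fixes f :: "real \<Rightarrow> complex"
  shows "(LINT x|lborel. f (- x)) = (LINT x|lborel. f x)"
  using lborel_integral_real_affine[of "-1" f 0] by simp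

text \<open>
  The product of the two transforms is a sum of four terms \<open>cis (t \<omega>) / \<omega>\<^sup>2\<close>
  with coefficients adding up to zero, where \<open>t\<close> runs through the differences of the end
  points. Each real part may therefore be replaced by \<open>- (1 - cos (t \<omega>)) / \<omega>\<^sup>2\<close>,
  which integrates to \<open>- \<pi> |t|\<close>.
\<close>

lemma fourier_interval_isometry:
  assumes ab: "a \<le> b" and cd: "c \<le> d"
  shows "(LINT \<omega>|lborel. fourier_interval a b \<omega> * cnj (fourier_interval c d \<omega>))
    = (LINT x|lborel. indicator {a..b} x * cnj (indicator {c..d} x))"
proof -
  let ?p = "\<lambda>\<omega>. fourier_interval a b \<omega> * cnj (fourier_interval c d \<omega>)"
  define h where "h t \<omega> = (1 - cos (t * \<omega>)) / \<omega>\<^sup>2" for t \<omega> :: real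
  have h: "has_bochner_integral lborel (h t) (pi * \<bar>t\<bar>)" for t
    unfolding h_def by (rule Fejer_integral)
  have p: "integrable lborel ?p"
    by (intro L2_mult_integrable L2_cnj fourier_interval_L2 assms)
  have cnj_ind: "(\<lambda>x. cnj (indicator A x)) = indicator A" for A :: "real set"
    by (auto simp: indicator_def)
  \<comment> \<open>The transform of a real function takes conjugate values at opposite points, so the
    integral is real and only the cosines matter.\<close>
  have "(LINT \<omega>|lborel. ?p \<omega>) = (LINT \<omega>|lborel. ?p (- \<omega>))"
    by (rule lborel_integral_reflect[symmetric])
  also have "\<dots> = (LINT \<omega>|lborel. cnj (?p \<omega>))"
    by (simp add: fourier_int_uminus cnj_ind)
  also have "\<dots> = cnj (LINT \<omega>|lborel. ?p \<omega>)"
    by (rule Bochner_Integration.integral_cnj)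
  finally have im: "Im (LINT \<omega>|lborel. ?p \<omega>) = 0"
    by (metis complex_cnj Im_complex_of_real Reals_cnj_iff complex_is_Real_iff)
  have "Re (LINT \<omega>|lborel. ?p \<omega>) = (LINT \<omega>|lborel. Re (?p \<omega>))"
    using p by (simp only: integral_Re)
  also have "\<dots> = (LINT \<omega>|lborel. 1 / (2 * pi) * (h (d - a) \<omega> + h (c - b) \<omega> - h (c - a) \<omega> - h (d - b) \<omega>))"
  proof (rule integral_cong_AE)
    show "(\<lambda>\<omega>. Re (?p \<omega>)) \<in> borel_measurable lborel" by measurable
    show "(\<lambda>\<omega>. 1 / (2 * pi) * (h (d - a) \<omega> + h (c - b) \<omega> - h (c - a) \<omega> - h (d - b) \<omega>)) \<in> borel_measurable lborel"
      unfolding h_def by measurable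
    show "AE \<omega> in lborel. Re (?p \<omega>) = 1 / (2 * pi) * (h (d - a) \<omega> + h (c - b) \<omega> - h (c - a) \<omega> - h (d - b) \<omega>)"
      using AE_lborel_singleton[of 0]
    proof eventually_elim
      fix \<omega> :: real assume \<omega>: "\<omega> \<noteq> 0"
      have "?p \<omega> = of_real (1 / (2 * pi)) * ((cis (- (\<omega> * a)) - cis (- (\<omega> * b))) * (cis (\<omega> * c) - cis (\<omega> * d)) / of_real (\<omega>\<^sup>2))"
        unfolding fourier_interval_eq[OF ab \<omega>] fourier_interval_eq[OF cd \<omega>]
        by (simp add: cis_cnj power2_eq_square field_simps flip: of_real_mult)
      also have "\<dots> = of_real (1 / (2 * pi)) * ((cis ((c - a) * \<omega>) - cis ((d - a) * \<omega>) - cis ((c - b) * \<omega>) + cis ((d - b) * \<omega>)) / of_real (\<omega>\<^sup>2))"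
        by (simp add: left_diff_distrib right_diff_distrib cis_mult algebra_simps)
      finally show "Re (?p \<omega>) = 1 / (2 * pi) * (h (d - a) \<omega> + h (c - b) \<omega> - h (c - a) \<omega> - h (d - b) \<omega>)"
        by (simp add: h_def diff_divide_distrib add_divide_distrib flip: of_real_divide of_real_power)
    qed
  qed
  also have "\<dots> = 1 / (2 * pi) * (pi * \<bar>d - a\<bar> + pi * \<bar>c - b\<bar> - pi * \<bar>c - a\<bar> - pi * \<bar>d - b\<bar>)"
    by (intro has_bochner_integral_integral_eq has_bochner_integral_mult_right has_bochner_integral_diff has_bochner_integral_add h)
  also have "\<dots> = (\<bar>d - a\<bar> + \<bar>c - b\<bar> - \<bar>c - a\<bar> - \<bar>d - b\<bar>) / 2"
    by (simp add: field_simps)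
  finally have re: "Re (LINT \<omega>|lborel. ?p \<omega>) = (\<bar>d - a\<bar> + \<bar>c - b\<bar> - \<bar>c - a\<bar> - \<bar>d - b\<bar>) / 2" .
  show ?thesis
    unfolding fun_cong[OF cnj_ind] integral_indicator_interval_product[OF assms]
    using re im by (simp add: complex_eq_iff)
qed

section \<open>The Fourier transform as a closed relation\<close>

lemma L2_lim_dominated:
  assumes F: "\<And>n. F n \<in> L2 M" and f: "f \<in> L2 M"
    and lim: "AE x in M. (\<lambda>n. F n x) \<longlonglongrightarrow> f x"
    and h: "integrable M h" and bound: "\<And>n. AE x in M. (norm (F n x - f x))\<^sup>2 \<le> h x"
  shows "L2_lim M F f"
proof -
  have "(\<lambda>n. LINT x|M. (norm (F n x - f x))\<^sup>2) \<longlonglongrightarrow> (LINT x|M. 0)"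
  proof (rule integral_dominated_convergence[OF _ _ h])
    show "AE x in M. (\<lambda>n. (norm (F n x - f x))\<^sup>2) \<longlonglongrightarrow> 0"
      using lim
    proof eventually_elim
      fix x assume "(\<lambda>n. F n x) \<longlonglongrightarrow> f x"
      then have "(\<lambda>n. (norm (F n x - f x))\<^sup>2) \<longlonglongrightarrow> (norm (f x - f x))\<^sup>2"
        by (intro tendsto_intros)
      then show "(\<lambda>n. (norm (F n x - f x))\<^sup>2) \<longlonglongrightarrow> 0" by simp
    qed
    show "(\<lambda>x. (norm (F n x - f x))\<^sup>2) \<in> borel_measurable M" for n
      using L2_norm_sq_integrable[OF L2_diff[OF F f]] by auto
  qed (use bound in auto)
  then show ?thesis by (simp add: L2_lim_def)
qed

lemma L2_lim_AE_cong:
  assumes "AE x in M. f x = f' x"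
  shows "L2_lim M (\<lambda>n. f) f'"
proof -
  have "(LINT x|M. (norm (f x - f' x))\<^sup>2) = 0"
    by (rule integral_eq_zero_AE) (use assms in auto)
  then show ?thesis by (simp add: L2_lim_def)
qed

lemma L2_zero_AE:
  assumes "f \<in> L2 M" "(LINT x|M. (norm (f x))\<^sup>2) = 0"
  shows "AE x in M. f x = 0"
  using integral_nonneg_eq_0_iff_AE[OF L2_norm_sq_integrable[OF assms(1)]] assms(2) by auto

lemma norm_sq_integral_eq_pairing:
  "complex_of_real (LINT x|M. (norm (f x))\<^sup>2) = (LINT x|M. f x * cnj (f x))"
  by (simp add: complex_norm_square[symmetric] flip: integral_complex_of_real)

text \<open>
  The graph of the Fourier transform on \<open>L\<^sub>2(\<real>)\<close>: the closed linear relation generated by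
  the indicator functions of compact intervals and their transforms. Rule induction extends
  bilinear identities from intervals to all pairs of the relation.
\<close>

inductive FT :: "(real \<Rightarrow> complex) \<Rightarrow> (real \<Rightarrow> complex) \<Rightarrow> bool" where
  interval: "a \<le> b \<Longrightarrow> FT (indicator {a..b}) (fourier_interval a b)"
| lincomb: "FT f w \<Longrightarrow> FT g v \<Longrightarrow> FT (\<lambda>x. c * f x + g x) (\<lambda>\<omega>. c * w \<omega> + v \<omega>)"
| limit: "(\<And>n. FT (F n) (W n)) \<Longrightarrow> f \<in> L2 lborel \<Longrightarrow> w \<in> L2 lborel \<Longrightarrow>
    L2_lim lborel F f \<Longrightarrow> L2_lim lborel W w \<Longrightarrow> FT f w"

lemma L2_indicator_interval: "(indicator {a..b} :: real \<Rightarrow> complex) \<in> L2 lborel"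
proof (rule L2_indicator)
  show "emeasure lborel {a..b} < \<infinity>" by (cases "a \<le> b") auto
qed simp

lemma FT_L2:
  assumes "FT f w"
  shows FT_L2_left: "f \<in> L2 lborel" and FT_L2_right: "w \<in> L2 lborel"
proof -
  have "f \<in> L2 lborel \<and> w \<in> L2 lborel"
    using assms by induction (auto intro: L2_lincomb L2_indicator_interval fourier_interval_L2)
  then show "f \<in> L2 lborel" "w \<in> L2 lborel" by auto
qed

text \<open>
  The induction principle behind all identities for \<open>FT\<close>: an equation between a pairing with
  \<open>w\<close> and a pairing with \<open>f\<close> is linear and continuous in \<open>(f, w)\<close>, so it
  may be checked on intervals.
\<close>

lemma FT_pairing:
  assumes "FT f w" and p: "p \<in> L2 lborel" and q: "q \<in> L2 lborel"
    and base: "\<And>a b. a \<le> b \<Longrightarrow>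
      (LINT x|lborel. fourier_interval a b x * p x) = (LINT x|lborel. indicator {a..b} x * q x)"
  shows "(LINT x|lborel. w x * p x) = (LINT x|lborel. f x * q x)"
  using assms(1)
proof induction
  case (interval a b)
  then show ?case by (rule base)
next
  case (lincomb f w g v c)
  have i: "integrable lborel (\<lambda>x. w x * p x)" "integrable lborel (\<lambda>x. v x * p x)"
    "integrable lborel (\<lambda>x. f x * q x)" "integrable lborel (\<lambda>x. g x * q x)"
    using lincomb.hyps p q by (auto intro!: L2_mult_integrable dest: FT_L2_left FT_L2_right)
  then show ?case
    using lincomb.IH by (simp add: distrib_right mult.assoc)
next
  case (limit F W f w)
  have "(\<lambda>n. LINT x|lborel. W n x * p x) \<longlonglongrightarrow> (LINT x|lborel. w x * p x)"
    by (rule L2_lim_pairing) (use limit p in \<open>auto dest: FT_L2_right\<close>)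
  moreover have "(\<lambda>n. LINT x|lborel. F n x * q x) \<longlonglongrightarrow> (LINT x|lborel. f x * q x)"
    by (rule L2_lim_pairing) (use limit q in \<open>auto dest: FT_L2_left\<close>)
  ultimately show ?case
    using limit.IH by (auto intro: LIMSEQ_unique)
qed

text \<open>
  The identity is reduced to intervals in one argument after the other.
\<close>

lemma FT_isometry:
  assumes fw: "FT f w" and gv: "FT g v"
  shows "(LINT x|lborel. w x * cnj (v x)) = (LINT x|lborel. f x * cnj (g x))"
proof (rule FT_pairing[OF fw])
  show "(\<lambda>x. cnj (v x)) \<in> L2 lborel" "(\<lambda>x. cnj (g x)) \<in> L2 lborel"
    using gv by (auto intro: L2_cnj FT_L2_left FT_L2_right)
  fix a b :: real assume ab: "a \<le> b"
  have "(LINT x|lborel. v x * cnj (fourier_interval a b x)) = (LINT x|lborel. g x * cnj (indicator {a..b} x))"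
  proof (rule FT_pairing[OF gv])
    show "(\<lambda>x. cnj (fourier_interval a b x)) \<in> L2 lborel" "(\<lambda>x. cnj (indicator {a..b} x)) \<in> L2 lborel"
      using ab by (intro L2_cnj fourier_interval_L2 L2_indicator_interval; simp)+
  qed (use ab fourier_interval_isometry in auto)
  from arg_cong[OF this, of cnj]
  show "(LINT x|lborel. fourier_interval a b x * cnj (v x)) = (LINT x|lborel. indicator {a..b} x * cnj (g x))"
    by (simp add: mult.commute flip: Bochner_Integration.integral_cnj)
qed

lemma FT_norm:
  assumes "FT f w"
  shows "(LINT x|lborel. (norm (w x))\<^sup>2) = (LINT x|lborel. (norm (f x))\<^sup>2)"
  using FT_isometry[OF assms assms]
  unfolding norm_sq_integral_eq_pairing[symmetric] of_real_eq_iff .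

lemma FT_zero: "FT (\<lambda>x. 0) (\<lambda>x. 0)"
  using FT.lincomb[OF FT.interval[of 0 0] FT.lincomb[OF FT.interval[of 0 0] FT.interval[of 0 0], of "-2"], of 1]
  by simp

lemma FT_diff: "FT f w \<Longrightarrow> FT g v \<Longrightarrow> FT (\<lambda>x. f x - g x) (\<lambda>\<omega>. w \<omega> - v \<omega>)"
  using FT.lincomb[of g v f w "-1"] by simp

lemma FT_cong_AE:
  assumes "FT f w" "AE x in lborel. f x = f' x" "AE x in lborel. w x = w' x"
    and [measurable]: "f' \<in> borel_measurable borel" "w' \<in> borel_measurable borel"
  shows "FT f' w'"
proof (rule FT.limit[where F = "\<lambda>n. f" and W = "\<lambda>n. w"])
  show "f' \<in> L2 lborel" by (rule L2_AE_cong[OF FT_L2_left[OF assms(1)]]) (use assms(2) in auto)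
  show "w' \<in> L2 lborel" by (rule L2_AE_cong[OF FT_L2_right[OF assms(1)]]) (use assms(3) in auto)
qed (use assms L2_lim_AE_cong in auto)

lemma FT_unique:
  assumes "FT f w" "FT f' w'" "AE x in lborel. f x = f' x"
  shows "AE x in lborel. w x = w' x"
proof -
  have FT: "FT (\<lambda>x. f x - f' x) (\<lambda>x. w x - w' x)" by (rule FT_diff[OF assms(1,2)])
  have "(LINT x|lborel. (norm (w x - w' x))\<^sup>2) = (LINT x|lborel. (norm (f x - f' x))\<^sup>2)"
    by (rule FT_norm[OF FT])
  also have "\<dots> = 0" by (rule integral_eq_zero_AE) (use assms(3) in auto)
  finally have "AE x in lborel. w x - w' x = 0" by (rule L2_zero_AE[OF FT_L2_right[OF FT]])
  then show ?thesis by auto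
qed

section \<open>Totality of the Fourier transform\<close>

text \<open>
  The domain of \<open>FT\<close>, which turns out to be all of \<open>L\<^sub>2(\<real>)\<close>.
\<close>

definition FT_dom :: "(real \<Rightarrow> complex) set" where
  "FT_dom = {f. \<exists>w. FT f w}"

text \<open>
  The isometry makes the transforms of a convergent sequence a Cauchy sequence, and
  completeness provides their limit.
\<close>

lemma FT_dom_limit:
  assumes F: "\<And>n. F n \<in> FT_dom" and f: "f \<in> L2 lborel" and lim: "L2_lim lborel F f"
  shows "f \<in> FT_dom"
proof -
  have FL2: "F n \<in> L2 lborel" for n
    using F[of n] unfolding FT_dom_def by (auto dest: FT_L2_left)
  \<comment> \<open>Two terms within \<open>(1/4) ^ (n + 1)\<close> of the limit (in squared norm) are within
    \<open>2 * (1/4) ^ (n + 1) + 2 * (1/4) ^ (n + 1) = (1/4) ^ n\<close> of each other.\<close>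
  have "\<exists>k. (LINT x|lborel. (norm (F k x - f x))\<^sup>2) < (1/4) ^ (n + 1)" for n
    using order_tendstoD(2)[OF lim[unfolded L2_lim_def], of "(1/4) ^ (n + 1)"]
    by (auto simp: eventually_sequentially)
  then have "\<exists>r. \<forall>n. (LINT x|lborel. (norm (F (r n) x - f x))\<^sup>2) < (1/4) ^ (n + 1)"
    by (intro choice allI)
  then obtain r where r: "\<And>n. (LINT x|lborel. (norm (F (r n) x - f x))\<^sup>2) < (1/4) ^ (n + 1)"
    by blast
  have "\<exists>W. \<forall>n. FT (F (r n)) (W n)"
    by (intro choice allI) (use F in \<open>simp add: FT_dom_def\<close>)
  then obtain W where W: "\<And>n. FT (F (r n)) (W n)"
    by blast
  have int: "integrable lborel (\<lambda>x. (norm (F (r n) x - f x))\<^sup>2)" for n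
    by (intro L2_norm_sq_integrable L2_diff FL2 f)
  have "(LINT x|lborel. (norm (W m x - W n x))\<^sup>2) \<le> (1/4) ^ n" if "n \<le> m" for n m
  proof -
    have "(LINT x|lborel. (norm (W m x - W n x))\<^sup>2) = (LINT x|lborel. (norm (F (r m) x - F (r n) x))\<^sup>2)"
      by (rule FT_norm[OF FT_diff[OF W W]])
    also have "\<dots> \<le> (LINT x|lborel. 2 * (norm (F (r m) x - f x))\<^sup>2 + 2 * (norm (F (r n) x - f x))\<^sup>2)"
    proof (rule integral_mono)
      show "integrable lborel (\<lambda>x. (norm (F (r m) x - F (r n) x))\<^sup>2)"
        by (intro L2_norm_sq_integrable L2_diff FL2)
      show "integrable lborel (\<lambda>x. 2 * (norm (F (r m) x - f x))\<^sup>2 + 2 * (norm (F (r n) x - f x))\<^sup>2)"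
        using int by (intro Bochner_Integration.integrable_add integrable_mult_right)
      show "(norm (F (r m) x - F (r n) x))\<^sup>2 \<le> 2 * (norm (F (r m) x - f x))\<^sup>2 + 2 * (norm (F (r n) x - f x))\<^sup>2" for x
        using norm_add_sq_le[of "F (r m) x - f x" "f x - F (r n) x"] by (simp add: norm_minus_commute)
    qed
    also have "\<dots> = 2 * (LINT x|lborel. (norm (F (r m) x - f x))\<^sup>2) + 2 * (LINT x|lborel. (norm (F (r n) x - f x))\<^sup>2)"
      using int by simp
    also have "\<dots> \<le> 2 * (1/4) ^ (m + 1) + 2 * (1/4) ^ (n + 1)"
      using r[of m] r[of n] by simp
    also have "\<dots> \<le> 2 * (1/4) ^ (n + 1) + 2 * (1/4) ^ (n + 1)"
      using that by (intro add_mono mult_left_mono power_decreasing) auto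
    also have "\<dots> = (1/4) ^ n" by simp
    finally show ?thesis .
  qed
  from L2_geometric_Cauchy_lim[OF FT_L2_right[OF W] this]
  obtain w where w: "w \<in> L2 lborel" "L2_lim lborel W w" by blast
  have "L2_lim lborel (\<lambda>n. F (r n)) f"
    unfolding L2_lim_def
  proof (rule tendsto_sandwich[where f = "\<lambda>_. 0"])
    show "(\<lambda>n. (1/4::real) ^ (n + 1)) \<longlonglongrightarrow> 0"
      by (rule LIMSEQ_ignore_initial_segment) (intro LIMSEQ_power_zero, simp)
    show "\<forall>\<^sub>F n in sequentially. (LINT x|lborel. (norm (F (r n) x - f x))\<^sup>2) \<le> (1/4) ^ (n + 1)"
      by (intro always_eventually allI less_imp_le r)
  qed auto
  then have "FT f w"
    by (rule FT.limit[where F = "\<lambda>n. F (r n)" and W = W, OF W f w(1) _ w(2)])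
  then show ?thesis by (auto simp: FT_dom_def)
qed

lemma FT_dom_lincomb: "f \<in> FT_dom \<Longrightarrow> g \<in> FT_dom \<Longrightarrow> (\<lambda>x. c * f x + g x) \<in> FT_dom"
  unfolding FT_dom_def by (auto intro: FT.lincomb)

lemma FT_dom_zero: "(\<lambda>x. 0) \<in> FT_dom"
  unfolding FT_dom_def using FT_zero by auto

lemma FT_dom_sum:
  assumes "finite S" "\<And>i. i \<in> S \<Longrightarrow> f i \<in> FT_dom"
  shows "(\<lambda>x. \<Sum>i\<in>S. c i * f i x) \<in> FT_dom"
  using assms by (induction S rule: finite_induct) (auto intro: FT_dom_zero FT_dom_lincomb)

lemma FT_dom_indicator_interval: "indicator {a..b} \<in> FT_dom"
proof (cases "a \<le> b")
  case True
  then show ?thesis unfolding FT_dom_def using FT.interval by auto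
next
  case False
  then have "(indicator {a..b} :: real \<Rightarrow> complex) = (\<lambda>x. 0)" by auto
  then show ?thesis using FT_dom_zero by simp
qed

lemma L2_indicator_lborel_subset:
  assumes "A \<in> sets borel" "A \<subseteq> {a..b}"
  shows "(indicator A :: real \<Rightarrow> complex) \<in> L2 lborel"
proof (rule L2_indicator)
  have "emeasure lborel A \<le> emeasure lborel {a..b}"
    using assms by (intro emeasure_mono) auto
  also have "\<dots> < \<infinity>" by (cases "a \<le> b") auto
  finally show "emeasure lborel A < \<infinity>" .
qed (use assms in auto)

lemma indicator_UN_disjoint_sums:
  assumes "disjoint_family A"
  shows "(\<lambda>i. indicator (A i) x :: complex) sums indicator (\<Union>i. A i) x"
proof (cases "\<exists>i. x \<in> A i")
  case True
  then obtain i where i: "x \<in> A i" by auto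
  with assms have "x \<notin> A j" if "j \<noteq> i" for j
    using that unfolding disjoint_family_on_def by auto
  then have "indicator (A j) x = (if j = i then 1 else 0 :: complex)" for j
    using i by (cases "j = i") auto
  then show ?thesis using i sums_single[of i "\<lambda>_. 1::complex"] by (auto simp: indicator_def)
next
  case False
  then show ?thesis by (auto simp: indicator_def)
qed

text \<open>
  The Borel sets with this property form a Dynkin system containing the compact intervals.
  Intersecting with a fixed bounded interval keeps complements square integrable.
\<close>

lemma FT_dom_indicator_bounded:
  assumes "A \<in> sets borel"
  shows "indicator (A \<inter> {- real n..real n}) \<in> FT_dom"
proof -
  let ?K = "{- real n..real n}"
  let ?G = "range (\<lambda>(a, b). {a..b :: real})"
  have "Int_stable ?G"
  proof (rule Int_stableI)
    fix X Y assume "X \<in> ?G" "Y \<in> ?G"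
    then obtain a b c d where "X = {a..b}" "Y = {c..d}" by auto
    then have "X \<inter> Y = (\<lambda>(a, b). {a..b}) (max a c, min b d)" by auto
    then show "X \<inter> Y \<in> ?G" by (metis rangeI)
  qed
  moreover have "?G \<subseteq> Pow UNIV" by simp
  moreover have "A \<in> sigma_sets UNIV ?G"
    using assms unfolding borel_eq_atLeastAtMost by simp
  ultimately show ?thesis
  proof (induction rule: sigma_sets_induct_disjoint[of ?G UNIV A])
    case (basic X)
    then obtain a b where "X = {a..b}" by auto
    then have "X \<inter> ?K = {max a (- real n)..min b (real n)}" by auto
    then show ?case using FT_dom_indicator_interval by simp
  next
    case empty
    show ?case using FT_dom_zero by simp
  next
    case (compl X)
    have "(indicator ((UNIV - X) \<inter> ?K) :: real \<Rightarrow> complex) = (\<lambda>x. -1 * indicator (X \<inter> ?K) x + indicator ?K x)"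
      by (auto simp: indicator_def fun_eq_iff)
    then show ?case using FT_dom_lincomb[OF compl(2) FT_dom_indicator_interval, of "-1"] by simp
  next
    case (union X)
    have meas: "X i \<in> sets borel" for i
      using union.hyps unfolding borel_eq_atLeastAtMost by auto
    define F where "F N = (\<lambda>x. \<Sum>i<N. 1 * indicator (X i \<inter> ?K) x :: complex)" for N :: nat
    have F: "F N \<in> FT_dom" for N
      unfolding F_def by (rule FT_dom_sum) (use union in auto)
    have lim: "(\<lambda>N. F N x) \<longlonglongrightarrow> indicator ((\<Union>i. X i) \<inter> ?K) x" for x
      using indicator_UN_disjoint_sums[of "\<lambda>i. X i \<inter> ?K" x] union(1)
      unfolding F_def sums_def by (auto simp: disjoint_family_on_def)
    have F_eq: "F N = indicator ((\<Union>i<N. X i) \<inter> ?K)" for N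
    proof (induction N)
      case 0
      show ?case by (auto simp: F_def)
    next
      case (Suc N)
      have "F (Suc N) x = F N x + indicator (X N \<inter> ?K) x" for x by (simp add: F_def)
      moreover have "X N \<inter> (\<Union>i<N. X i) = {}"
        using union(1) unfolding disjoint_family_on_def by (fastforce dest: less_imp_neq)
      ultimately show ?case
        using Suc by (auto simp: fun_eq_iff indicator_def lessThan_Suc)
    qed
    show ?case
    proof (rule FT_dom_limit[of F])
      show u: "indicator (\<Union> (range X) \<inter> ?K) \<in> L2 lborel"
        using meas by (intro L2_indicator_lborel_subset[where a = "- real n" and b = "real n"]) auto
      have FL: "F N \<in> L2 lborel" for N
        using meas unfolding F_eq by (intro L2_indicator_lborel_subset[where a = "- real n" and b = "real n"]) auto
      show "L2_lim lborel F (indicator (\<Union> (range X) \<inter> ?K))"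
      proof (rule L2_lim_dominated[OF FL u])
        show "AE x in lborel. (\<lambda>N. F N x) \<longlonglongrightarrow> indicator (\<Union> (range X) \<inter> ?K) x"
          using lim by auto
        show "integrable lborel (indicator ?K :: real \<Rightarrow> real)"
          by (intro integrable_real_indicator) auto
        show "AE x in lborel. (cmod (F N x - indicator (\<Union> (range X) \<inter> ?K) x))\<^sup>2 \<le> indicator ?K x" for N
          by (auto simp: F_eq indicator_def)
      qed
    qed (rule F)
  qed
qed

lemma FT_dom_indicator:
  assumes A: "A \<in> sets borel" "emeasure lborel A < \<infinity>"
  shows "indicator A \<in> FT_dom"
proof (rule FT_dom_limit)
  show "indicator (A \<inter> {- real n..real n}) \<in> FT_dom" for n
    by (rule FT_dom_indicator_bounded[OF A(1)])
  show L: "(indicator A :: real \<Rightarrow> complex) \<in> L2 lborel"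
    using A by (intro L2_indicator) auto
  show "L2_lim lborel (\<lambda>n. indicator (A \<inter> {- real n..real n})) (indicator A)"
  proof (rule L2_lim_dominated[OF _ L])
    show "indicator (A \<inter> {- real n..real n}) \<in> L2 lborel" for n
      using A(1) by (intro L2_indicator_lborel_subset) auto
    show "AE x in lborel. (\<lambda>n. indicator (A \<inter> {- real n..real n}) x) \<longlonglongrightarrow> (indicator A x :: complex)"
    proof (rule AE_I2)
      fix x :: real
      obtain N where N: "\<bar>x\<bar> \<le> real N" using real_arch_simple by blast
      have "\<forall>\<^sub>F n in sequentially. indicator (A \<inter> {- real n..real n}) x = (indicator A x :: complex)"
        using eventually_ge_at_top[of N]
      proof eventually_elim
        fix n assume "N \<le> n"
        then have "\<bar>x\<bar> \<le> real n" using N by linarith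
        then show "indicator (A \<inter> {- real n..real n}) x = (indicator A x :: complex)"
          by (auto simp: indicator_def)
      qed
      then show "(\<lambda>n. indicator (A \<inter> {- real n..real n}) x) \<longlonglongrightarrow> (indicator A x :: complex)"
        by (rule tendsto_eventually)
    qed
    show "integrable lborel (indicator A :: real \<Rightarrow> real)"
      using A by (intro integrable_real_indicator) auto
  qed (auto simp: indicator_def)
qed

text \<open>
  Simple functions dominated by \<open>2 |f|\<close> approximate \<open>f\<close>; their nonzero values are
  taken on sets of finite measure.
\<close>

theorem FT_total:
  assumes f: "f \<in> L2 lborel"
  obtains w where "FT f w"
proof -
  obtain F where simple: "\<And>i. simple_function lborel (F i)"
    and lim: "\<And>x. (\<lambda>i. F i x) \<longlonglongrightarrow> f x" and bound: "\<And>i x. norm (F i x) \<le> 2 * norm (f x)"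
    using borel_measurable_implies_sequence_metric[OF L2_measurable[OF f], of 0] by auto
  have FL: "F i \<in> L2 lborel" for i
  proof (rule L2_bound)
    show "F i \<in> borel_measurable lborel" by (rule borel_measurable_simple_function[OF simple])
    show "integrable lborel (\<lambda>x. 4 * (norm (f x))\<^sup>2)"
      by (intro integrable_mult_right L2_norm_sq_integrable f)
    show "AE x in lborel. (norm (F i x))\<^sup>2 \<le> 4 * (norm (f x))\<^sup>2"
      using power_mono[OF bound norm_ge_zero, of _ _ 2] by (auto simp: power_mult_distrib)
  qed
  have dom: "F i \<in> FT_dom" for i
  proof -
    let ?V = "F i ` UNIV - {0}"
    have fin: "finite ?V" using simple_functionD(1)[OF simple[of i]] by simp
    have rep: "F i = (\<lambda>x. \<Sum>y\<in>?V. y * indicator (F i -` {y}) x)"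
    proof
      fix x
      have "F i x = (\<Sum>y\<in>F i ` UNIV. y * indicator (F i -` {y}) x)"
        by (subst simple_function_indicator_representation_banach[OF simple[of i], of x])
           (auto intro!: sum.cong simp: indicator_def)
      also have "\<dots> = (\<Sum>y\<in>?V. y * indicator (F i -` {y}) x)"
        using simple_functionD(1)[OF simple[of i]] by (intro sum.mono_neutral_right) auto
      finally show "F i x = (\<Sum>y\<in>?V. y * indicator (F i -` {y}) x)" .
    qed
    have "indicator (F i -` {y}) \<in> FT_dom" if "y \<in> ?V" for y
    proof (rule FT_dom_indicator)
      show m: "F i -` {y} \<in> sets borel"
        using simple_functionD(2)[OF simple[of i], of "{y}"] by simp
      have "integrable lborel (\<lambda>x. (norm (F i x))\<^sup>2 / (norm y)\<^sup>2)"
        using L2_norm_sq_integrable[OF FL] by simp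
      then have "integrable lborel (indicator (F i -` {y}) :: real \<Rightarrow> real)"
        by (rule Bochner_Integration.integrable_bound) (use m that in \<open>auto simp: indicator_def\<close>)
      then show "emeasure lborel (F i -` {y}) < \<infinity>"
        by (simp add: integrable_indicator_iff)
    qed
    then show ?thesis
      by (subst rep) (rule FT_dom_sum[OF fin])
  qed
  have "f \<in> FT_dom"
  proof (rule FT_dom_limit[OF dom f], rule L2_lim_dominated[where F = F, OF FL f])
    show "integrable lborel (\<lambda>x. 9 * (norm (f x))\<^sup>2)"
      by (intro integrable_mult_right L2_norm_sq_integrable f)
    show "AE x in lborel. (norm (F n x - f x))\<^sup>2 \<le> 9 * (norm (f x))\<^sup>2" for n
    proof (rule AE_I2)
      fix x
      have "norm (F n x - f x) \<le> 3 * norm (f x)"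
        using norm_triangle_ineq4[of "F n x" "f x"] bound[of n x] by simp
      from power_mono[OF this norm_ge_zero, of 2] show "(norm (F n x - f x))\<^sup>2 \<le> 9 * (norm (f x))\<^sup>2"
        by (simp add: power_mult_distrib)
    qed
  qed (use lim in auto)
  then show ?thesis using that by (auto simp: FT_dom_def)
qed

section \<open>Multiplication formula, inversion and convolution\<close>

lemma fourier_int_multiplication_formula:
  assumes f: "integrable lborel f" and g: "integrable lborel g"
  shows "(LINT \<omega>|lborel. fourier_int f \<omega> * g \<omega>) = (LINT x|lborel. f x * fourier_int g x)"
proof -
  have [measurable]: "f \<in> borel_measurable borel" "g \<in> borel_measurable borel"
    using f g by auto
  let ?h = "\<lambda>x \<omega>. cis (- (\<omega> * x)) * f x * g \<omega>"
  have int: "integrable (lborel \<Otimes>\<^sub>M lborel) (case_prod ?h)"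
  proof (rule lborel_pair.Fubini_integrable)
    show "case_prod ?h \<in> borel_measurable (lborel \<Otimes>\<^sub>M lborel)" by measurable
    show "integrable lborel (\<lambda>x. LINT y|lborel. norm (case (x, y) of (x, y) \<Rightarrow> ?h x y))"
      using f by (simp add: norm_mult)
    have "integrable lborel (\<lambda>\<omega>. ?h x \<omega>)" for x
      by (rule Bochner_Integration.integrable_bound[OF integrable_mult_right[OF g, of "f x"]]) (auto simp: norm_mult)
    then show "AE x in lborel. integrable lborel (\<lambda>y. case (x, y) of (x, y) \<Rightarrow> ?h x y)"
      by simp
  qed
  have "(LINT \<omega>|lborel. LINT x|lborel. ?h x \<omega>) = (LINT x|lborel. LINT \<omega>|lborel. ?h x \<omega>)"
    by (rule lborel_pair.Fubini_integral[OF int])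
  moreover have "(LINT x|lborel. ?h x \<omega>) = (LINT x|lborel. cis (- (\<omega> * x)) * f x) * g \<omega>" for \<omega>
    by simp
  moreover have "(LINT \<omega>|lborel. ?h x \<omega>) = f x * (LINT \<omega>|lborel. cis (- (x * \<omega>)) * g \<omega>)" for x
    by (simp add: mult_ac flip: integral_mult_right_zero)
  ultimately have "(LINT \<omega>|lborel. (LINT x|lborel. cis (- (\<omega> * x)) * f x) * g \<omega>) =
      (LINT x|lborel. f x * (LINT \<omega>|lborel. cis (- (x * \<omega>)) * g \<omega>))"
    by (simp only:)
  from arg_cong[OF this, of "(*) (complex_of_real (1 / sqrt (2 * pi)))"] show ?thesis
    unfolding fourier_int_def by (simp only: integral_mult_right_zero[symmetric] mult_ac)
qed

lemma integrable_indicator_interval: "integrable lborel (indicator {a..b} :: real \<Rightarrow> complex)"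
  unfolding complex_indicator_eq
  by (cases "a \<le> b") (intro integrable_of_real integrable_real_indicator; simp)+

lemma FT_multiplication_formula:
  assumes fw: "FT f w" and gv: "FT g v"
  shows "(LINT x|lborel. w x * g x) = (LINT x|lborel. f x * v x)"
proof (rule FT_pairing[OF fw FT_L2_left[OF gv] FT_L2_right[OF gv]])
  fix a b :: real assume ab: "a \<le> b"
  have "(LINT x|lborel. v x * indicator {a..b} x) = (LINT x|lborel. g x * fourier_interval a b x)"
    by (rule FT_pairing[OF gv L2_indicator_interval fourier_interval_L2[OF ab]])
       (intro fourier_int_multiplication_formula integrable_indicator_interval)
  then show "(LINT x|lborel. fourier_interval a b x * g x) = (LINT x|lborel. indicator {a..b} x * v x)"
    by (simp add: mult.commute)
qed

lemma L2_zero_AE_if_orthogonal: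
  assumes q: "q \<in> L2 M" and 0: "\<And>h. h \<in> L2 M \<Longrightarrow> (LINT x|M. h x * q x) = 0"
  shows "AE x in M. q x = 0"
proof (rule L2_zero_AE[OF q])
  show "(LINT x|M. (norm (q x))\<^sup>2) = 0"
    using 0[OF L2_cnj[OF q]] norm_sq_integral_eq_pairing[of M q] by (simp add: mult.commute)
qed

text \<open>
  The indicator functions of intervals span a dense subspace: this is \<open>FT_pairing\<close> with the
  zero function on the Fourier side.
\<close>

lemma L2_zero_AE_if_interval_integrals_zero:
  fixes q :: "real \<Rightarrow> complex"
  assumes q: "q \<in> L2 lborel" and 0: "\<And>a b. a \<le> b \<Longrightarrow> (LINT x|lborel. indicator {a..b} x * q x) = 0"
  shows "AE x in lborel. q x = 0"
proof (rule L2_zero_AE_if_orthogonal[OF q])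
  fix h :: "real \<Rightarrow> complex" assume "h \<in> L2 lborel"
  then obtain v where "FT h v" by (rule FT_total)
  from FT_pairing[OF this L2_zero q] 0 show "(LINT x|lborel. h x * q x) = 0" by simp
qed

text \<open>
  By the multiplication formula \<open>w\<close> and \<open>fourier_int f\<close> have the same integral over
  every interval. As \<open>fourier_int f\<close> is bounded, the difference is square integrable on
  bounded sets, which suffices to compare the two functions.
\<close>

lemma FT_eq_fourier_int:
  assumes fw: "FT f w" and f: "integrable lborel f"
  shows "AE \<omega> in lborel. w \<omega> = fourier_int f \<omega>"
proof -
  have [measurable]: "f \<in> borel_measurable borel" using f by auto
  have w: "w \<in> L2 lborel" by (rule FT_L2_right[OF fw])
  have w_int: "integrable lborel (\<lambda>x. indicator {a..b} x * w x)" for a b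
    by (rule L2_mult_integrable[OF L2_indicator_interval w])
  have bounded: "(\<lambda>x. fourier_int f x * indicator {a..b} x) \<in> L2 lborel" for a b
    by (rule L2_mult_bounded[OF L2_indicator_interval _ fourier_int_bound]) simp
  have f_int: "integrable lborel (\<lambda>x. indicator {a..b} x * fourier_int f x)" for a b
    using L2_mult_integrable[OF L2_indicator_interval bounded, of a b a b]
    by (rule Bochner_Integration.integrable_cong[THEN iffD1, rotated -1]) (auto simp: indicator_def)
  have intervals: "(LINT x|lborel. indicator {a..b} x * (w x - fourier_int f x)) = 0" if "a \<le> b" for a b
  proof -
    have "(LINT x|lborel. w x * indicator {a..b} x) = (LINT x|lborel. f x * fourier_interval a b x)"
      by (rule FT_multiplication_formula[OF fw FT.interval[OF that]])
    also have "\<dots> = (LINT x|lborel. fourier_int f x * indicator {a..b} x)"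
      by (rule fourier_int_multiplication_formula[symmetric, OF f integrable_indicator_interval])
    finally show ?thesis
      using w_int f_int by (simp add: right_diff_distrib mult.commute)
  qed
  have "AE x in lborel. indicator {- real n..real n} x * (w x - fourier_int f x) = 0" for n
  proof (rule L2_zero_AE_if_interval_integrals_zero)
    have "(\<lambda>x. indicator {- real n..real n} x * w x) \<in> L2 lborel"
      by (rule L2_mult_bounded[where c = 1, OF w]) (auto simp: indicator_def)
    from L2_diff[OF this bounded[of "- real n" "real n"]]
    show "(\<lambda>x. indicator {- real n..real n} x * (w x - fourier_int f x)) \<in> L2 lborel"
      by (simp add: left_diff_distrib mult.commute)
    fix a b :: real assume "a \<le> b"
    let ?a = "max a (- real n)" and ?b = "min b (real n)"
    have "(LINT x|lborel. indicator {a..b} x * (indicator {- real n..real n} x * (w x - fourier_int f x)))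
        = (LINT x|lborel. indicator {?a..?b} x * (w x - fourier_int f x))"
      by (intro Bochner_Integration.integral_cong) (auto simp: indicator_def)
    also have "\<dots> = 0"
      using intervals[of ?a ?b] by (cases "?a \<le> ?b") auto
    finally show "(LINT x|lborel. indicator {a..b} x * (indicator {- real n..real n} x * (w x - fourier_int f x))) = 0" .
  qed
  then have "AE x in lborel. \<forall>n. indicator {- real n..real n} x * (w x - fourier_int f x) = 0"
    by (intro AE_all_countable[THEN iffD2] allI)
  then show ?thesis
  proof eventually_elim
    fix x assume *: "\<forall>n. indicator {- real n..real n} x * (w x - fourier_int f x) = 0"
    obtain n where "\<bar>x\<bar> \<le> real n" using real_arch_simple by blast
    then have "x \<in> {- real n..real n}" by auto
    then show "w x = fourier_int f x" using *[rule_format, of n] by simp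
  qed
qed

lemma L2_reflect:
  fixes f :: "real \<Rightarrow> complex"
  shows "f \<in> L2 lborel \<Longrightarrow> (\<lambda>x. f (- x)) \<in> L2 lborel"
  using lborel_integrable_real_affine[of "\<lambda>x. (norm (f x))\<^sup>2" "-1" 0]
  by (auto simp: L2_def)

lemma cnj_indicator: "cnj (indicator A x) = indicator A x"
  by (cases "x \<in> A") auto

lemma FT_cnj_reflect:
  assumes "FT f w"
  shows "FT (\<lambda>x. cnj (f (- x))) (\<lambda>\<omega>. cnj (w \<omega>))"
  using assms
proof induction
  case (interval a b)
  have "(\<lambda>x. cnj (indicator {a..b} (- x))) = indicator {-b..-a}"
    by (auto simp: indicator_def fun_eq_iff)
  moreover have "cnj (fourier_interval a b \<omega>) = fourier_interval (-b) (-a) \<omega>" for \<omega>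
  proof -
    have "cnj (LINT x|lborel. cis (- (\<omega> * x)) * indicator {a..b} x) = (LINT x|lborel. cis (\<omega> * x) * indicator {a..b} x)"
      by (simp add: cis_cnj cnj_indicator flip: Bochner_Integration.integral_cnj)
    also have "\<dots> = (LINT x|lborel. cis (\<omega> * - x) * indicator {a..b} (- x))"
      by (rule lborel_integral_reflect[symmetric])
    also have "\<dots> = (LINT x|lborel. cis (- (\<omega> * x)) * indicator {-b..-a} x)"
      by (intro Bochner_Integration.integral_cong) (auto simp: indicator_def)
    finally show ?thesis unfolding fourier_int_def by simp
  qed
  ultimately show ?case
    using FT.interval[of "-b" "-a"] interval by simp
next
  case (lincomb f w g v c)
  show ?case using FT.lincomb[OF lincomb.IH, of "cnj c"] by simp
next
  case (limit F W f w)
  show ?case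
  proof (rule FT.limit[OF limit.IH])
    show "L2_lim lborel (\<lambda>n x. cnj (F n (- x))) (\<lambda>x. cnj (f (- x)))"
    proof -
      have "(LINT x|lborel. (norm (F n (- x) - f (- x)))\<^sup>2) = (LINT x|lborel. (norm (F n x - f x))\<^sup>2)" for n
        using lborel_integral_real_affine[of "-1" "\<lambda>x. (norm (F n x - f x))\<^sup>2" 0] by simp
      then show ?thesis using limit(4) by (simp add: L2_lim_def flip: complex_cnj_diff)
    qed
  qed (use limit in \<open>auto intro: L2_cnj L2_reflect L2_lim_cnj\<close>)
qed

text \<open>
  The multiplication formula says that the bilinear transpose of the transform is the
  transform itself; the isometry says that its Hilbert space adjoint is a left inverse.
  The two adjoints differ by conjugation and reflection.
\<close>

theorem FT_inversion:
  assumes fw: "FT f w"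
  shows "FT w (\<lambda>x. f (- x))"
proof -
  obtain u where u: "FT w u" using FT_total[OF FT_L2_right[OF fw]] by blast
  have L2: "u \<in> L2 lborel" "(\<lambda>x. f (- x)) \<in> L2 lborel"
    using FT_L2_right[OF u] L2_reflect[OF FT_L2_left[OF fw]] by auto
  have "AE x in lborel. u x - f (- x) = 0"
  proof (rule L2_zero_AE_if_orthogonal[OF L2_diff[OF L2]])
    fix g :: "real \<Rightarrow> complex" assume g: "g \<in> L2 lborel"
    then obtain v where v: "FT g v" by (rule FT_total)
    have "(LINT x|lborel. u x * g x) = (LINT x|lborel. w x * v x)"
      by (rule FT_multiplication_formula[OF u v])
    also have "\<dots> = (LINT x|lborel. f x * g (- x))"
      using FT_isometry[OF fw FT_cnj_reflect[OF v]] by simp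
    also have "\<dots> = (LINT x|lborel. f (- x) * g x)"
      using lborel_integral_reflect[of "\<lambda>x. f x * g (- x)"] by simp
    finally show "(LINT x|lborel. g x * (u x - f (- x))) = 0"
      using L2_mult_integrable[OF g L2(1)] L2_mult_integrable[OF g L2(2)]
      by (simp add: right_diff_distrib mult.commute)
  qed
  then have "AE x in lborel. u x = f (- x)" by simp
  then show ?thesis
    by (rule FT_cong_AE[OF u AE_I2[OF refl]]) (use FT_L2_right[OF fw] L2(2) in \<open>auto dest: L2_measurable\<close>)
qed

text \<open>
  The value at \<open>- x\<close> of the transform of
  \<open>k w\<close> is the pairing of \<open>w\<close> with \<open>k\<close> times a character, and the
  multiplication formula turns it into the pairing of \<open>f\<close> with the transform of that
  product, which is the translated kernel. Applying the inversion theorem three times then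
  undoes the last transform.
\<close>

theorem FT_convolution:
  assumes fw: "FT f w" and k: "integrable lborel k" and k_bound: "\<And>\<omega>. norm (k \<omega>) \<le> c"
  defines "K \<equiv> \<lambda>x y. complex_of_real (1 / (2 * pi)) * (LINT \<omega>|lborel. cis (\<omega> * (x - y)) * k \<omega>)"
  shows "FT (int_op K f) (\<lambda>\<omega>. k \<omega> * w \<omega>)"
proof -
  have km [measurable]: "k \<in> borel_measurable borel" using k by auto
  have fm [measurable]: "f \<in> borel_measurable borel" using FT_L2_left[OF fw] by (auto dest: L2_measurable)
  have kL2: "k \<in> L2 lborel" by (rule L2_bounded_integrable[OF k k_bound])
  let ?p = "\<lambda>\<omega>. k \<omega> * w \<omega>"
  have p_L2: "?p \<in> L2 lborel"
    by (rule L2_mult_bounded[OF FT_L2_right[OF fw] _ k_bound]) simp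
  have p_int: "integrable lborel ?p"
    by (rule L2_mult_integrable[OF kL2 FT_L2_right[OF fw]])
  obtain q where q: "FT ?p q" using FT_total[OF p_L2] by blast
  have "fourier_int ?p x = int_op K f (- x)" for x
  proof -
    let ?e = "\<lambda>\<omega>. cis (- (x * \<omega>)) * k \<omega>"
    have e_int: "integrable lborel ?e"
      by (rule Bochner_Integration.integrable_bound[OF k]) (auto simp: norm_mult)
    have e_L2: "?e \<in> L2 lborel"
      by (rule L2_bounded_integrable[OF e_int, of c]) (use k_bound in \<open>simp add: norm_mult\<close>)
    obtain r where r: "FT ?e r" using FT_total[OF e_L2] by blast
    have "(LINT \<omega>|lborel. w \<omega> * ?e \<omega>) = (LINT y|lborel. f y * r y)"
      by (rule FT_multiplication_formula[OF fw r])
    also have "\<dots> = (LINT y|lborel. f y * fourier_int ?e y)"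
    proof (rule integral_cong_AE)
      show "(\<lambda>y. f y * r y) \<in> borel_measurable lborel"
        using FT_L2_right[OF r] by measurable
      show "(\<lambda>y. f y * fourier_int ?e y) \<in> borel_measurable lborel" by measurable
      show "AE y in lborel. f y * r y = f y * fourier_int ?e y"
        using FT_eq_fourier_int[OF r e_int] by eventually_elim simp
    qed
    finally have "complex_of_real (1 / sqrt (2 * pi)) * (LINT \<omega>|lborel. w \<omega> * ?e \<omega>) =
        (LINT y|lborel. complex_of_real (1 / sqrt (2 * pi)) * (f y * fourier_int ?e y))"
      by simp
    also have "\<dots> = (LINT y|lborel. K (- x) y * f y)"
    proof (rule Bochner_Integration.integral_cong[OF refl])
      fix y
      have "(LINT \<omega>|lborel. cis (- (y * \<omega>)) * (cis (- (x * \<omega>)) * k \<omega>)) = (LINT \<omega>|lborel. cis (\<omega> * (- x - y)) * k \<omega>)"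
        by (intro Bochner_Integration.integral_cong) (simp_all add: cis_mult algebra_simps flip: mult.assoc)
      moreover have "complex_of_real (1 / sqrt (2 * pi)) * complex_of_real (1 / sqrt (2 * pi)) = complex_of_real (1 / (2 * pi))"
        by (simp flip: of_real_mult)
      ultimately show "complex_of_real (1 / sqrt (2 * pi)) * (f y * fourier_int ?e y) = K (- x) y * f y"
        unfolding K_def fourier_int_def by (simp only: mult_ac) (simp only: mult.assoc[symmetric])
    qed
    finally show ?thesis
      unfolding fourier_int_def int_op_def by (simp add: mult_ac)
  qed
  then have "AE x in lborel. q x = int_op K f (- x)"
    using FT_eq_fourier_int[OF q p_int] by simp
  moreover have Km [measurable]: "int_op K f \<in> borel_measurable borel"
    unfolding int_op_def K_def by measurable
  ultimately have "FT ?p (\<lambda>x. int_op K f (- x))"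
    by (intro FT_cong_AE[OF q AE_I2[OF refl]]) (use p_L2 in \<open>auto dest: L2_measurable\<close>)
  from FT_inversion[OF FT_inversion[OF FT_inversion[OF this]]] show ?thesis by simp
qed

section \<open>The Lorentz and Voigt multipliers\<close>

lemma Laplace_cis_half:
  assumes "\<kappa> > 0"
  shows "set_integrable lborel {0<..} (\<lambda>\<omega>. cis (\<omega> * t) * of_real (exp (- (\<omega> * \<kappa>))))"
    and "(LINT \<omega>:{0<..}|lborel. cis (\<omega> * t) * of_real (exp (- (\<omega> * \<kappa>)))) = 1 / (of_real \<kappa> - \<i> * of_real t)"
proof -
  define z where "z = \<i> * of_real t - complex_of_real \<kappa>"
  have z: "z \<noteq> 0" using assms by (auto simp: z_def complex_eq_iff)
  let ?f = "\<lambda>\<omega>. cis (\<omega> * t) * complex_of_real (exp (- (\<omega> * \<kappa>)))"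
  have f_eq: "?f \<omega> = exp (of_real \<omega> * z)" for \<omega>
    by (simp add: z_def cis_conv_exp exp_of_real[symmetric] algebra_simps flip: exp_add)
  show int: "set_integrable lborel {0<..} ?f"
    unfolding set_integrable_def
    by (rule Bochner_Integration.integrable_bound[OF integrable_I0i_exp_mscale[OF assms, unfolded set_integrable_def]])
       (auto simp: norm_mult)
  have einterval: "einterval 0 \<infinity> = {0<..}" by (auto simp: einterval_iff)
  have "(LBINT \<omega>=0..\<infinity>. ?f \<omega>) = 0 - 1 / z"
  proof (rule interval_integral_FTC_integrable)
    show "((\<lambda>\<omega>. exp (of_real \<omega> * z) / z) has_vector_derivative ?f \<omega>) (at \<omega>)" for \<omega>
      unfolding f_eq using z by (auto intro!: derivative_eq_intros has_vector_derivative_real_field)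
    show "isCont ?f \<omega>" for \<omega>
      unfolding f_eq by (intro continuous_intros)
    show "set_integrable lborel (einterval 0 \<infinity>) ?f"
      unfolding einterval by (rule int)
    have "((\<lambda>\<omega>. exp (of_real \<omega> * z) / z) \<longlongrightarrow> exp (of_real 0 * z) / z) (at_right 0)"
      by (intro tendsto_intros z)
    then show "(((\<lambda>\<omega>. exp (of_real \<omega> * z) / z) \<circ> real_of_ereal) \<longlongrightarrow> 1 / z) (at_right 0)"
      unfolding zero_ereal_def ereal_tendsto_simps by simp
    have "((\<lambda>\<omega>. exp (of_real \<omega> * z) / z) \<longlongrightarrow> 0) at_top"
    proof (rule Lim_null_comparison)
      show "\<forall>\<^sub>F \<omega> in at_top. norm (exp (of_real \<omega> * z) / z) \<le> exp (- (\<omega> * \<kappa>)) / norm z"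
        by (simp add: norm_divide z_def)
      have "((\<lambda>\<omega>. exp (- (\<omega> * \<kappa>)) / norm z) \<longlongrightarrow> 0 / norm z) at_top"
        using assms z
        by (intro tendsto_divide tendsto_const filterlim_compose[OF exp_at_bot]
            filterlim_uminus_at_bot_at_top[THEN filterlim_compose] filterlim_at_top_mult_tendsto_pos[OF tendsto_const _ filterlim_ident]) auto
      then show "((\<lambda>\<omega>. exp (- (\<omega> * \<kappa>)) / norm z) \<longlongrightarrow> 0) at_top" by simp
    qed
    then show "(((\<lambda>\<omega>. exp (of_real \<omega> * z) / z) \<circ> real_of_ereal) \<longlongrightarrow> 0) (at_left \<infinity>)"
      unfolding ereal_tendsto_simps .
  qed simp
  then show "(LINT \<omega>:{0<..}|lborel. ?f \<omega>) = 1 / (of_real \<kappa> - \<i> * of_real t)"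
    by (simp add: interval_lebesgue_integral_0_infty z_def minus_divide_right)
qed

lemma Fourier_integral_exp_abs:
  assumes "\<kappa> > 0"
  shows "has_bochner_integral lborel (\<lambda>\<omega>. cis (\<omega> * t) * complex_of_real (exp (- (\<kappa> * \<bar>\<omega>\<bar>)))) (of_real (2 * \<kappa> / (\<kappa>\<^sup>2 + t\<^sup>2)))"
proof -
  let ?f = "\<lambda>t \<omega>. indicator {0<..} \<omega> *\<^sub>R (cis (\<omega> * t) * complex_of_real (exp (- (\<omega> * \<kappa>))))"
  have f: "has_bochner_integral lborel (?f t) (1 / (of_real \<kappa> - \<i> * of_real t))" for t
    using Laplace_cis_half[OF assms, of t] unfolding set_integrable_def set_lebesgue_integral_def
    by (simp add: has_bochner_integral_iff)
  have "has_bochner_integral lborel (\<lambda>\<omega>. ?f (- t) (0 + (- 1) * \<omega>)) ((1 / (of_real \<kappa> - \<i> * of_real (- t))) /\<^sub>R \<bar>- 1\<bar>)"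
    by (rule lborel_has_bochner_integral_real_affine_iff[THEN iffD1, OF _ f]) simp
  from has_bochner_integral_add[OF f[of t] this]
  have "has_bochner_integral lborel (\<lambda>\<omega>. ?f t \<omega> + ?f (- t) (0 + (- 1) * \<omega>))
      (1 / (of_real \<kappa> - \<i> * of_real t) + 1 / (of_real \<kappa> + \<i> * of_real t))"
    by simp
  moreover have "1 / (of_real \<kappa> - \<i> * of_real t) + 1 / (of_real \<kappa> + \<i> * of_real t) = complex_of_real (2 * \<kappa> / (\<kappa>\<^sup>2 + t\<^sup>2))"
  proof -
    have nz: "complex_of_real \<kappa> - \<i> * of_real t \<noteq> 0" "complex_of_real \<kappa> + \<i> * of_real t \<noteq> 0"
      using assms by (auto simp: complex_eq_iff)
    have "(complex_of_real \<kappa> - \<i> * of_real t) * (complex_of_real \<kappa> + \<i> * of_real t) = of_real (\<kappa>\<^sup>2 + t\<^sup>2)"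
      by (simp add: algebra_simps power2_eq_square)
    with nz show ?thesis by (simp add: add_frac_eq)
  qed
  moreover have "AE \<omega> in lborel. ?f t \<omega> + ?f (- t) (0 + (- 1) * \<omega>) = cis (\<omega> * t) * complex_of_real (exp (- (\<kappa> * \<bar>\<omega>\<bar>)))"
    using AE_lborel_singleton[of 0] by eventually_elim (auto simp: indicator_def abs_if mult.commute)
  ultimately show ?thesis
    by (simp only:) (rule has_bochner_integralI_AE, assumption, measurable)
qed

text \<open>
  The kernel is written as the Fourier integral of its multiplier, the form in which
  \<open>FT_convolution\<close> applies.
\<close>

lemma lorentz_kernel_eq:
  assumes "\<kappa> > 0"
  shows "lorentz_kernel \<kappa> x y = complex_of_real (1 / (2 * pi)) *
    (LINT \<omega>|lborel. cis (\<omega> * (x - y)) * complex_of_real (exp (- (\<kappa> * \<bar>\<omega>\<bar>))))"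
proof -
  have "1 / (2 * pi) * (2 * \<kappa> / (\<kappa>\<^sup>2 + (x - y)\<^sup>2)) = 1 / (\<kappa> * pi) * (1 / (1 + (x - y)\<^sup>2 / \<kappa>\<^sup>2))"
  proof -
    have "1 + (x - y)\<^sup>2 / \<kappa>\<^sup>2 = (\<kappa>\<^sup>2 + (x - y)\<^sup>2) / \<kappa>\<^sup>2"
      using assms by (simp add: add_divide_distrib)
    then show ?thesis using assms by (simp add: power2_eq_square)
  qed
  then show ?thesis
    unfolding lorentz_kernel_def has_bochner_integral_integral_eq[OF Fourier_integral_exp_abs[OF assms]]
    by (simp only: of_real_mult[symmetric])
qed

theorem FT_lorentz_op:
  assumes "\<kappa> > 0" "FT f w"
  shows "FT (lorentz_op \<kappa> f) (\<lambda>\<omega>. of_real (exp (- (\<kappa> * \<bar>\<omega>\<bar>))) * w \<omega>)"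
proof -
  have "lorentz_kernel \<kappa> = (\<lambda>x y. complex_of_real (1 / (2 * pi)) *
      (LINT \<omega>|lborel. cis (\<omega> * (x - y)) * complex_of_real (exp (- (\<kappa> * \<bar>\<omega>\<bar>)))))"
    by (intro ext lorentz_kernel_eq assms)
  moreover have "integrable lborel (\<lambda>\<omega>. complex_of_real (exp (- (\<kappa> * \<bar>\<omega>\<bar>))))"
    using Fourier_integral_exp_abs[OF assms(1), of 0] by (auto simp: has_bochner_integral_iff)
  ultimately show ?thesis
    unfolding lorentz_op_def using assms
    by (simp only:) (rule FT_convolution[where c = 1], auto)
qed

lemma voigt_hat_eq: "voigt_hat \<theta> \<omega> = exp (- (\<theta> * \<omega>\<^sup>2 / 2 + sqrt 2 * (1 - \<theta>) * \<bar>\<omega>\<bar>))"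
  unfolding voigt_hat_def gauss_hat_def lorentz_hat_def powr_def
  by (simp add: algebra_simps flip: exp_add)

theorem FT_voigt:
  assumes \<theta>: "0 < \<theta>" "\<theta> \<le> 1" and fw: "FT f w"
  shows "FT (int_op (voigt_kernel \<theta>) f) (\<lambda>\<omega>. of_real (voigt_hat \<theta> \<omega>) * w \<omega>)"
proof -
  have kernel: "voigt_kernel \<theta> = (\<lambda>x y. complex_of_real (1 / (2 * pi)) *
      (LINT \<omega>|lborel. cis (\<omega> * (x - y)) * complex_of_real (voigt_hat \<theta> \<omega>)))"
    unfolding voigt_kernel_def by (simp add: cis_conv_exp)
  have m [measurable]: "voigt_hat \<theta> \<in> borel_measurable borel"
    unfolding voigt_hat_eq[abs_def] by measurable
  have "integrable lborel (\<lambda>\<omega>. complex_of_real (voigt_hat \<theta> \<omega>))"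
  proof (rule Bochner_Integration.integrable_bound)
    have "integrable lborel (\<lambda>\<omega>. complex_of_real (exp (- (1 * \<bar>\<omega>\<bar>))))"
      using Fourier_integral_exp_abs[of 1 0] by (auto simp: has_bochner_integral_iff)
    then show "integrable lborel (\<lambda>\<omega>. of_real (exp (1 / (2 * \<theta>))) * complex_of_real (exp (- (1 * \<bar>\<omega>\<bar>))))"
      by (rule integrable_mult_right)
    have "norm (complex_of_real (voigt_hat \<theta> \<omega>)) \<le> norm (complex_of_real (exp (1 / (2 * \<theta>))) * complex_of_real (exp (- (1 * \<bar>\<omega>\<bar>))))" for \<omega>
    proof -
      \<comment> \<open>Completing the square bounds the Gaussian factor by a multiple of
        \<open>exp (- |\<omega>|)\<close>, whose integrability is known.\<close>
      have "0 \<le> (\<theta> * \<bar>\<omega>\<bar> - 1)\<^sup>2 / (2 * \<theta>)" using \<theta> by simp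
      also have "(\<theta> * \<bar>\<omega>\<bar> - 1)\<^sup>2 = \<theta> * (\<theta> * \<omega>\<^sup>2) - 2 * \<theta> * \<bar>\<omega>\<bar> + 1"
        by (simp add: power2_diff power_mult_distrib) (simp add: power2_eq_square)
      also have "(\<theta> * (\<theta> * \<omega>\<^sup>2) - 2 * \<theta> * \<bar>\<omega>\<bar> + 1) / (2 * \<theta>) = \<theta> * \<omega>\<^sup>2 / 2 - \<bar>\<omega>\<bar> + 1 / (2 * \<theta>)"
        using \<theta> by (simp add: add_divide_distrib diff_divide_distrib)
      finally have "- (\<theta> * \<omega>\<^sup>2 / 2) \<le> 1 / (2 * \<theta>) - \<bar>\<omega>\<bar>" by simp
      moreover have "0 \<le> sqrt 2 * (1 - \<theta>) * \<bar>\<omega>\<bar>" using \<theta> by simp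
      ultimately have "- (\<theta> * \<omega>\<^sup>2 / 2 + sqrt 2 * (1 - \<theta>) * \<bar>\<omega>\<bar>) \<le> 1 / (2 * \<theta>) - 1 * \<bar>\<omega>\<bar>"
        by linarith
      then have "voigt_hat \<theta> \<omega> \<le> exp (1 / (2 * \<theta>)) * exp (- (1 * \<bar>\<omega>\<bar>))"
        unfolding voigt_hat_eq exp_add[symmetric] by simp
      then show ?thesis by (simp add: norm_mult voigt_hat_eq)
    qed
    then show "AE \<omega> in lborel. norm (complex_of_real (voigt_hat \<theta> \<omega>)) \<le>
        norm (complex_of_real (exp (1 / (2 * \<theta>))) * complex_of_real (exp (- (1 * \<bar>\<omega>\<bar>))))"
      by simp
  qed simp
  moreover have "norm (complex_of_real (voigt_hat \<theta> \<omega>)) \<le> 1" for \<omega>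
  proof -
    have "0 \<le> \<theta> * \<omega>\<^sup>2 / 2" "0 \<le> sqrt 2 * (1 - \<theta>) * \<bar>\<omega>\<bar>" using \<theta> by simp_all
    then show ?thesis unfolding voigt_hat_eq by simp
  qed
  ultimately show ?thesis
    unfolding kernel by (intro FT_convolution[where c = 1] fw) auto
qed

section \<open>Diagonalization of the Lorentz operator\<close>

lemma FT_AE_eq_iff:
  assumes "FT f w" "FT f' w'"
  shows "(AE x in lborel. w x = w' x) \<longleftrightarrow> (AE x in lborel. f x = f' x)"
proof
  assume "AE x in lborel. w x = w' x"
  note eq = this
  have FT: "FT (\<lambda>x. f x - f' x) (\<lambda>x. w x - w' x)" by (rule FT_diff[OF assms])
  have "(LINT x|lborel. (norm (f x - f' x))\<^sup>2) = (LINT x|lborel. (norm (w x - w' x))\<^sup>2)"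
    by (rule FT_norm[OF FT, symmetric])
  also have "\<dots> = 0"
    by (rule integral_eq_zero_AE) (use eq in auto)
  finally have "AE x in lborel. f x - f' x = 0" by (rule L2_zero_AE[OF FT_L2_left[OF FT]])
  then show "AE x in lborel. f x = f' x" by auto
qed (rule FT_unique[OF assms])

text \<open>
  A transform as a function, as required for a unitary operator; it is determined up to a
  null set.
\<close>

definition fourier :: "(real \<Rightarrow> complex) \<Rightarrow> real \<Rightarrow> complex" where
  "fourier f = (SOME w. FT f w)"

lemma FT_fourier:
  assumes "f \<in> L2 lborel"
  shows "FT f (fourier f)"
proof -
  obtain w where "FT f w" using FT_total[OF assms] .
  then show ?thesis unfolding fourier_def by (rule someI[of "FT f"])
qed

lemma fourier_L2: "f \<in> L2 lborel \<Longrightarrow> fourier f \<in> L2 lborel"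
  using FT_L2_right[OF FT_fourier] .

lemma fourier_measurable: "f \<in> L2 lborel \<Longrightarrow> fourier f \<in> borel_measurable borel"
  using L2_measurable[OF fourier_L2] by simp

lemma fourier_inner:
  "f \<in> L2 lborel \<Longrightarrow> g \<in> L2 lborel \<Longrightarrow> L2_inner lborel (fourier f) (fourier g) = L2_inner lborel f g"
  unfolding L2_inner_def by (intro FT_isometry FT_fourier)

lemma fourier_surj:
  assumes "w \<in> L2 lborel"
  obtains f where "f \<in> L2 lborel" "FT f w" "AE x in lborel. fourier f x = w x"
proof -
  obtain q where "FT w q" using FT_total[OF assms] .
  from FT_inversion[OF FT_inversion[OF FT_inversion[OF this]]]
  have "FT (\<lambda>x. q (- x)) w" by simp
  with FT_L2_left[OF this] show ?thesis
    by (intro that[of "\<lambda>x. q (- x)"] FT_unique[OF FT_fourier]) auto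
qed

lemma op_graph_lorentz_iff:
  assumes "\<kappa> > 0" "f \<in> L2 lborel" "h \<in> L2 lborel"
  shows "(f, h) \<in> op_graph (lorentz_op \<kappa>) \<longleftrightarrow>
    (AE \<omega> in lborel. fourier h \<omega> = of_real (exp (- (\<kappa> * \<bar>\<omega>\<bar>))) * fourier f \<omega>)"
  using FT_AE_eq_iff[OF FT_fourier[OF assms(3)] FT_lorentz_op[OF assms(1) FT_fourier[OF assms(2)]]] assms(2,3)
  unfolding op_graph_def by simp

lemma exp_neg_abs_mult_L2:
  assumes "\<kappa> > 0" "w \<in> L2 lborel"
  shows "(\<lambda>\<omega>. of_real (exp (- (\<kappa> * \<bar>\<omega>\<bar>))) * w \<omega>) \<in> L2 lborel"
  by (rule L2_mult_bounded[where c = 1, OF assms(2)]) (use assms(1) in auto)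

text \<open>
  The Lorentz operator is self-adjoint, since its multiplier is real. For the inclusion of the
  adjoint in the operator itself one tests with all \<open>u\<close> at once: their transforms exhaust
  \<open>L\<^sub>2(\<real>)\<close>.
\<close>

lemma op_adjoint_lorentz_iff:
  assumes \<kappa>: "\<kappa> > 0" and f: "f \<in> L2 lborel" and h: "h \<in> L2 lborel"
  shows "(f, h) \<in> op_adjoint (op_graph (lorentz_op \<kappa>)) \<longleftrightarrow>
    (AE \<omega> in lborel. fourier h \<omega> = of_real (exp (- (\<kappa> * \<bar>\<omega>\<bar>))) * fourier f \<omega>)"
proof -
  let ?e = "\<lambda>\<omega>. complex_of_real (exp (- (\<kappa> * \<bar>\<omega>\<bar>)))"
  note [measurable] = fourier_measurable[OF f] fourier_measurable[OF h]
  note L2 = fourier_L2[OF f] fourier_L2[OF h] exp_neg_abs_mult_L2[OF \<kappa> fourier_L2[OF f]]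
  have graph: "L2_inner lborel v f = (LINT \<omega>|lborel. fourier u \<omega> * cnj (?e \<omega> * fourier f \<omega>))"
    if uv: "(u, v) \<in> op_graph (lorentz_op \<kappa>)" for u v
  proof -
    have u: "u \<in> L2 lborel" and v: "v \<in> L2 lborel"
      using uv by (auto simp: op_graph_def)
    note [measurable] = fourier_measurable[OF u] fourier_measurable[OF v]
    have "L2_inner lborel v f = (LINT \<omega>|lborel. fourier v \<omega> * cnj (fourier f \<omega>))"
      using fourier_inner[OF v f] by (simp add: L2_inner_def)
    also have "\<dots> = (LINT \<omega>|lborel. fourier u \<omega> * cnj (?e \<omega> * fourier f \<omega>))"
    proof (rule integral_cong_AE)
      show "AE \<omega> in lborel. fourier v \<omega> * cnj (fourier f \<omega>) = fourier u \<omega> * cnj (?e \<omega> * fourier f \<omega>)"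
        using uv unfolding op_graph_lorentz_iff[OF \<kappa> u v] by eventually_elim simp
    qed simp_all
    finally show ?thesis .
  qed
  show ?thesis
  proof
    assume adj: "(f, h) \<in> op_adjoint (op_graph (lorentz_op \<kappa>))"
    have "AE \<omega> in lborel. cnj (fourier h \<omega> - ?e \<omega> * fourier f \<omega>) = 0"
    proof (rule L2_zero_AE_if_orthogonal[OF L2_cnj[OF L2_diff[OF L2(2,3)]]])
      fix w :: "real \<Rightarrow> complex" assume w: "w \<in> L2 lborel"
      obtain u where u: "u \<in> L2 lborel" "AE \<omega> in lborel. fourier u \<omega> = w \<omega>"
        using fourier_surj[OF w] by blast
      have [measurable]: "fourier u \<in> borel_measurable borel" "w \<in> borel_measurable borel"
        using fourier_measurable[OF u(1)] L2_measurable[OF w] by simp_all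
      have uB: "(u, lorentz_op \<kappa> u) \<in> op_graph (lorentz_op \<kappa>)"
        using u(1) FT_L2_left[OF FT_lorentz_op[OF \<kappa> FT_fourier[OF u(1)]]] by (simp add: op_graph_def)
      have "(LINT \<omega>|lborel. fourier u \<omega> * cnj (fourier h \<omega>)) = L2_inner lborel u h"
        using fourier_inner[OF u(1) h] by (simp add: L2_inner_def)
      also have "\<dots> = L2_inner lborel (lorentz_op \<kappa> u) f"
        using adj uB unfolding op_adjoint_def by auto
      also have "\<dots> = (LINT \<omega>|lborel. fourier u \<omega> * cnj (?e \<omega> * fourier f \<omega>))"
        by (rule graph[OF uB])
      finally have "(LINT \<omega>|lborel. fourier u \<omega> * cnj (fourier h \<omega> - ?e \<omega> * fourier f \<omega>)) = 0"
        using L2_mult_integrable[OF fourier_L2[OF u(1)] L2_cnj[OF L2(2)]]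
          L2_mult_integrable[OF fourier_L2[OF u(1)] L2_cnj[OF L2(3)]]
        by (simp add: right_diff_distrib)
      also have "(LINT \<omega>|lborel. fourier u \<omega> * cnj (fourier h \<omega> - ?e \<omega> * fourier f \<omega>))
          = (LINT \<omega>|lborel. w \<omega> * cnj (fourier h \<omega> - ?e \<omega> * fourier f \<omega>))"
      proof (rule integral_cong_AE)
        show "AE \<omega> in lborel. fourier u \<omega> * cnj (fourier h \<omega> - ?e \<omega> * fourier f \<omega>)
            = w \<omega> * cnj (fourier h \<omega> - ?e \<omega> * fourier f \<omega>)"
          using u(2) by eventually_elim simp
      qed simp_all
      finally show "(LINT \<omega>|lborel. w \<omega> * cnj (fourier h \<omega> - ?e \<omega> * fourier f \<omega>)) = 0" .
    qed
    then show "AE \<omega> in lborel. fourier h \<omega> = ?e \<omega> * fourier f \<omega>"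
      by eventually_elim (simp only: complex_cnj_zero_iff right_minus_eq)
  next
    assume eq: "AE \<omega> in lborel. fourier h \<omega> = ?e \<omega> * fourier f \<omega>"
    have "L2_inner lborel v f = L2_inner lborel u h" if uv: "(u, v) \<in> op_graph (lorentz_op \<kappa>)" for u v
    proof -
      have u: "u \<in> L2 lborel" using uv by (auto simp: op_graph_def)
      note [measurable] = fourier_measurable[OF u]
      have "L2_inner lborel v f = (LINT \<omega>|lborel. fourier u \<omega> * cnj (?e \<omega> * fourier f \<omega>))"
        by (rule graph[OF uv])
      also have "\<dots> = (LINT \<omega>|lborel. fourier u \<omega> * cnj (fourier h \<omega>))"
      proof (rule integral_cong_AE)
        show "AE \<omega> in lborel. fourier u \<omega> * cnj (?e \<omega> * fourier f \<omega>) = fourier u \<omega> * cnj (fourier h \<omega>)"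
          using eq by eventually_elim simp
      qed simp_all
      also have "\<dots> = L2_inner lborel u h"
        using fourier_inner[OF u h] by (simp add: L2_inner_def)
      finally show ?thesis .
    qed
    then show "(f, h) \<in> op_adjoint (op_graph (lorentz_op \<kappa>))"
      using f h unfolding op_adjoint_def by auto
  qed
qed

theorem fourier_diagonalizes_BB_adj_inv:
  assumes \<kappa>: "\<kappa> > 0"
  shows "diagonalizes lborel fourier (\<lambda>\<omega>. exp (2 * \<kappa> * \<bar>\<omega>\<bar>)) (BB_adj_inv \<kappa>)"
proof -
  let ?e = "\<lambda>\<omega>. complex_of_real (exp (- (\<kappa> * \<bar>\<omega>\<bar>)))"
  let ?m = "\<lambda>\<omega>. complex_of_real (exp (2 * \<kappa> * \<bar>\<omega>\<bar>))"
  let ?A = "{(f, h). f \<in> L2 lborel \<and> h \<in> L2 lborel \<and> (AE \<omega> in lborel. fourier h \<omega> = ?m \<omega> * fourier f \<omega>)}"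
  have em: "?m \<omega> * (?e \<omega> * (?e \<omega> * z)) = z" for \<omega> z
  proof -
    have "exp (2 * \<kappa> * \<bar>\<omega>\<bar>) * (exp (- (\<kappa> * \<bar>\<omega>\<bar>)) * exp (- (\<kappa> * \<bar>\<omega>\<bar>))) = 1"
      by (simp flip: exp_add)
    then have "?m \<omega> * (?e \<omega> * ?e \<omega>) = 1" by (metis of_real_mult of_real_1)
    then show ?thesis by (simp add: mult.assoc[symmetric])
  qed
  have "(f, h) \<in> BB_adj_inv \<kappa> \<longleftrightarrow> (f, h) \<in> ?A" for f h
  proof
    assume "(f, h) \<in> BB_adj_inv \<kappa>"
    then obtain y where hy: "(h, y) \<in> op_adjoint (op_graph (lorentz_op \<kappa>))" and yf: "(y, f) \<in> op_graph (lorentz_op \<kappa>)"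
      unfolding BB_adj_inv_def by auto
    have L2: "h \<in> L2 lborel" "y \<in> L2 lborel" "f \<in> L2 lborel"
      using hy yf by (auto simp: op_adjoint_def op_graph_def)
    have "AE \<omega> in lborel. fourier h \<omega> = ?m \<omega> * fourier f \<omega>"
      using hy[unfolded op_adjoint_lorentz_iff[OF \<kappa> L2(1,2)]] yf[unfolded op_graph_lorentz_iff[OF \<kappa> L2(2,3)]]
      by eventually_elim (simp only: em)
    then show "(f, h) \<in> ?A" using L2 by simp
  next
    assume "(f, h) \<in> ?A"
    then have L2: "f \<in> L2 lborel" "h \<in> L2 lborel" and eq: "AE \<omega> in lborel. fourier h \<omega> = ?m \<omega> * fourier f \<omega>"
      by auto
    obtain y where y: "y \<in> L2 lborel" "AE \<omega> in lborel. fourier y \<omega> = ?e \<omega> * fourier h \<omega>"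
      using fourier_surj[OF exp_neg_abs_mult_L2[OF \<kappa> fourier_L2[OF L2(2)]]] by blast
    have "AE \<omega> in lborel. fourier f \<omega> = ?e \<omega> * fourier y \<omega>"
      using y(2) eq
    proof eventually_elim
      fix \<omega> assume "fourier y \<omega> = ?e \<omega> * fourier h \<omega>" "fourier h \<omega> = ?m \<omega> * fourier f \<omega>"
      then show "fourier f \<omega> = ?e \<omega> * fourier y \<omega>" using em[of \<omega> "fourier f \<omega>"] by (simp only: mult_ac)
    qed
    then have "(h, y) \<in> op_adjoint (op_graph (lorentz_op \<kappa>))" "(y, f) \<in> op_graph (lorentz_op \<kappa>)"
      using y(2) by (simp_all only: op_adjoint_lorentz_iff[OF \<kappa> L2(2) y(1)] op_graph_lorentz_iff[OF \<kappa> y(1) L2(1)])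
    then show "(f, h) \<in> BB_adj_inv \<kappa>"
      unfolding BB_adj_inv_def by auto
  qed
  then have "BB_adj_inv \<kappa> = ?A" by (auto simp: set_eq_iff)
  moreover have "\<forall>v\<in>L2 lborel. \<exists>f\<in>L2 lborel. AE x in lborel. fourier f x = v x"
    using fourier_surj by blast
  ultimately show ?thesis
    unfolding diagonalizes_def
    using fourier_L2 fourier_inner lborel.sigma_finite_measure_axioms by auto
qed

section \<open>Uniqueness of the functional calculus\<close>

text \<open>
  A finite measure on \<open>[0, 1]\<close> is determined by its moments, by the Weierstrass
  approximation theorem. The measures appear here as images under \<open>r\<close> and \<open>r'\<close>
  of measures with densities \<open>q\<close> and \<open>q'\<close>.
\<close>

lemma Hausdorff_moments:
  fixes r q :: "'a \<Rightarrow> real" and r' q' :: "'b \<Rightarrow> real"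
  assumes r [measurable]: "r \<in> borel_measurable M" and r01: "AE x in M. 0 \<le> r x \<and> r x \<le> 1"
    and q: "integrable M q" "\<And>x. 0 \<le> q x"
    and r' [measurable]: "r' \<in> borel_measurable M'" and r01': "AE x in M'. 0 \<le> r' x \<and> r' x \<le> 1"
    and q': "integrable M' q'" "\<And>x. 0 \<le> q' x"
    and moments: "\<And>n::nat. (LINT x|M. (r x) ^ n * q x) = (LINT x|M'. (r' x) ^ n * q' x)"
    and \<phi>: "continuous_on UNIV \<phi>"
  shows "(LINT x|M. \<phi> (r x) * q x) = (LINT x|M'. \<phi> (r' x) * q' x)"
proof -
  have \<phi>m [measurable]: "\<phi> \<in> borel_measurable borel"
    using \<phi> by (rule borel_measurable_continuous_onI)
  have approx: "\<bar>(LINT x|M. \<phi> (r x) * q x) - (LINT x|M. P (r x) * q x)\<bar> \<le> e * (LINT x|M. q x)"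
    if r [measurable]: "r \<in> borel_measurable M" and r01: "AE x in M. 0 \<le> r x \<and> r x \<le> 1"
    and q: "integrable M q" "\<And>x. 0 \<le> q x"
    and P: "continuous_on UNIV P" "\<And>t. t \<in> {0..1} \<Longrightarrow> \<bar>\<phi> t - P t\<bar> \<le> e"
    for M :: "'c measure" and r q :: "'c \<Rightarrow> real" and P e
  proof -
    have int: "integrable M (\<lambda>x. f (r x) * q x)" if f: "continuous_on UNIV f" for f :: "real \<Rightarrow> real"
    proof -
      have [measurable]: "f \<in> borel_measurable borel"
        using f by (rule borel_measurable_continuous_onI)
      have "compact (f ` {0..1})"
        by (rule compact_continuous_image[OF continuous_on_subset[OF f]]) auto
      then obtain C where C: "\<And>t. t \<in> {0..1} \<Longrightarrow> \<bar>f t\<bar> \<le> C"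
        using compact_imp_bounded bounded_iff by (metis image_eqI real_norm_def)
      have [measurable]: "q \<in> borel_measurable M" using q by auto
      show ?thesis
      proof (rule Bochner_Integration.integrable_bound)
        show "integrable M (\<lambda>x. C * q x)" using q by simp
        show "AE x in M. norm (f (r x) * q x) \<le> norm (C * q x)"
          using r01
        proof eventually_elim
          fix x assume "0 \<le> r x \<and> r x \<le> 1"
          then have "\<bar>f (r x)\<bar> \<le> \<bar>C\<bar>" using C[of "r x"] by auto
          then show "norm (f (r x) * q x) \<le> norm (C * q x)"
            by (simp add: abs_mult mult_right_mono)
        qed
      qed measurable
    qed
    have "(LINT x|M. \<phi> (r x) * q x) - (LINT x|M. P (r x) * q x) = (LINT x|M. \<phi> (r x) * q x - P (r x) * q x)"
      using int[OF \<phi>] int[OF P(1)] by simp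
    also have "\<bar>\<dots>\<bar> \<le> (LINT x|M. \<bar>\<phi> (r x) * q x - P (r x) * q x\<bar>)"
      using integral_norm_bound[of M "\<lambda>x. \<phi> (r x) * q x - P (r x) * q x"] by simp
    also have "\<dots> \<le> (LINT x|M. e * q x)"
    proof (rule integral_mono_AE)
      show "integrable M (\<lambda>x. \<bar>\<phi> (r x) * q x - P (r x) * q x\<bar>)"
        using int[OF \<phi>] int[OF P(1)] by simp
      show "integrable M (\<lambda>x. e * q x)" using q by simp
      show "AE x in M. \<bar>\<phi> (r x) * q x - P (r x) * q x\<bar> \<le> e * q x"
        using r01
      proof eventually_elim
        fix x assume "0 \<le> r x \<and> r x \<le> 1"
        then have "\<bar>\<phi> (r x) - P (r x)\<bar> * q x \<le> e * q x"
          using P(2)[of "r x"] q(2)[of x] by (intro mult_right_mono) auto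
        then show "\<bar>\<phi> (r x) * q x - P (r x) * q x\<bar> \<le> e * q x"
          using q(2)[of x] by (simp add: left_diff_distrib[symmetric] abs_mult)
      qed
    qed
    finally show ?thesis by simp
  qed
  have power_int: "integrable M (\<lambda>x. (r x) ^ n * q x)"
    if r [measurable]: "r \<in> borel_measurable M" and r01: "AE x in M. 0 \<le> r x \<and> r x \<le> 1"
    and q: "integrable M q" for M :: "'c measure" and r q :: "'c \<Rightarrow> real" and n :: nat
  proof (rule Bochner_Integration.integrable_bound[OF q])
    have [measurable]: "q \<in> borel_measurable M" using q by auto
    show "(\<lambda>x. (r x) ^ n * q x) \<in> borel_measurable M" by measurable
    show "AE x in M. norm ((r x) ^ n * q x) \<le> norm (q x)"
      using r01 by eventually_elim (auto simp: abs_mult intro!: mult_left_le_one_le power_le_one)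
  qed
  let ?R = "(LINT x|M. q x) + (LINT x|M'. q' x)"
  have R: "0 \<le> ?R" using q q' by (intro add_nonneg_nonneg integral_nonneg_AE) auto
  have "\<bar>(LINT x|M. \<phi> (r x) * q x) - (LINT x|M'. \<phi> (r' x) * q' x)\<bar> \<le> e" if e: "e > 0" for e
  proof -
    define d where "d = e / (?R + 1)"
    have d: "d > 0" using e R by (simp add: d_def)
    obtain P where P: "real_polynomial_function P" "\<And>t. t \<in> {0..1} \<Longrightarrow> \<bar>\<phi> t - P t\<bar> < d"
      using Stone_Weierstrass_real_polynomial_function[of "{0..1::real}" \<phi> d] \<phi> d
      by (metis compact_Icc continuous_on_subset top_greatest)
    obtain a n where Peq: "P = (\<lambda>t. \<Sum>i\<le>n. a i * t ^ i)"
      using P(1) unfolding real_polynomial_function_iff_sum by blast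
    have Pcont: "continuous_on UNIV P" unfolding Peq by (intro continuous_intros)
    have "(LINT x|M. P (r x) * q x) = (\<Sum>i\<le>n. a i * (LINT x|M. (r x) ^ i * q x))"
      unfolding Peq using power_int[OF r r01 q(1)] by (simp add: sum_distrib_right mult.assoc)
    also have "\<dots> = (LINT x|M'. P (r' x) * q' x)"
      unfolding Peq moments using power_int[OF r' r01' q'(1)] by (simp add: sum_distrib_right mult.assoc)
    finally have eq: "(LINT x|M. P (r x) * q x) = (LINT x|M'. P (r' x) * q' x)" .
    have "\<bar>(LINT x|M. \<phi> (r x) * q x) - (LINT x|M. P (r x) * q x)\<bar> \<le> d * (LINT x|M. q x)"
      by (rule approx[OF r r01 q Pcont]) (use P(2) in \<open>auto intro: less_imp_le\<close>)
    moreover have "\<bar>(LINT x|M'. \<phi> (r' x) * q' x) - (LINT x|M'. P (r' x) * q' x)\<bar> \<le> d * (LINT x|M'. q' x)"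
      by (rule approx[OF r' r01' q' Pcont]) (use P(2) in \<open>auto intro: less_imp_le\<close>)
    ultimately have "\<bar>(LINT x|M. \<phi> (r x) * q x) - (LINT x|M'. \<phi> (r' x) * q' x)\<bar> \<le> d * ?R"
      using eq by (simp add: distrib_left)
    also have "\<dots> \<le> d * (?R + 1)" using d by (intro mult_left_mono) auto
    also have "\<dots> = e" using R by (simp add: d_def)
    finally show ?thesis .
  qed
  from field_le_epsilon[of "\<bar>(LINT x|M. \<phi> (r x) * q x) - (LINT x|M'. \<phi> (r' x) * q' x)\<bar>" 0] this
  show ?thesis by simp
qed

lemma L2_inner_self: "L2_inner M f f = of_real (LINT x|M. (norm (f x))\<^sup>2)"
  unfolding L2_inner_def norm_sq_integral_eq_pairing ..

lemma diagonalizesD: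
  assumes "diagonalizes N U m A"
  shows "sigma_finite_measure N" "m \<in> borel_measurable N"
    "\<And>f. f \<in> L2 lborel \<Longrightarrow> U f \<in> L2 N"
    "\<And>f g. f \<in> L2 lborel \<Longrightarrow> g \<in> L2 lborel \<Longrightarrow> L2_inner N (U f) (U g) = L2_inner lborel f g"
    "\<And>v. v \<in> L2 N \<Longrightarrow> \<exists>f \<in> L2 lborel. AE x in N. U f x = v x"
    "\<And>f h. (f, h) \<in> A \<longleftrightarrow> f \<in> L2 lborel \<and> h \<in> L2 lborel \<and> (AE x in N. U h x = of_real (m x) * U f x)"
  using assms unfolding diagonalizes_def by auto

text \<open>
  An operator whose spectrum is bounded away from \<open>0\<close> has an inverse defined everywhere.
\<close>

lemma diagonalizes_inverse_total:
  assumes D: "diagonalizes N U m A" and m1: "AE x in N. 1 \<le> m x" and h: "h \<in> L2 lborel"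
  obtains f where "(f, h) \<in> A"
proof -
  note D = diagonalizesD[OF D]
  have [measurable]: "m \<in> borel_measurable N" "U h \<in> borel_measurable N"
    using D(2) L2_measurable[OF D(3)[OF h]] by auto
  have "(\<lambda>x. U h x / of_real (m x)) \<in> L2 N"
  proof (rule L2_bound[OF _ L2_norm_sq_integrable[OF D(3)[OF h]]])
    show "AE x in N. (norm (U h x / of_real (m x)))\<^sup>2 \<le> (norm (U h x))\<^sup>2"
      using m1
    proof eventually_elim
      fix x assume "1 \<le> m x"
      then have "norm (U h x) / \<bar>m x\<bar> \<le> norm (U h x) / 1"
        by (intro divide_left_mono) auto
      then show "(norm (U h x / of_real (m x)))\<^sup>2 \<le> (norm (U h x))\<^sup>2"
        by (intro power_mono) (auto simp: norm_divide)
    qed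
  qed measurable
  then obtain f where f: "f \<in> L2 lborel" "AE x in N. U f x = U h x / of_real (m x)"
    using D(5) by blast
  have "AE x in N. U h x = of_real (m x) * U f x"
    using m1 f(2) by eventually_elim auto
  then show ?thesis using f(1) h D(6) that by blast
qed

text \<open>
  A spectral lower bound does not depend on the diagonalization: it says that the quadratic form
  of \<open>A\<^sup>-\<^sup>1\<close> lies between \<open>0\<close> and the squared norm, which only involves inner
  products. Testing with functions supported on a measurable set turns this into
  \<open>0 \<le> 1 / m \<le> 1\<close> almost everywhere.
\<close>

lemma diagonalizes_spectrum_bound:
  assumes D: "diagonalizes N U m A" and D': "diagonalizes N' U' m' A" and m1': "AE x in N'. 1 \<le> m' x"
  shows "AE x in N. 1 \<le> m x"
proof -
  note E = diagonalizesD[OF D] and E' = diagonalizesD[OF D']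
  interpret sigma_finite_measure N by (rule E(1))
  note [measurable] = E(2)
  obtain p :: "real \<Rightarrow> real" where p [measurable]: "p \<in> borel_measurable N" and p0: "\<And>x. p x > 0"
    and p_int: "integrable N p"
    using obtain_positive_integrable_function by metis
  \<comment> \<open>Indicator functions of sets of infinite measure are not square integrable, hence the
    weight, the square root of a positive integrable function. Applied to the whole space, the
    statement yields the integrability and \<open>m \<noteq> 0\<close>; for the other sets the
    integrability is then known.\<close>
  have key: "integrable N (\<lambda>x. 1 / m x * p x) \<and> (AE x in N. m x \<noteq> 0 \<or> x \<notin> S) \<and>
      0 \<le> (LINT x:S|N. 1 / m x * p x) \<and> (LINT x:S|N. 1 / m x * p x) \<le> (LINT x:S|N. p x)"
    if S [measurable]: "S \<in> sets N" and int: "S = space N \<or> integrable N (\<lambda>x. 1 / m x * p x)" for S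
  proof -
    let ?v = "\<lambda>x. complex_of_real (indicator S x * sqrt (p x))"
    have v_sq: "(norm (?v x))\<^sup>2 = indicator S x * p x" for x
      using p0[of x] by (auto simp: indicator_def)
    have "?v \<in> L2 N"
      by (rule L2_bound[OF _ p_int]) (auto simp: indicator_def less_imp_le[OF p0])
    then obtain h where h: "h \<in> L2 lborel" "AE x in N. U h x = ?v x"
      using E(5) by blast
    obtain f where fh: "(f, h) \<in> A"
      using diagonalizes_inverse_total[OF D' m1' h(1)] .
    have f: "f \<in> L2 lborel" and Uh: "AE x in N. U h x = of_real (m x) * U f x"
      and Uh': "AE x in N'. U' h x = of_real (m' x) * U' f x"
      using fh E(6) E'(6) by auto
    note [measurable] = L2_measurable[OF E(3)[OF f]] L2_measurable[OF E(3)[OF h(1)]]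
      L2_measurable[OF E'(3)[OF f]] L2_measurable[OF E'(3)[OF h(1)]] E'(2)
    have m0: "AE x in N. m x \<noteq> 0 \<or> x \<notin> S"
      using Uh h(2)
    proof eventually_elim
      fix x assume "U h x = of_real (m x) * U f x" "U h x = ?v x"
      then show "m x \<noteq> 0 \<or> x \<notin> S" using p0[of x] by auto
    qed
    have prod: "AE x in N. U f x * cnj (U h x) = of_real (indicator S x * (1 / m x * p x))"
      using Uh h(2) m0
    proof eventually_elim
      fix x assume *: "U h x = of_real (m x) * U f x" "U h x = ?v x" "m x \<noteq> 0 \<or> x \<notin> S"
      show "U f x * cnj (U h x) = of_real (indicator S x * (1 / m x * p x))"
      proof (cases "x \<in> S")
        case True
        then have "U f x = of_real (sqrt (p x) / m x)"
          using * by (simp add: field_simps)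
        moreover have "sqrt (p x) / m x * sqrt (p x) = 1 / m x * p x"
          using p0[of x] by simp
        ultimately show ?thesis using True *(2) by (simp flip: of_real_mult)
      next
        case False
        then show ?thesis using *(2) by simp
      qed
    qed
    have "integrable N (\<lambda>x. U f x * cnj (U h x))"
      by (rule L2_mult_integrable[OF E(3)[OF f] L2_cnj[OF E(3)[OF h(1)]]])
    then have "integrable N (\<lambda>x. complex_of_real (indicator S x * (1 / m x * p x)))"
      by (rule integrable_cong_AE_imp) (use prod in \<open>auto simp: eq_commute\<close>)
    from integrable_Re[OF this] have intS: "integrable N (\<lambda>x. indicator S x * (1 / m x * p x))"
      by (simp only: Re_complex_of_real)
    have int: "integrable N (\<lambda>x. 1 / m x * p x)"
      using int
    proof
      assume "S = space N"
      with intS show ?thesis by (subst Bochner_Integration.integrable_cong[OF refl]) auto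
    qed
    have "complex_of_real (LINT x:S|N. 1 / m x * p x) = L2_inner N (U f) (U h)"
      unfolding L2_inner_def set_lebesgue_integral_def integral_complex_of_real[symmetric]
      by (rule integral_cong_AE) (use prod in auto)
    also have "\<dots> = L2_inner N' (U' f) (U' h)"
      using E(4)[OF f h(1)] E'(4)[OF f h(1)] by simp
    also have "\<dots> = of_real (LINT x|N'. m' x * (norm (U' f x))\<^sup>2)"
      unfolding L2_inner_def integral_complex_of_real[symmetric]
    proof (rule integral_cong_AE)
      show "AE x in N'. U' f x * cnj (U' h x) = of_real (m' x * (norm (U' f x))\<^sup>2)"
        using Uh' by eventually_elim (simp add: mult_ac complex_norm_square[symmetric])
    qed simp_all
    finally have eq: "(LINT x:S|N. 1 / m x * p x) = (LINT x|N'. m' x * (norm (U' f x))\<^sup>2)"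
      by (simp only: of_real_eq_iff)
    have nonneg: "0 \<le> (LINT x|N'. m' x * (norm (U' f x))\<^sup>2)"
      by (rule integral_nonneg_AE) (use m1' in \<open>auto elim!: eventually_mono\<close>)
    have le: "(LINT x|N'. m' x * (norm (U' f x))\<^sup>2) \<le> (LINT x|N'. (norm (U' h x))\<^sup>2)"
    proof (rule integral_mono_AE)
      show "AE x in N'. m' x * (norm (U' f x))\<^sup>2 \<le> (norm (U' h x))\<^sup>2"
        using m1' Uh'
      proof eventually_elim
        fix x assume *: "1 \<le> m' x" "U' h x = of_real (m' x) * U' f x"
        have "m' x * 1 \<le> m' x * m' x" using *(1) by (intro mult_left_mono) auto
        then show "m' x * (norm (U' f x))\<^sup>2 \<le> (norm (U' h x))\<^sup>2"
          using *(1) unfolding *(2) norm_mult power_mult_distrib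
          by (intro mult_right_mono) (auto simp: power2_eq_square)
      qed
      show "integrable N' (\<lambda>x. (norm (U' h x))\<^sup>2)"
        by (rule L2_norm_sq_integrable[OF E'(3)[OF h(1)]])
      then show "integrable N' (\<lambda>x. m' x * (norm (U' f x))\<^sup>2)"
        by (rule Bochner_Integration.integrable_bound)
           (use \<open>AE x in N'. m' x * (norm (U' f x))\<^sup>2 \<le> (norm (U' h x))\<^sup>2\<close> m1' in \<open>auto simp: abs_mult elim!: eventually_elim2\<close>)
    qed
    have "complex_of_real (LINT x|N'. (norm (U' h x))\<^sup>2) = of_real (LINT x|N. (norm (U h x))\<^sup>2)"
      using E(4)[OF h(1) h(1)] E'(4)[OF h(1) h(1)] by (simp only: L2_inner_self)
    then have "(LINT x|N'. (norm (U' h x))\<^sup>2) = (LINT x|N. (norm (U h x))\<^sup>2)"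
      by (simp only: of_real_eq_iff)
    also have "\<dots> = (LINT x:S|N. p x)"
      unfolding set_lebesgue_integral_def
      by (rule integral_cong_AE) (use h(2) v_sq in \<open>auto elim!: eventually_mono\<close>)
    finally show ?thesis
      using eq nonneg le int m0 by simp
  qed
  have rp_int: "integrable N (\<lambda>x. 1 / m x * p x)" and m0: "AE x in N. m x \<noteq> 0"
    using key[of "space N"] by (auto elim: eventually_mono)
  have "AE x in N. 0 \<le> 1 / m x * p x"
    by (rule density_nonneg[OF rp_int]) (use key rp_int in auto)
  moreover have "AE x in N. 0 \<le> p x - 1 / m x * p x"
  proof (rule density_nonneg)
    show "integrable N (\<lambda>x. p x - 1 / m x * p x)" using rp_int p_int by simp
    fix S assume S: "S \<in> sets N"
    have "(LINT x:S|N. p x - 1 / m x * p x) = (LINT x:S|N. p x) - (LINT x:S|N. 1 / m x * p x)"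
      by (rule set_integral_diff(2); unfold set_integrable_def; rule integrable_mult_indicator[OF S]; fact)
    then show "0 \<le> (LINT x:S|N. p x - 1 / m x * p x)"
      using key[OF S] rp_int by simp
  qed
  ultimately show ?thesis
    using m0
  proof eventually_elim
    fix x assume *: "0 \<le> 1 / m x * p x" "0 \<le> p x - 1 / m x * p x" "m x \<noteq> 0"
    have "m x > 0" using *(1,3) p0[of x] by (simp add: zero_le_divide_iff zero_le_mult_iff)
    moreover have "1 / m x * p x \<le> 1 * p x" using *(2) by simp
    then have "1 / m x \<le> 1" using p0[of x] by (simp only: mult_le_cancel_right)
    ultimately show "1 \<le> m x" by (simp add: divide_le_eq)
  qed
qed

text \<open>
  Both sides are the inner product of \<open>A\<^sup>-\<^sup>n h\<close> with \<open>h\<close>.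
\<close>

lemma diagonalizes_moments:
  assumes D: "diagonalizes N U m A" and m1: "AE x in N. 1 \<le> m x"
    and D': "diagonalizes N' U' m' A" and m1': "AE x in N'. 1 \<le> m' x" and h: "h \<in> L2 lborel"
  shows "(LINT x|N. (1 / m x) ^ n * (norm (U h x))\<^sup>2) = (LINT x|N'. (1 / m' x) ^ n * (norm (U' h x))\<^sup>2)"
proof -
  note E = diagonalizesD[OF D] and E' = diagonalizesD[OF D']
  have "\<exists>f\<in>L2 lborel. (AE x in N. U h x = of_real (m x ^ n) * U f x) \<and> (AE x in N'. U' h x = of_real (m' x ^ n) * U' f x)"
  proof (induction n)
    case 0
    show ?case using h by (intro bexI[of _ h]) auto
  next
    case (Suc n)
    then obtain f where f: "f \<in> L2 lborel" "AE x in N. U h x = of_real (m x ^ n) * U f x"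
      "AE x in N'. U' h x = of_real (m' x ^ n) * U' f x" by blast
    obtain g where g: "(g, f) \<in> A" using diagonalizes_inverse_total[OF D m1 f(1)] .
    then have "g \<in> L2 lborel" "AE x in N. U f x = of_real (m x) * U g x" "AE x in N'. U' f x = of_real (m' x) * U' g x"
      using E(6) E'(6) by auto
    with f(2,3) show ?case
      by (intro bexI[of _ g] conjI) (auto elim!: eventually_elim2 simp: mult_ac)
  qed
  then obtain f where f: "f \<in> L2 lborel" and U: "AE x in N. U h x = of_real (m x ^ n) * U f x"
    and U': "AE x in N'. U' h x = of_real (m' x ^ n) * U' f x" by blast
  have inner: "complex_of_real (LINT x|N. (1 / m x) ^ n * (norm (U h x))\<^sup>2) = L2_inner N (U f) (U h)"
    if D: "diagonalizes N U m A" and m1: "AE x in N. 1 \<le> m x" and U: "AE x in N. U h x = of_real (m x ^ n) * U f x" for N U m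
    unfolding L2_inner_def integral_complex_of_real[symmetric]
  proof (rule integral_cong_AE)
    note E = diagonalizesD[OF D]
    note [measurable] = E(2) L2_measurable[OF E(3)[OF f]] L2_measurable[OF E(3)[OF h]]
    show "(\<lambda>x. complex_of_real ((1 / m x) ^ n * (norm (U h x))\<^sup>2)) \<in> borel_measurable N" by measurable
    show "(\<lambda>x. U f x * cnj (U h x)) \<in> borel_measurable N" by measurable
    show "AE x in N. complex_of_real ((1 / m x) ^ n * (norm (U h x))\<^sup>2) = U f x * cnj (U h x)"
      using m1 U
    proof eventually_elim
      fix x assume *: "1 \<le> m x" "U h x = of_real (m x ^ n) * U f x"
      then have "of_real ((1 / m x) ^ n) * U h x = U f x"
        by (simp add: power_divide)
      then have "U f x * cnj (U h x) = of_real ((1 / m x) ^ n) * (U h x * cnj (U h x))"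
        by (metis mult.assoc)
      then show "complex_of_real ((1 / m x) ^ n * (norm (U h x))\<^sup>2) = U f x * cnj (U h x)"
        by (simp only: of_real_mult complex_norm_square)
    qed
  qed
  have "complex_of_real (LINT x|N. (1 / m x) ^ n * (norm (U h x))\<^sup>2) = of_real (LINT x|N'. (1 / m' x) ^ n * (norm (U' h x))\<^sup>2)"
    unfolding inner[OF D m1 U] inner[OF D' m1' U'] E(4)[OF f h] E'(4)[OF f h] ..
  then show ?thesis by (simp only: of_real_eq_iff)
qed

text \<open>
  As functions of \<open>t = 1 / m\<close>, the moments determine the integrals of all continuous
  functions on \<open>[0, 1]\<close>. The function \<open>\<psi> (1 / t)\<close> may be unbounded at
  \<open>0\<close>, so it is the increasing limit of continuous functions that vanish near \<open>0\<close>.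
\<close>

lemma diagonalizes_form_eq:
  assumes D: "diagonalizes N U m A" and m1: "AE x in N. 1 \<le> m x"
    and D': "diagonalizes N' U' m' A" and m1': "AE x in N'. 1 \<le> m' x" and g: "g \<in> L2 lborel"
    and \<psi>: "continuous_on {0<..} \<psi>" and \<psi>0: "\<And>t. t > 0 \<Longrightarrow> 0 \<le> \<psi> t"
  shows "(\<integral>\<^sup>+x. ennreal (\<psi> (m x) * (norm (U g x))\<^sup>2) \<partial>N) = (\<integral>\<^sup>+x. ennreal (\<psi> (m' x) * (norm (U' g x))\<^sup>2) \<partial>N')"
proof -
  \<comment> \<open>\<open>\<phi> n\<close> vanishes below \<open>1 / (n + 1)\<close> and agrees with
    \<open>\<psi> (1 / t)\<close> above \<open>2 / (n + 1)\<close>. The inner maximum changes nothing where the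
    second factor is positive and makes the definition continuous on the whole line.\<close>
  define \<phi> where "\<phi> n t = \<psi> (1 / max t (1 / real (Suc n))) * min 1 (max 0 (real (Suc n) * t - 1))" for n t
  have pos: "0 < max t (1 / real (Suc n))" for t n
    by (simp add: less_max_iff_disj)
  have \<phi>_cont: "continuous_on UNIV (\<phi> n)" for n
    unfolding \<phi>_def
  proof (intro continuous_intros continuous_on_compose2[OF \<psi>])
    show "\<forall>x\<in>UNIV. max x (1 / real (Suc n)) \<noteq> 0" using pos less_irrefl by metis
    show "range (\<lambda>x. 1 / max x (1 / real (Suc n))) \<subseteq> {0<..}" using pos by auto
  qed
  have \<phi>0: "0 \<le> \<phi> n t" for n t
    unfolding \<phi>_def using \<psi>0[of "1 / max t (1 / real (Suc n))"] pos[of t n]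
    by (intro mult_nonneg_nonneg) auto
  have \<phi>_eq: "\<phi> n t = \<psi> (1 / t) * min 1 (max 0 (real (Suc n) * t - 1))" if "t > 0" for n t
  proof (cases "real (Suc n) * t \<le> 1")
    case True
    then show ?thesis by (simp add: \<phi>_def)
  next
    case False
    then have "1 / real (Suc n) \<le> t" by (simp add: divide_le_eq mult.commute)
    then show ?thesis unfolding \<phi>_def by (simp add: max_absorb1)
  qed
  have \<phi>_mono: "\<phi> n t \<le> \<phi> (Suc n) t" if "t > 0" for n t
  proof -
    have "real (Suc n) * t \<le> real (Suc (Suc n)) * t"
      using that by (intro mult_right_mono) auto
    then have "min 1 (max 0 (real (Suc n) * t - 1)) \<le> min 1 (max 0 (real (Suc (Suc n)) * t - 1))"
      by linarith
    then show ?thesis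
      unfolding \<phi>_eq[OF that] by (rule mult_left_mono) (simp add: \<psi>0 that)
  qed
  have \<phi>_lim: "(\<lambda>n. \<phi> n t) \<longlonglongrightarrow> \<psi> (1 / t)" if t: "t > 0" for t
  proof (rule tendsto_eventually)
    obtain n0 where n0: "2 / t \<le> real n0" using real_arch_simple by blast
    show "\<forall>\<^sub>F n in sequentially. \<phi> n t = \<psi> (1 / t)"
      using eventually_ge_at_top[of n0]
    proof eventually_elim
      fix n assume "n0 \<le> n"
      then have "2 / t \<le> real (Suc n)" using n0 by linarith
      then have "2 \<le> real (Suc n) * t" using t by (simp add: divide_le_eq)
      then have "min 1 (max 0 (real (Suc n) * t - 1)) = 1" by linarith
      then show "\<phi> n t = \<psi> (1 / t)" unfolding \<phi>_eq[OF t] by simp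
    qed
  qed
  have form: "(\<integral>\<^sup>+x. ennreal (\<psi> (m x) * (norm (U g x))\<^sup>2) \<partial>N)
      = (SUP n. ennreal (LINT x|N. \<phi> n (1 / m x) * (norm (U g x))\<^sup>2))"
    if D: "diagonalizes N U m A" and m1: "AE x in N. 1 \<le> m x" for N U m
  proof -
    note E = diagonalizesD[OF D]
    note [measurable] = E(2) L2_measurable[OF E(3)[OF g]]
    have [measurable]: "\<phi> n \<in> borel_measurable borel" for n
      by (rule borel_measurable_continuous_onI[OF \<phi>_cont])
    have "(\<integral>\<^sup>+x. ennreal (\<psi> (m x) * (norm (U g x))\<^sup>2) \<partial>N)
        = (\<integral>\<^sup>+x. (SUP n. ennreal (\<phi> n (1 / m x) * (norm (U g x))\<^sup>2)) \<partial>N)"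
    proof (rule nn_integral_cong_AE)
      show "AE x in N. ennreal (\<psi> (m x) * (norm (U g x))\<^sup>2) = (SUP n. ennreal (\<phi> n (1 / m x) * (norm (U g x))\<^sup>2))"
        using m1
      proof eventually_elim
        fix x assume x: "1 \<le> m x"
        then have t: "1 / m x > 0" by simp
        have "(\<lambda>n. ennreal (\<phi> n (1 / m x) * (norm (U g x))\<^sup>2)) \<longlonglongrightarrow> ennreal (\<psi> (m x) * (norm (U g x))\<^sup>2)"
          using \<phi>_lim[OF t] by (intro tendsto_ennrealI tendsto_mult tendsto_const) simp
        moreover have "incseq (\<lambda>n. ennreal (\<phi> n (1 / m x) * (norm (U g x))\<^sup>2))"
          by (intro incseq_SucI ennreal_leI mult_right_mono \<phi>_mono t) simp
        ultimately show "ennreal (\<psi> (m x) * (norm (U g x))\<^sup>2) = (SUP n. ennreal (\<phi> n (1 / m x) * (norm (U g x))\<^sup>2))"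
          using LIMSEQ_SUP LIMSEQ_unique by blast
      qed
    qed
    also have "\<dots> = (SUP n. \<integral>\<^sup>+x. ennreal (\<phi> n (1 / m x) * (norm (U g x))\<^sup>2) \<partial>N)"
    proof (rule nn_integral_monotone_convergence_SUP_AE)
      show "AE x in N. ennreal (\<phi> n (1 / m x) * (norm (U g x))\<^sup>2) \<le> ennreal (\<phi> (Suc n) (1 / m x) * (norm (U g x))\<^sup>2)" for n
        using m1 by eventually_elim (intro ennreal_leI mult_right_mono \<phi>_mono, auto)
    qed measurable
    also have "\<dots> = (SUP n. ennreal (LINT x|N. \<phi> n (1 / m x) * (norm (U g x))\<^sup>2))"
    proof (rule SUP_cong[OF refl])
      fix n
      have "compact (\<phi> n ` {0..1})"
        by (rule compact_continuous_image[OF continuous_on_subset[OF \<phi>_cont]]) auto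
      then obtain C where C: "\<And>t. t \<in> {0..1} \<Longrightarrow> \<bar>\<phi> n t\<bar> \<le> C"
        using compact_imp_bounded bounded_iff by (metis image_eqI real_norm_def)
      have "integrable N (\<lambda>x. \<phi> n (1 / m x) * (norm (U g x))\<^sup>2)"
      proof (rule Bochner_Integration.integrable_bound)
        show "integrable N (\<lambda>x. C * (norm (U g x))\<^sup>2)"
          by (intro integrable_mult_right L2_norm_sq_integrable E(3) g)
        show "AE x in N. norm (\<phi> n (1 / m x) * (norm (U g x))\<^sup>2) \<le> norm (C * (norm (U g x))\<^sup>2)"
          using m1
        proof eventually_elim
          fix x assume "1 \<le> m x"
          then have "\<bar>\<phi> n (1 / m x)\<bar> \<le> \<bar>C\<bar>" using C[of "1 / m x"] by auto
          then show "norm (\<phi> n (1 / m x) * (norm (U g x))\<^sup>2) \<le> norm (C * (norm (U g x))\<^sup>2)"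
            by (simp add: abs_mult mult_right_mono)
        qed
      qed measurable
      then show "(\<integral>\<^sup>+x. ennreal (\<phi> n (1 / m x) * (norm (U g x))\<^sup>2) \<partial>N)
          = ennreal (LINT x|N. \<phi> n (1 / m x) * (norm (U g x))\<^sup>2)"
        using \<phi>0 by (intro nn_integral_eq_integral) auto
    qed
    finally show ?thesis .
  qed
  note E = diagonalizesD[OF D] and E' = diagonalizesD[OF D']
  note [measurable] = E(2) E'(2)
  have "(LINT x|N. \<phi> n (1 / m x) * (norm (U g x))\<^sup>2) = (LINT x|N'. \<phi> n (1 / m' x) * (norm (U' g x))\<^sup>2)" for n
  proof (rule Hausdorff_moments[OF _ _ _ _ _ _ _ _ diagonalizes_moments[OF D m1 D' m1' g] \<phi>_cont])
    show "AE x in N. 0 \<le> 1 / m x \<and> 1 / m x \<le> 1" using m1 by eventually_elim auto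
    show "AE x in N'. 0 \<le> 1 / m' x \<and> 1 / m' x \<le> 1" using m1' by eventually_elim auto
    show "integrable N (\<lambda>x. (norm (U g x))\<^sup>2)" "integrable N' (\<lambda>x. (norm (U' g x))\<^sup>2)"
      using E(3) E'(3) g by (auto intro: L2_norm_sq_integrable)
  qed simp_all
  then show ?thesis
    unfolding form[OF D m1] form[OF D' m1'] by simp
qed

text \<open>
  The spectral form is defined through an arbitrarily chosen diagonalization. It can be
  evaluated in any diagonalization with spectrum in \<open>[1, \<infinity>)\<close>.
\<close>

theorem spectral_form_eq:
  assumes D: "diagonalizes N U m A" and m1: "AE x in N. 1 \<le> m x" and g: "g \<in> L2 lborel"
    and \<psi>: "continuous_on {0<..} \<psi>" and \<psi>0: "\<And>t. t > 0 \<Longrightarrow> 0 \<le> \<psi> t"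
  shows "spectral_form A \<psi> g = (\<integral>\<^sup>+x. ennreal (\<psi> (m x) * (norm (U g x))\<^sup>2) \<partial>N)"
proof -
  obtain N0 U0 m0 where eq: "diagonalization A = (N0, U0, m0)"
    by (cases "diagonalization A") auto
  have "case diagonalization A of (N, U, m) \<Rightarrow> diagonalizes N U m A"
    unfolding diagonalization_def by (rule someI[of _ "(N, U, m)"]) (use D in simp)
  then have D0: "diagonalizes N0 U0 m0 A"
    unfolding eq by simp
  show ?thesis
    unfolding spectral_form_def eq prod.case
    by (rule diagonalizes_form_eq[OF D0 diagonalizes_spectrum_bound[OF D0 D m1] D m1 g \<psi> \<psi>0])
qed

section \<open>The stability estimate\<close>

lemma psi_exp:
  assumes "\<kappa> > 0"
  shows "psi \<kappa> \<theta> (exp (2 * \<kappa> * \<bar>\<omega>\<bar>)) = exp (\<theta> * \<omega>\<^sup>2 + sqrt 8 * (1 - \<theta>) * \<bar>\<omega>\<bar>)"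
  using assms unfolding psi_def by simp

lemma psi_voigt_hat:
  assumes "\<kappa> > 0"
  shows "psi \<kappa> \<theta> (exp (2 * \<kappa> * \<bar>\<omega>\<bar>)) * (voigt_hat \<theta> \<omega>)\<^sup>2 = 1"
proof -
  have "sqrt 8 = sqrt (2\<^sup>2 * 2)" by simp
  also have "\<dots> = 2 * sqrt 2" by (simp only: real_sqrt_mult real_sqrt_abs abs_numeral)
  finally have s8: "sqrt 8 = 2 * sqrt 2" .
  have "(voigt_hat \<theta> \<omega>)\<^sup>2 = exp (- (\<theta> * \<omega>\<^sup>2 + sqrt 8 * (1 - \<theta>) * \<bar>\<omega>\<bar>))"
    unfolding voigt_hat_eq power2_eq_square exp_add[symmetric] s8 by (simp add: algebra_simps)
  then show ?thesis unfolding psi_exp[OF assms] by (simp flip: exp_add)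
qed

text \<open>
  Below the cutoff \<open>\<Omega>\<close> the factor \<open>exp (2 \<kappa> |\<omega>|)\<close> is at most
  \<open>exp (2 \<kappa> \<Omega>)\<close>. Above it, \<open>2 \<kappa> t - \<theta> t\<^sup>2\<close> is decreasing in
  \<open>t\<close>, because \<open>\<Omega>\<close> is beyond the vertex \<open>\<kappa> / \<theta>\<close>.
  The bound compares \<open>\<psi>\<close> with its factor \<open>exp (\<theta> \<omega>\<^sup>2)\<close>.
\<close>

lemma cutoff_pointwise:
  fixes \<kappa> \<theta> \<Omega> \<omega> :: real
  assumes \<kappa>: "\<kappa> > 0" and \<theta>: "0 < \<theta>" "\<theta> \<le> 1" and \<Omega>: "\<kappa> / \<theta> \<le> \<Omega>"
  shows "1 \<le> exp (2 * \<kappa> * \<Omega>) * (exp (- (\<kappa> * \<bar>\<omega>\<bar>)))\<^sup>2 +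
    exp (2 * \<kappa> * \<Omega> - \<theta> * \<Omega>\<^sup>2) * (psi \<kappa> \<theta> (exp (2 * \<kappa> * \<bar>\<omega>\<bar>)) * (exp (- (\<kappa> * \<bar>\<omega>\<bar>)))\<^sup>2)"
proof -
  let ?t = "\<bar>\<omega>\<bar>"
  have e2: "(exp (- (\<kappa> * ?t)))\<^sup>2 = exp (- (2 * \<kappa> * ?t))"
    by (simp add: power2_eq_square flip: exp_add)
  show ?thesis
  proof (cases "?t \<le> \<Omega>")
    case True
    then have "1 \<le> exp (2 * \<kappa> * \<Omega>) * exp (- (2 * \<kappa> * ?t))"
      using \<kappa> by (simp flip: exp_add)
    moreover have "0 \<le> exp (2 * \<kappa> * \<Omega> - \<theta> * \<Omega>\<^sup>2) * (psi \<kappa> \<theta> (exp (2 * \<kappa> * ?t)) * exp (- (2 * \<kappa> * ?t)))"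
      by (simp add: psi_def)
    ultimately show ?thesis unfolding e2 by linarith
  next
    case False
    have "\<kappa> \<le> \<theta> * \<Omega>" using \<Omega> \<theta> by (simp add: divide_le_eq mult.commute)
    then have "0 \<le> (?t - \<Omega>) * (\<theta> * (?t + \<Omega>) - 2 * \<kappa>)"
    proof (intro mult_nonneg_nonneg)
      have "\<theta> * \<Omega> \<le> \<theta> * ?t" using False \<theta> by (intro mult_left_mono) auto
      then show "0 \<le> \<theta> * (?t + \<Omega>) - 2 * \<kappa>"
        using \<open>\<kappa> \<le> \<theta> * \<Omega>\<close> unfolding distrib_left by linarith
    qed (use False in simp)
    also have "\<dots> = 2 * \<kappa> * \<Omega> - \<theta> * \<Omega>\<^sup>2 + (\<theta> * ?t\<^sup>2 - 2 * \<kappa> * ?t)"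
      by (simp add: algebra_simps power2_eq_square)
    also have "\<dots> \<le> 2 * \<kappa> * \<Omega> - \<theta> * \<Omega>\<^sup>2 + ((\<theta> * \<omega>\<^sup>2 + sqrt 8 * (1 - \<theta>) * ?t) + - (2 * \<kappa> * ?t))"
      using \<theta> by simp
    finally have "1 \<le> exp (2 * \<kappa> * \<Omega> - \<theta> * \<Omega>\<^sup>2 + ((\<theta> * \<omega>\<^sup>2 + sqrt 8 * (1 - \<theta>) * ?t) + - (2 * \<kappa> * ?t)))"
      by simp
    also have "\<dots> = exp (2 * \<kappa> * \<Omega> - \<theta> * \<Omega>\<^sup>2) * (psi \<kappa> \<theta> (exp (2 * \<kappa> * ?t)) * exp (- (2 * \<kappa> * ?t)))"
      by (simp only: psi_exp[OF \<kappa>] exp_add)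
    also have "\<dots> \<le> exp (2 * \<kappa> * \<Omega>) * exp (- (2 * \<kappa> * ?t)) + \<dots>"
      by simp
    finally show ?thesis unfolding e2 .
  qed
qed

text \<open>
  Here \<open>D\<close> is the transform of the error and \<open>E\<close> that of the residual.
\<close>

lemma cutoff_estimate:
  assumes \<kappa>: "\<kappa> > 0" and \<theta>: "0 < \<theta>" "\<theta> \<le> 1" and \<Omega>: "\<kappa> / \<theta> \<le> \<Omega>"
    and D: "D \<in> L2 lborel" and C: "C \<ge> 0"
  defines "E \<equiv> \<lambda>\<omega>. complex_of_real (exp (- (\<kappa> * \<bar>\<omega>\<bar>))) * D \<omega>"
  assumes form: "(\<integral>\<^sup>+\<omega>. ennreal (psi \<kappa> \<theta> (exp (2 * \<kappa> * \<bar>\<omega>\<bar>)) * (norm (E \<omega>))\<^sup>2) \<partial>lborel) \<le> ennreal C"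
  shows "(LINT \<omega>|lborel. (norm (D \<omega>))\<^sup>2) \<le> exp (2 * \<kappa> * \<Omega>) * ((LINT \<omega>|lborel. (norm (E \<omega>))\<^sup>2) + exp (- (\<theta> * \<Omega>\<^sup>2)) * C)"
proof -
  have [measurable]: "D \<in> borel_measurable borel" using L2_measurable[OF D] by simp
  have [measurable]: "E \<in> borel_measurable borel" unfolding E_def by measurable
  have [measurable]: "psi \<kappa> \<theta> \<in> borel_measurable borel" unfolding psi_def[abs_def] by measurable
  have E: "E \<in> L2 lborel" unfolding E_def by (rule exp_neg_abs_mult_L2[OF \<kappa> D])
  let ?a = "exp (2 * \<kappa> * \<Omega>)" and ?b = "exp (2 * \<kappa> * \<Omega> - \<theta> * \<Omega>\<^sup>2)"
  let ?P = "\<lambda>\<omega>. psi \<kappa> \<theta> (exp (2 * \<kappa> * \<bar>\<omega>\<bar>)) * (norm (E \<omega>))\<^sup>2"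
  have P0: "0 \<le> ?P \<omega>" for \<omega> by (simp add: psi_def)
  have "ennreal (LINT \<omega>|lborel. (norm (D \<omega>))\<^sup>2) = (\<integral>\<^sup>+\<omega>. ennreal ((norm (D \<omega>))\<^sup>2) \<partial>lborel)"
    by (rule nn_integral_eq_integral[symmetric, OF L2_norm_sq_integrable[OF D]]) simp
  also have "\<dots> \<le> (\<integral>\<^sup>+\<omega>. (ennreal (?a * (norm (E \<omega>))\<^sup>2) + ennreal ?b * ennreal (?P \<omega>)) \<partial>lborel)"
  proof (rule nn_integral_mono)
    fix \<omega>
    have "1 * (norm (D \<omega>))\<^sup>2 \<le> (?a * (exp (- (\<kappa> * \<bar>\<omega>\<bar>)))\<^sup>2 +
        ?b * (psi \<kappa> \<theta> (exp (2 * \<kappa> * \<bar>\<omega>\<bar>)) * (exp (- (\<kappa> * \<bar>\<omega>\<bar>)))\<^sup>2)) * (norm (D \<omega>))\<^sup>2"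
      by (rule mult_right_mono[OF cutoff_pointwise[OF \<kappa> \<theta> \<Omega>]]) simp
    also have "\<dots> = ?a * (norm (E \<omega>))\<^sup>2 + ?b * ?P \<omega>"
      unfolding E_def by (simp add: norm_mult power_mult_distrib algebra_simps)
    finally have "ennreal ((norm (D \<omega>))\<^sup>2) \<le> ennreal (?a * (norm (E \<omega>))\<^sup>2 + ?b * ?P \<omega>)"
      by (intro ennreal_leI) simp
    also have "\<dots> = ennreal (?a * (norm (E \<omega>))\<^sup>2) + ennreal ?b * ennreal (?P \<omega>)"
      using P0 by (simp add: ennreal_plus ennreal_mult)
    finally show "ennreal ((norm (D \<omega>))\<^sup>2) \<le> ennreal (?a * (norm (E \<omega>))\<^sup>2) + ennreal ?b * ennreal (?P \<omega>)" .
  qed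
  also have "\<dots> = (\<integral>\<^sup>+\<omega>. ennreal (?a * (norm (E \<omega>))\<^sup>2) \<partial>lborel) + ennreal ?b * (\<integral>\<^sup>+\<omega>. ennreal (?P \<omega>) \<partial>lborel)"
    by (subst nn_integral_add) (auto simp: nn_integral_cmult)
  also have "(\<integral>\<^sup>+\<omega>. ennreal (?a * (norm (E \<omega>))\<^sup>2) \<partial>lborel) = ennreal (LINT \<omega>|lborel. ?a * (norm (E \<omega>))\<^sup>2)"
    by (rule nn_integral_eq_integral) (use L2_norm_sq_integrable[OF E] in auto)
  also have "ennreal (LINT \<omega>|lborel. ?a * (norm (E \<omega>))\<^sup>2) + ennreal ?b * (\<integral>\<^sup>+\<omega>. ennreal (?P \<omega>) \<partial>lborel)
      \<le> ennreal (LINT \<omega>|lborel. ?a * (norm (E \<omega>))\<^sup>2) + ennreal ?b * ennreal C"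
    by (intro add_left_mono mult_left_mono form) simp
  also have "\<dots> = ennreal (?a * (LINT \<omega>|lborel. (norm (E \<omega>))\<^sup>2) + ?b * C)"
    using C by (simp add: ennreal_plus ennreal_mult integral_nonneg_AE)
  finally have "ennreal (LINT \<omega>|lborel. (norm (D \<omega>))\<^sup>2) \<le> ennreal (?a * (LINT \<omega>|lborel. (norm (E \<omega>))\<^sup>2) + ?b * C)" .
  then have "(LINT \<omega>|lborel. (norm (D \<omega>))\<^sup>2) \<le> ?a * (LINT \<omega>|lborel. (norm (E \<omega>))\<^sup>2) + ?b * C"
    using C by (subst (asm) ennreal_le_iff) (auto intro!: add_nonneg_nonneg mult_nonneg_nonneg integral_nonneg_AE)
  also have "?b = ?a * exp (- (\<theta> * \<Omega>\<^sup>2))" by (simp flip: exp_add)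
  finally show ?thesis by (simp add: algebra_simps)
qed

text \<open>
  Write \<open>l = |ln \<epsilon>|\<close> and \<open>y = sqrt (l / \<theta>)\<close>. A cutoff \<open>\<Omega> = c y\<close>
  gives \<open>exp (- \<theta> \<Omega>\<^sup>2) = \<epsilon> ^ (c\<^sup>2)\<close>, which is small compared with
  \<open>\<epsilon>\<^sup>2\<close> if \<open>c > sqrt 2\<close>, and amplifies squared
  norms by \<open>exp (2 \<kappa> c y)\<close>. The claimed rate, squared, allows for a factor of about \<open>exp (4 \<kappa> y)\<close>, so every \<open>c\<close>
  between \<open>sqrt 2\<close> and \<open>2\<close> works in the limit; the choice is \<open>c = 3/2\<close>.
\<close>

lemma rate_asymptotics:
  fixes \<kappa> \<theta> C :: real
  assumes \<kappa>: "\<kappa> > 0" and \<theta>: "0 < \<theta>" "\<theta> \<le> 1" and C: "C \<ge> 0"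
  obtains \<epsilon>0 where "\<epsilon>0 > 0" "\<And>\<epsilon>. 0 < \<epsilon> \<Longrightarrow> \<epsilon> < \<epsilon>0 \<Longrightarrow> \<exists>\<Omega>. \<kappa> / \<theta> \<le> \<Omega> \<and>
    exp (2 * \<kappa> * \<Omega>) * (\<epsilon>\<^sup>2 + exp (- (\<theta> * \<Omega>\<^sup>2)) * C)
      \<le> (\<epsilon> powr (1 - 2 * \<kappa> / sqrt (\<theta> * \<bar>ln \<epsilon>\<bar> + (1 - \<theta>)\<^sup>2)))\<^sup>2"
proof -
  \<comment> \<open>The summands guarantee, in this order: \<open>\<kappa> / \<theta> \<le> y\<close>, that the constant factor
    \<open>2\<close> is absorbed, that \<open>(1 - \<theta>)\<^sup>2\<close> is small compared with \<open>\<theta> l\<close>, and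
    that \<open>C\<close> is absorbed. The last summand makes \<open>\<epsilon> < 1\<close>.\<close>
  define L where "L = \<theta> * (\<kappa> / \<theta>)\<^sup>2 + \<theta> * (2 / \<kappa>)\<^sup>2 + 4 / \<theta> + 4 * C + 1"
  have "\<exists>\<Omega>. \<kappa> / \<theta> \<le> \<Omega> \<and>
      exp (2 * \<kappa> * \<Omega>) * (\<epsilon>\<^sup>2 + exp (- (\<theta> * \<Omega>\<^sup>2)) * C)
        \<le> (\<epsilon> powr (1 - 2 * \<kappa> / sqrt (\<theta> * \<bar>ln \<epsilon>\<bar> + (1 - \<theta>)\<^sup>2)))\<^sup>2"
    if \<epsilon>: "0 < \<epsilon>" "\<epsilon> < exp (- L)" for \<epsilon>
  proof -
    define l where "l = - ln \<epsilon>"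
    have parts: "0 \<le> \<theta> * (\<kappa> / \<theta>)\<^sup>2" "0 \<le> \<theta> * (2 / \<kappa>)\<^sup>2" "0 \<le> 4 / \<theta>" "0 \<le> 4 * C"
      using \<theta> C by auto
    have "ln \<epsilon> < - L" using \<epsilon> by (metis ln_exp ln_less_cancel_iff exp_gt_zero)
    then have lL: "L \<le> l" by (simp add: l_def)
    have l: "\<theta> * (\<kappa> / \<theta>)\<^sup>2 \<le> l" "\<theta> * (2 / \<kappa>)\<^sup>2 \<le> l" "4 / \<theta> \<le> l" "4 * C \<le> l" "0 < l"
      using lL parts unfolding L_def by linarith+
    have abs_ln: "\<bar>ln \<epsilon>\<bar> = l" using l(5) by (simp add: l_def)
    have \<epsilon>_eq: "\<epsilon> = exp (- l)" using \<epsilon>(1) by (simp add: l_def)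
    define y where "y = sqrt (l / \<theta>)"
    have y2: "\<theta> * y\<^sup>2 = l" using l(5) \<theta> by (simp add: y_def)
    have y_ge: "z \<le> y" if "\<theta> * z\<^sup>2 \<le> l" for z
      unfolding y_def by (rule real_le_rsqrt) (use that \<theta> in \<open>simp add: le_divide_eq mult.commute\<close>)
    have y: "\<kappa> / \<theta> \<le> y" "2 / \<kappa> \<le> y" using y_ge l(1,2) by auto
    have y0: "0 < y" using l(5) \<theta> by (simp add: y_def)
    define s where "s = sqrt (\<theta> * l + (1 - \<theta>)\<^sup>2)"
    have \<theta>l: "4 \<le> \<theta> * l" using l(3) \<theta> by (simp add: divide_le_eq mult.commute)
    have c1: "(1 - \<theta>)\<^sup>2 \<le> 1" using \<theta> by (simp add: power_le_one)
    have s0: "0 < s" unfolding s_def using \<theta>l by (simp add: add_pos_nonneg)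
    have s_le: "s \<le> 8 / 7 * (\<theta> * y)"
      unfolding s_def
    proof (rule real_le_lsqrt)
      have "(8 / 7 * (\<theta> * y))\<^sup>2 = 64 / 49 * (\<theta> * l)"
        unfolding y2[symmetric] by (simp add: power2_eq_square)
      then show "\<theta> * l + (1 - \<theta>)\<^sup>2 \<le> (8 / 7 * (\<theta> * y))\<^sup>2"
        using \<theta>l c1 by linarith
    qed (use \<theta> y0 in simp)
    \<comment> \<open>The loss of \<open>8 / 7\<close> in \<open>s\<close> leaves \<open>7 / 2\<close> instead of \<open>4\<close>, still
      more than the \<open>3\<close> that the cutoff costs.\<close>
    have rate: "7 / 2 * \<kappa> * y \<le> 4 * \<kappa> * l / s"
    proof -
      have "7 / 2 * \<kappa> * y * s \<le> 7 / 2 * \<kappa> * y * (8 / 7 * (\<theta> * y))"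
        using \<kappa> y0 by (intro mult_left_mono s_le) simp
      also have "\<dots> = 4 * \<kappa> * l"
        unfolding y2[symmetric] by (simp add: power2_eq_square)
      finally show ?thesis using s0 by (simp add: le_divide_eq)
    qed
    have ln2: "ln 2 \<le> 1 / 2 * \<kappa> * y"
    proof -
      have "2 \<le> \<kappa> * y" using y(2) \<kappa> by (simp add: divide_le_eq mult.commute)
      moreover have "ln 2 \<le> (1::real)" using ln_le_minus_one[of 2] by simp
      ultimately show ?thesis by simp
    qed
    have tail: "exp (- (9 / 4 * l)) * C \<le> exp (- (2 * l))"
    proof -
      have "C \<le> exp (l / 4)" using exp_ge_add_one_self[of "l / 4"] l(4) by linarith
      then have "exp (- (9 / 4 * l)) * C \<le> exp (- (9 / 4 * l)) * exp (l / 4)"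
        by (intro mult_left_mono) auto
      also have "\<dots> = exp (- (2 * l))" by (simp flip: exp_add)
      finally show ?thesis .
    qed
    let ?\<Omega> = "3 / 2 * y"
    have \<Omega>_sq: "\<theta> * ?\<Omega>\<^sup>2 = 9 / 4 * l"
      unfolding y2[symmetric] by (simp add: power2_eq_square)
    have "exp (2 * \<kappa> * ?\<Omega>) * (\<epsilon>\<^sup>2 + exp (- (\<theta> * ?\<Omega>\<^sup>2)) * C) \<le> exp (3 * \<kappa> * y) * (exp (- (2 * l)) + exp (- (2 * l)))"
    proof (rule mult_mono)
      show "\<epsilon>\<^sup>2 + exp (- (\<theta> * ?\<Omega>\<^sup>2)) * C \<le> exp (- (2 * l)) + exp (- (2 * l))"
        unfolding \<Omega>_sq using tail by (simp add: \<epsilon>_eq power2_eq_square flip: exp_add)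
    qed (use C in auto)
    also have "\<dots> = exp (ln 2) * (exp (3 * \<kappa> * y) * exp (- (2 * l)))" by simp
    also have "\<dots> = exp (ln 2 + (3 * \<kappa> * y + - (2 * l)))" by (simp only: exp_add)
    also have "\<dots> \<le> exp (4 * \<kappa> * l / s + - (2 * l))"
      using ln2 rate by simp
    also have "\<dots> = (\<epsilon> powr (1 - 2 * \<kappa> / sqrt (\<theta> * \<bar>ln \<epsilon>\<bar> + (1 - \<theta>)\<^sup>2)))\<^sup>2"
      unfolding abs_ln s_def[symmetric] powr_def using \<epsilon>(1) s0
      by (simp add: power2_eq_square l_def field_simps flip: exp_add)
    finally have "exp (2 * \<kappa> * ?\<Omega>) * (\<epsilon>\<^sup>2 + exp (- (\<theta> * ?\<Omega>\<^sup>2)) * C)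
        \<le> (\<epsilon> powr (1 - 2 * \<kappa> / sqrt (\<theta> * \<bar>ln \<epsilon>\<bar> + (1 - \<theta>)\<^sup>2)))\<^sup>2" .
    moreover have "\<kappa> / \<theta> \<le> ?\<Omega>" using y(1) y0 by linarith
    ultimately show ?thesis by (intro exI[of _ ?\<Omega>] conjI) auto
  qed
  then show ?thesis by (intro that[of "exp (- L)"]) auto
qed

lemma lorentz_spectral_form:
  assumes \<kappa>: "\<kappa> > 0" and f: "f \<in> L2 lborel"
  shows "spectral_form (BB_adj_inv \<kappa>) (psi \<kappa> \<theta>) (lorentz_op \<kappa> f) =
    (\<integral>\<^sup>+\<omega>. ennreal (psi \<kappa> \<theta> (exp (2 * \<kappa> * \<bar>\<omega>\<bar>)) *
       (norm (complex_of_real (exp (- (\<kappa> * \<bar>\<omega>\<bar>))) * fourier f \<omega>))\<^sup>2) \<partial>lborel)"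
proof -
  have FT: "FT (lorentz_op \<kappa> f) (\<lambda>\<omega>. complex_of_real (exp (- (\<kappa> * \<bar>\<omega>\<bar>))) * fourier f \<omega>)"
    by (rule FT_lorentz_op[OF \<kappa> FT_fourier[OF f]])
  have Bf: "lorentz_op \<kappa> f \<in> L2 lborel" by (rule FT_L2_left[OF FT])
  have "continuous_on {0<..} (psi \<kappa> \<theta>)"
    unfolding psi_def using \<kappa> by (intro continuous_intros) auto
  moreover have "0 \<le> psi \<kappa> \<theta> t" for t by (simp add: psi_def)
  ultimately have "spectral_form (BB_adj_inv \<kappa>) (psi \<kappa> \<theta>) (lorentz_op \<kappa> f) =
      (\<integral>\<^sup>+\<omega>. ennreal (psi \<kappa> \<theta> (exp (2 * \<kappa> * \<bar>\<omega>\<bar>)) * (norm (fourier (lorentz_op \<kappa> f) \<omega>))\<^sup>2) \<partial>lborel)"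
    using \<kappa> by (intro spectral_form_eq[OF fourier_diagonalizes_BB_adj_inv[OF \<kappa>] _ Bf]) auto
  also have "\<dots> = (\<integral>\<^sup>+\<omega>. ennreal (psi \<kappa> \<theta> (exp (2 * \<kappa> * \<bar>\<omega>\<bar>)) *
       (norm (complex_of_real (exp (- (\<kappa> * \<bar>\<omega>\<bar>))) * fourier f \<omega>))\<^sup>2) \<partial>lborel)"
    using FT_unique[OF FT_fourier[OF Bf] FT AE_I2[OF refl]]
    by (intro nn_integral_cong_AE) (auto elim!: eventually_mono)
  finally show ?thesis .
qed

text \<open>
  The weight \<open>\<psi>\<close> is the inverse square of the Voigt multiplier in the Fourier domain, so
  the form of the spectrum is the squared norm of \<open>u\<close>.
\<close>

lemma voigt_spectral_form_finite:
  assumes \<kappa>: "\<kappa> > 0" and \<theta>: "0 < \<theta>" "\<theta> \<le> 1" and g: "voigt_spectrum \<theta> g"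
    and f: "f \<in> L2 lborel" and fg: "AE x in lborel. lorentz_op \<kappa> f x = g x"
  shows "spectral_form (BB_adj_inv \<kappa>) (psi \<kappa> \<theta>) (lorentz_op \<kappa> f) < \<infinity>"
proof -
  obtain u where u: "u \<in> L2 lborel" "AE x in lborel. g x = int_op (voigt_kernel \<theta>) u x"
    using g unfolding voigt_spectrum_def by blast
  have "AE x in lborel. lorentz_op \<kappa> f x = int_op (voigt_kernel \<theta>) u x"
    using fg u(2) by eventually_elim simp
  from FT_unique[OF FT_lorentz_op[OF \<kappa> FT_fourier[OF f]] FT_voigt[OF \<theta> FT_fourier[OF u(1)]] this]
  have "AE \<omega> in lborel. psi \<kappa> \<theta> (exp (2 * \<kappa> * \<bar>\<omega>\<bar>)) *
      (norm (complex_of_real (exp (- (\<kappa> * \<bar>\<omega>\<bar>))) * fourier f \<omega>))\<^sup>2 = (norm (fourier u \<omega>))\<^sup>2"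
  proof eventually_elim
    fix \<omega> assume eq: "complex_of_real (exp (- (\<kappa> * \<bar>\<omega>\<bar>))) * fourier f \<omega> = of_real (voigt_hat \<theta> \<omega>) * fourier u \<omega>"
    show "psi \<kappa> \<theta> (exp (2 * \<kappa> * \<bar>\<omega>\<bar>)) * (norm (complex_of_real (exp (- (\<kappa> * \<bar>\<omega>\<bar>))) * fourier f \<omega>))\<^sup>2 = (norm (fourier u \<omega>))\<^sup>2"
      unfolding eq using psi_voigt_hat[OF \<kappa>, of \<theta> \<omega>]
      by (simp add: norm_mult power_mult_distrib mult.assoc[symmetric])
  qed
  then have "spectral_form (BB_adj_inv \<kappa>) (psi \<kappa> \<theta>) (lorentz_op \<kappa> f) = (\<integral>\<^sup>+\<omega>. ennreal ((norm (fourier u \<omega>))\<^sup>2) \<partial>lborel)"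
    unfolding lorentz_spectral_form[OF \<kappa> f] by (intro nn_integral_cong_AE) (auto elim!: eventually_mono)
  also have "\<dots> < \<infinity>"
    using L2_norm_sq_integrable[OF fourier_L2[OF u(1)]]
    by (subst nn_integral_eq_integral) auto
  finally show ?thesis .
qed

theorem proposition4:
  fixes \<kappa> \<theta> M :: real and f g :: "real \<Rightarrow> complex"
  assumes "\<kappa> > 0" and "0 < \<theta>" and "\<theta> \<le> 1" and "M \<ge> 0"
    and "voigt_spectrum \<theta> g"
    and "f \<in> L2 lborel" and "AE x in lborel. lorentz_op \<kappa> f x = g x"
  shows "\<exists>\<epsilon>0>0. \<forall>\<epsilon>. 0 < \<epsilon> \<and> \<epsilon> < \<epsilon>0 \<longrightarrow>
    (\<forall>f\<alpha> \<in> L2 lborel.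
      lorentz_op \<kappa> f\<alpha> \<in> H_space (BB_adj_inv \<kappa>) (psi \<kappa> \<theta>) \<and>
      H_norm (BB_adj_inv \<kappa>) (psi \<kappa> \<theta>) (lorentz_op \<kappa> f\<alpha>) \<le> M \<and>
      L2_norm lborel (\<lambda>x. lorentz_op \<kappa> f\<alpha> x - g x) = \<epsilon> \<longrightarrow>
      L2_norm lborel (\<lambda>x. f\<alpha> x - f x)
        \<le> \<epsilon> powr (1 - 2 * \<kappa> / sqrt (\<theta> * \<bar>ln \<epsilon>\<bar> + (1 - \<theta>)\<^sup>2)))"
proof -
  note \<kappa> = assms(1) and \<theta> = assms(2,3) and f = assms(6)
  let ?form = "\<lambda>f. spectral_form (BB_adj_inv \<kappa>) (psi \<kappa> \<theta>) (lorentz_op \<kappa> f)"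
  let ?E = "\<lambda>w \<omega>. complex_of_real (exp (- (\<kappa> * \<bar>\<omega>\<bar>))) * w \<omega>"
  let ?P = "\<lambda>\<omega>. psi \<kappa> \<theta> (exp (2 * \<kappa> * \<bar>\<omega>\<bar>))"
  define G where "G = enn2real (?form f)"
  have G: "?form f = ennreal G" "G \<ge> 0"
    using voigt_spectral_form_finite[OF \<kappa> \<theta> assms(5) f assms(7)]
    by (simp_all add: G_def less_top)
  define C where "C = 2 * M\<^sup>2 + 2 * G"
  have C: "C \<ge> 0" using G(2) by (simp add: C_def)
  obtain \<epsilon>0 where \<epsilon>0: "\<epsilon>0 > 0" and rate: "\<And>\<epsilon>. 0 < \<epsilon> \<Longrightarrow> \<epsilon> < \<epsilon>0 \<Longrightarrow> \<exists>\<Omega>. \<kappa> / \<theta> \<le> \<Omega> \<and>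
      exp (2 * \<kappa> * \<Omega>) * (\<epsilon>\<^sup>2 + exp (- (\<theta> * \<Omega>\<^sup>2)) * C)
        \<le> (\<epsilon> powr (1 - 2 * \<kappa> / sqrt (\<theta> * \<bar>ln \<epsilon>\<bar> + (1 - \<theta>)\<^sup>2)))\<^sup>2"
    using rate_asymptotics[OF \<kappa> \<theta> C] by blast
  show ?thesis
  proof (intro exI[of _ \<epsilon>0] conjI allI impI ballI \<epsilon>0)
    fix \<epsilon> f\<alpha>
    assume \<epsilon>: "0 < \<epsilon> \<and> \<epsilon> < \<epsilon>0" and f\<alpha>: "f\<alpha> \<in> L2 lborel"
      and H: "lorentz_op \<kappa> f\<alpha> \<in> H_space (BB_adj_inv \<kappa>) (psi \<kappa> \<theta>) \<and>
        H_norm (BB_adj_inv \<kappa>) (psi \<kappa> \<theta>) (lorentz_op \<kappa> f\<alpha>) \<le> M \<and>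
        L2_norm lborel (\<lambda>x. lorentz_op \<kappa> f\<alpha> x - g x) = \<epsilon>"
    obtain \<Omega> where \<Omega>: "\<kappa> / \<theta> \<le> \<Omega>" and bound: "exp (2 * \<kappa> * \<Omega>) * (\<epsilon>\<^sup>2 + exp (- (\<theta> * \<Omega>\<^sup>2)) * C)
        \<le> (\<epsilon> powr (1 - 2 * \<kappa> / sqrt (\<theta> * \<bar>ln \<epsilon>\<bar> + (1 - \<theta>)\<^sup>2)))\<^sup>2"
      using rate \<epsilon> by blast
    define D where "D \<omega> = fourier f\<alpha> \<omega> - fourier f \<omega>" for \<omega>
    note [measurable] = fourier_measurable[OF f] fourier_measurable[OF f\<alpha>]
    have [measurable]: "psi \<kappa> \<theta> \<in> borel_measurable borel" unfolding psi_def[abs_def] by measurable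
    have FD: "FT (\<lambda>x. f\<alpha> x - f x) D"
      unfolding D_def by (rule FT_diff[OF FT_fourier[OF f\<alpha>] FT_fourier[OF f]])
    have ED: "?E D = (\<lambda>\<omega>. ?E (fourier f\<alpha>) \<omega> - ?E (fourier f) \<omega>)"
      by (simp add: D_def right_diff_distrib)
    have FED: "FT (\<lambda>x. lorentz_op \<kappa> f\<alpha> x - lorentz_op \<kappa> f x) (?E D)"
      unfolding ED by (rule FT_diff[OF FT_lorentz_op[OF \<kappa> FT_fourier[OF f\<alpha>]] FT_lorentz_op[OF \<kappa> FT_fourier[OF f]]])
    have "(LINT \<omega>|lborel. (norm (?E D \<omega>))\<^sup>2) = (LINT x|lborel. (norm (lorentz_op \<kappa> f\<alpha> x - lorentz_op \<kappa> f x))\<^sup>2)"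
      by (rule FT_norm[OF FED])
    also have "\<dots> = (LINT x|lborel. (norm (lorentz_op \<kappa> f\<alpha> x - g x))\<^sup>2)"
    proof (rule integral_cong_AE)
      show "(\<lambda>x. (norm (lorentz_op \<kappa> f\<alpha> x - lorentz_op \<kappa> f x))\<^sup>2) \<in> borel_measurable lborel"
        using L2_norm_sq_integrable[OF FT_L2_left[OF FED]] by auto
      have "g \<in> borel_measurable lborel" "lorentz_op \<kappa> f\<alpha> \<in> borel_measurable lborel"
        using assms(5) FT_L2_left[OF FT_lorentz_op[OF \<kappa> FT_fourier[OF f\<alpha>]]]
        by (auto simp: voigt_spectrum_def L2_def)
      then show "(\<lambda>x. (norm (lorentz_op \<kappa> f\<alpha> x - g x))\<^sup>2) \<in> borel_measurable lborel"
        by measurable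
    qed (use assms(7) in \<open>auto elim!: eventually_mono\<close>)
    also have "\<dots> = \<epsilon>\<^sup>2"
    proof -
      have "0 \<le> (LINT x|lborel. (norm (lorentz_op \<kappa> f\<alpha> x - g x))\<^sup>2)" by (rule integral_nonneg_AE) simp
      then have "(L2_norm lborel (\<lambda>x. lorentz_op \<kappa> f\<alpha> x - g x))\<^sup>2 = (LINT x|lborel. (norm (lorentz_op \<kappa> f\<alpha> x - g x))\<^sup>2)"
        unfolding L2_norm_def by simp
      then show ?thesis using H by simp
    qed
    finally have residual: "(LINT \<omega>|lborel. (norm (?E D \<omega>))\<^sup>2) = \<epsilon>\<^sup>2" .
    have form_f\<alpha>: "?form f\<alpha> \<le> ennreal (M\<^sup>2)"
    proof -
      have fin: "?form f\<alpha> < \<infinity>" using H by (simp add: H_space_def)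
      have "sqrt (enn2real (?form f\<alpha>)) \<le> M" using H by (simp add: H_norm_def)
      then have "enn2real (?form f\<alpha>) \<le> M\<^sup>2"
        using real_sqrt_le_iff[of "enn2real (?form f\<alpha>)" "M\<^sup>2"] assms(4) by simp
      then have "ennreal (enn2real (?form f\<alpha>)) \<le> ennreal (M\<^sup>2)" by (rule ennreal_leI)
      then show ?thesis using fin by (simp only: ennreal_enn2real infinity_ennreal_def)
    qed
    have "(\<integral>\<^sup>+\<omega>. ennreal (?P \<omega> * (norm (?E D \<omega>))\<^sup>2) \<partial>lborel)
        \<le> (\<integral>\<^sup>+\<omega>. (2 * ennreal (?P \<omega> * (norm (?E (fourier f\<alpha>) \<omega>))\<^sup>2) + 2 * ennreal (?P \<omega> * (norm (?E (fourier f) \<omega>))\<^sup>2)) \<partial>lborel)"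
    proof (rule nn_integral_mono)
      fix \<omega>
      have P0: "0 \<le> ?P \<omega>" by (simp add: psi_def)
      have "?P \<omega> * (norm (?E D \<omega>))\<^sup>2 \<le> ?P \<omega> * (2 * (norm (?E (fourier f\<alpha>) \<omega>))\<^sup>2 + 2 * (norm (?E (fourier f) \<omega>))\<^sup>2)"
        using norm_add_sq_le[of "?E (fourier f\<alpha>) \<omega>" "- ?E (fourier f) \<omega>"]
        unfolding fun_cong[OF ED] by (intro mult_left_mono P0) simp
      also have "\<dots> = 2 * (?P \<omega> * (norm (?E (fourier f\<alpha>) \<omega>))\<^sup>2) + 2 * (?P \<omega> * (norm (?E (fourier f) \<omega>))\<^sup>2)"
        by (simp only: distrib_left mult_ac)
      finally have "ennreal (?P \<omega> * (norm (?E D \<omega>))\<^sup>2)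
          \<le> ennreal (2 * (?P \<omega> * (norm (?E (fourier f\<alpha>) \<omega>))\<^sup>2) + 2 * (?P \<omega> * (norm (?E (fourier f) \<omega>))\<^sup>2))"
        by (rule ennreal_leI)
      also have "\<dots> = 2 * ennreal (?P \<omega> * (norm (?E (fourier f\<alpha>) \<omega>))\<^sup>2) + 2 * ennreal (?P \<omega> * (norm (?E (fourier f) \<omega>))\<^sup>2)"
        using P0 by (simp only: ennreal_plus ennreal_mult'' ennreal_numeral mult_nonneg_nonneg zero_le_power2 zero_le_numeral)
      finally show "ennreal (?P \<omega> * (norm (?E D \<omega>))\<^sup>2)
          \<le> 2 * ennreal (?P \<omega> * (norm (?E (fourier f\<alpha>) \<omega>))\<^sup>2) + 2 * ennreal (?P \<omega> * (norm (?E (fourier f) \<omega>))\<^sup>2)" .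
    qed
    also have "\<dots> = 2 * ?form f\<alpha> + 2 * ?form f"
      unfolding lorentz_spectral_form[OF \<kappa> f\<alpha>] lorentz_spectral_form[OF \<kappa> f]
      by (subst nn_integral_add) (simp_all add: nn_integral_cmult)
    also have "\<dots> \<le> 2 * ennreal (M\<^sup>2) + 2 * ennreal G"
      unfolding G(1) by (intro add_mono mult_left_mono form_f\<alpha>) auto
    also have "\<dots> = ennreal C"
      unfolding C_def using G(2) by (simp add: ennreal_plus ennreal_mult)
    finally have "(LINT \<omega>|lborel. (norm (D \<omega>))\<^sup>2) \<le> exp (2 * \<kappa> * \<Omega>) * (\<epsilon>\<^sup>2 + exp (- (\<theta> * \<Omega>\<^sup>2)) * C)"
      using cutoff_estimate[OF \<kappa> \<theta> \<Omega> FT_L2_right[OF FD] C] unfolding residual by simp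
    also note bound
    finally have "(LINT x|lborel. (norm (f\<alpha> x - f x))\<^sup>2)
        \<le> (\<epsilon> powr (1 - 2 * \<kappa> / sqrt (\<theta> * \<bar>ln \<epsilon>\<bar> + (1 - \<theta>)\<^sup>2)))\<^sup>2"
      unfolding FT_norm[OF FD] .
    then show "L2_norm lborel (\<lambda>x. f\<alpha> x - f x) \<le> \<epsilon> powr (1 - 2 * \<kappa> / sqrt (\<theta> * \<bar>ln \<epsilon>\<bar> + (1 - \<theta>)\<^sup>2))"
      unfolding L2_norm_def by (intro real_le_lsqrt) auto
  qed
qed

end
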